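(* Let $\alpha>1$, $\alpha'=\alpha/(\alpha-1)$, and let $\{X_{(\varepsilon)},\varepsilon>0\}$ be a family of $D[0,1]$-valued stochastic processes with $X_{(\varepsilon)}(0)=0$ for every $\varepsilon>0$. 1. Suppose there exist constants $c,C\in(0,\infty)$ such that for every $\lambda>0$, every $\varepsilon>0$ and every $0\le t_1\le t\le t_2\le1$, $\mathbb E[\exp(\lambda M(X_{(\varepsilon)}(t_1),X_{(\varepsilon)}(t),X_{(\varepsilon)}(t_2)))]\le c\exp(C(\lambda\varepsilon)^\alpha|t_2-t_1|)$. Then for every $\beta\in(0,1/\alpha)$, $\lim_{N\to\infty}\limsup_{\varepsilon\downarrow0}\varepsilon^{\alpha'}\log P\Big(\bigcup_{n>N}\big\{w_M(X_{(\varepsilon)},2^{-n})>2\frac{2^{-n\beta}}{1-2^{-\beta}}\big\}\Big)=-\infty.$ 2. Suppose further that for some countable dense subset $\mathcal D$ of $[0,1]$ containing $1$, the family of real random variables $\{X_{(\varepsilon)}(q),\varepsilon>0\}$ is exponentially tight with speed $\varepsilon^{-\alpha'}$ for every $q\in\mathcal D$. Then the laws of $X_{(\varepsilon)}$ as $\varepsilon\downarrow0$ are exponentially tight in $(D[0,1],\mathrm{dist})$ with speed $\varepsilon^{-\alpha'}$.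
   Context: $D[0,1]$ is the space of càdlàg functions $f:[0,1]\to\mathbb R$, with the convention $f(0-)=0$. For $x,y,z\in\mathbb R$, $M(x,y,z)=d(y,[x\wedge z,x\vee z])$ is the distance from $y$ to the interval between $x$ and $z$. The $M$-oscillation is $w_M(f,\delta)=\sup\{M(f(t_1-),f(t),f(t_2)):0\le t_1<t<t_2\le1,\ |t_2-t_1|<\delta\}$. Metric $\mathrm{dist}$: let $\Gamma_0(f)=\{(t,x):t\in[0,1],x\text{ between }f(t-)\text{ and }f(t)\}$, ordered by $(t,x)\preceq(u,y)$ iff $t<u$ or ($t=u$ and $|x-f(t-)|\le|y-f(t-)|$); $\Pi(f)$ is the set of increasing bijections $r\mapsto(t(r),x(r))$ of $[0,1]$ onto $\Gamma_0(f)$; $\mathrm{dist}(f_1,f_2)=\inf_{(t_i,x_i)\in\Pi(f_i)}\sup_r|t_1(r)-t_2(r)|\vee|x_1(r)-x_2(r)|$. A family $(Y_\varepsilon)$ of random elements of a space $S$ is exponentially tight with speed $\varepsilon^{-\beta}$ if for each $M<\infty$ there is a compact $K_M\subset S$ with $\limsup_{\varepsilon\downarrow0}\varepsilon^\beta\log P(Y_\varepsilon\notin K_M)\le-M$. *)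

theory Defs
  imports "HOL-Probability.Probability"
begin

text \<open>A cadlag function on [0,1] is represented as a function real => real; only its
  values on [0,1] matter. Right-continuous on [0,1), left limits on (0,1].\<close>

definition cadlag :: "(real \<Rightarrow> real) \<Rightarrow> bool" where
  "cadlag f \<longleftrightarrow> (\<forall>t\<in>{0..<1}. (f \<longlongrightarrow> f t) (at_right t))
                 \<and> (\<forall>t\<in>{0<..1}. \<exists>l. (f \<longlongrightarrow> l) (at_left t))"

definition Dspace :: "(real \<Rightarrow> real) set" where
  "Dspace = {f. cadlag f}"

definition left_lim :: "(real \<Rightarrow> real) \<Rightarrow> real \<Rightarrow> real" where
  "left_lim f t = (if t = 0 then 0 else Lim (at_left t) f)"

definition Mfun :: "real \<Rightarrow> real \<Rightarrow> real \<Rightarrow> real" where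
  "Mfun x y z = infdist y {min x z .. max x z}"

definition wM :: "(real \<Rightarrow> real) \<Rightarrow> real \<Rightarrow> ereal" where
  "wM f \<delta> = Sup {ereal (Mfun (left_lim f t1) (f t) (f t2)) | t1 t t2.
                    0 \<le> t1 \<and> t1 < t \<and> t < t2 \<and> t2 \<le> 1 \<and> \<bar>t2 - t1\<bar> < \<delta>}"

definition Gamma0 :: "(real \<Rightarrow> real) \<Rightarrow> (real \<times> real) set" where
  "Gamma0 f = {(t, x). t \<in> {0..1} \<and> x \<in> {min (left_lim f t) (f t) .. max (left_lim f t) (f t)}}"

definition graph_le :: "(real \<Rightarrow> real) \<Rightarrow> real \<times> real \<Rightarrow> real \<times> real \<Rightarrow> bool" where
  "graph_le f p q \<longleftrightarrow> fst p < fst q \<or>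
     (fst p = fst q \<and> \<bar>snd p - left_lim f (fst p)\<bar> \<le> \<bar>snd q - left_lim f (fst p)\<bar>)"

definition Pi_par :: "(real \<Rightarrow> real) \<Rightarrow> (real \<Rightarrow> real \<times> real) set" where
  "Pi_par f = {p. bij_betw p {0..1} (Gamma0 f) \<and>
                  (\<forall>r\<in>{0..1}. \<forall>r'\<in>{0..1}. r \<le> r' \<longrightarrow> graph_le f (p r) (p r'))}"

definition Mdist :: "(real \<Rightarrow> real) \<Rightarrow> (real \<Rightarrow> real) \<Rightarrow> ereal" where
  "Mdist f g = Inf {(SUP r\<in>{0..1}. ereal (max \<bar>fst (p r) - fst (q r)\<bar> \<bar>snd (p r) - snd (q r)\<bar>))
                     | p q. p \<in> Pi_par f \<and> q \<in> Pi_par g}"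

definition Dtop :: "(real \<Rightarrow> real) topology" where
  "Dtop = topology (\<lambda>U. U \<subseteq> Dspace \<and>
            (\<forall>f\<in>U. \<exists>e>0. {g \<in> Dspace. Mdist f g < ereal e} \<subseteq> U))"

definition outer_prob :: "'a measure \<Rightarrow> 'a set \<Rightarrow> real" where
  "outer_prob M S = Inf {measure M A | A. A \<in> sets M \<and> S \<inter> space M \<subseteq> A}"

text \<open>Exponential tightness of (Y eps), eps > 0, in the topological space T, with speed
  eps powr (-s): for each L there is a compact K with
  limsup_{eps->0} eps^s log P(Y eps \<notin> K) \<le> -L (written out with the limsup unfolded).\<close>
definition exp_tight :: "'a measure \<Rightarrow> real \<Rightarrow> (real \<Rightarrow> 'a \<Rightarrow> 'b) \<Rightarrow> 'b topology \<Rightarrow> bool" where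
  "exp_tight M s Y T \<longleftrightarrow>
     (\<forall>L::real. \<exists>K. compactin T K \<and>
        (\<exists>\<delta>>0. \<forall>\<epsilon>. 0 < \<epsilon> \<and> \<epsilon> < \<delta> \<longrightarrow>
            outer_prob M {\<omega> \<in> space M. Y \<epsilon> \<omega> \<notin> K} \<le> exp (- L / \<epsilon> powr s)))"

end

theory Submission
  imports Defs
begin

text \<open>
  On the event that every triple of neighbouring dyadic points of level \<open>m > N\<close> has \<open>M\<close>-value at most
  \<open>2^{-m \<beta>}\<close>, passing from level \<open>m\<close> to level \<open>m - 1\<close> moves each point to a neighbour at a total cost
  of \<open>2 \<cdot> 2^{-m \<beta>}\<close>, and summing the geometric series controls \<open>w\<^sub>M\<close>. The complement of that event
  is bounded by the exponential Markov inequality with \<open>\<lambda> = \<epsilon>^{-\<alpha>'} 2^{m \<gamma>}\<close>, \<open>\<beta> < \<gamma> < 1/\<alpha>\<close>.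

  For tightness, paths with a common bound and a common \<open>M\<close>-modulus form, after extension to the line, a
  closed subset of a product of compact intervals, which is compact by Tychonoff. The map sending such a
  function to its right-continuous regularisation is continuous into \<open>(D, dist)\<close>: two such paths that are
  close on a fine grid of continuity points are almost monotone between grid points, so their completed
  graphs can be matched cell by cell through their running maxima.
\<close>

section \<open>The chaining bound\<close>

text \<open>The window for \<gamma> balances two effects. A triple of level m spans 2^(1-m), and
  conjugacy gives (1 - \<alpha>') \<alpha> = -\<alpha>', so the moment bound costs 2 C
  \<epsilon>^(-\<alpha>') 2^(m(\<alpha>\<gamma>-1)) in the exponent, while Markov gains
  \<epsilon>^(-\<alpha>') 2^(m(\<gamma>-\<beta>)). Both carry the speed as a factor; \<gamma> <
  1/\<alpha> keeps the cost bounded in m, and \<gamma> > \<beta> lets the gain beat the 2^m triples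
  of level m. For tightness the obstacle is that being cadlag does not survive pointwise limits. The
  compact set therefore contains functions known only through their modulus, and one-sided limits
  are recovered from it. The modulus does not bound the ordinary oscillation: a short cell may
  contain a large jump. Inside a cell one can only say that a path is almost monotone, and two
  graphs are compared by pairing equal heights rather than equal times. Membership in \<Pi>(f) does
  not include continuity, and an empty \<Pi>(f) would make all distances from f infinite, so
  continuity and existence of parametrizations come before the matching.\<close>

lemma Mfun_eq: "Mfun x y z = max 0 (max (min x z - y) (y - max x z))"
proof -
  let ?I = "{min x z .. max x z}"
  have ne: "?I \<noteq> {}" by auto
  \<comment> \<open>The nearest point of the interval is \<open>y\<close> clamped to it.\<close>
  define p where "p = max (min x z) (min y (max x z))"
  have p: "p \<in> ?I" unfolding p_def by auto
  have d: "dist y p = max 0 (max (min x z - y) (y - max x z))"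
    unfolding p_def dist_real_def by (auto simp: max_def min_def)
  have "infdist y ?I \<le> dist y p" using p by (rule infdist_le)
  moreover have "dist y p \<le> infdist y ?I"
    unfolding infdist_notempty[OF ne]
  proof (rule cINF_greatest[OF ne])
    fix a assume "a \<in> ?I"
    then show "dist y p \<le> dist y a" unfolding d by (auto simp: dist_real_def)
  qed
  ultimately show ?thesis unfolding Mfun_def d by (rule antisym)
qed

lemma Mfun_le_iff: "0 \<le> e \<Longrightarrow> Mfun x y z \<le> e \<longleftrightarrow> min x z \<le> y + e \<and> y \<le> max x z + e"
  unfolding Mfun_eq by auto

lemma Mfun_sym: "Mfun x y z = Mfun z y x"
  unfolding Mfun_def by (simp add: min.commute max.commute)

lemma Mfun_nonneg: "0 \<le> Mfun x y z"
  unfolding Mfun_eq by simp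

lemma Mfun_left [simp]: "Mfun x x z = 0" and Mfun_right [simp]: "Mfun x z z = 0"
  unfolding Mfun_eq by auto

lemma tendsto_Mfun:
  assumes "(f \<longlongrightarrow> x) F" "(g \<longlongrightarrow> y) F" "(h \<longlongrightarrow> z) F"
  shows "((\<lambda>s. Mfun (f s) (g s) (h s)) \<longlongrightarrow> Mfun x y z) F"
  unfolding Mfun_eq by (intro tendsto_intros assms)

lemma continuous_on_Mfun [continuous_intros]:
  assumes "continuous_on S f" "continuous_on S g" "continuous_on S h"
  shows "continuous_on S (\<lambda>s. Mfun (f s) (g s) (h s))"
  unfolding Mfun_eq by (intro continuous_intros assms)

lemma measurable_Mfun [measurable]:
  assumes "f \<in> borel_measurable M" "g \<in> borel_measurable M" "h \<in> borel_measurable M"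
  shows "(\<lambda>x. Mfun (f x) (g x) (h x)) \<in> borel_measurable M"
  unfolding Mfun_eq using assms by measurable

text \<open>When \<open>y\<close> sticks out above, raising the ends or lowering the middle are the
  only ways to lose. The errors are therefore one-sided, which leaves room to choose a suitable
  neighbour for each of the three points.\<close>

lemma Mfun_le_exposed_above:
  assumes "max x z \<le> y" "x' \<le> x + e" "z' \<le> z + e" "y \<le> y' + e"
  shows "Mfun x y z \<le> Mfun x' y' z' + 2*e"
proof -
  have "Mfun x y z = y - max x z" using assms(1) unfolding Mfun_eq by linarith
  moreover have "max x' z' \<le> max x z + e" using assms(2,3) by linarith
  moreover have "y' - max x' z' \<le> Mfun x' y' z'" unfolding Mfun_eq by simp
  ultimately show ?thesis using assms(4) by linarith
qed

lemma Mfun_le_exposed_below: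
  assumes "y \<le> min x z" "x \<le> x' + e" "z \<le> z' + e" "y' \<le> y + e"
  shows "Mfun x y z \<le> Mfun x' y' z' + 2*e"
proof -
  have "Mfun x y z = min x z - y" using assms(1) unfolding Mfun_eq by linarith
  moreover have "min x z \<le> min x' z' + e" using assms(2,3) by linarith
  moreover have "min x' z' - y' \<le> Mfun x' y' z'" unfolding Mfun_eq by simp
  ultimately show ?thesis using assms(4) by linarith
qed

text \<open>Coarsening one dyadic level: every point of odd index is replaced by the neighbour that
  keeps the middle point exposed, which costs at most \<open>e\<close> for the middle and \<open>e\<close> for the ends.\<close>

lemma Mfun_dyadic_coarsen:
  fixes f :: "nat \<Rightarrow> real"
  assumes e: "0 \<le> e"
    and odd: "\<And>k. k < K \<Longrightarrow> Mfun (f (2*k)) (f (2*k+1)) (f (2*k+2)) \<le> e"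
    and le: "a \<le> b" "b \<le> c" and lo: "2*l \<le> a" and hi: "c \<le> 2*h" "h \<le> K"
  shows "\<exists>a' b' c'. l \<le> a' \<and> a' \<le> b' \<and> b' \<le> c' \<and> c' \<le> h \<and>
           Mfun (f a) (f b) (f c) \<le> Mfun (f (2*a')) (f (2*b')) (f (2*c')) + 2*e"
proof -
  \<comment> \<open>A value of odd index is at most the larger even neighbour plus \<open>e\<close>
    and at least the smaller one minus \<open>e\<close>. So one neighbour serves as an upper and one
    as a lower replacement, possibly on different sides.\<close>
  have up: "\<exists>i'. i div 2 \<le> i' \<and> i' \<le> (i+1) div 2 \<and> f i \<le> f (2*i') + e"
    and dn: "\<exists>i'. i div 2 \<le> i' \<and> i' \<le> (i+1) div 2 \<and> f (2*i') \<le> f i + e" if "i \<le> 2*K" for i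
  proof -
    consider (ev) k where "i = 2*k" | (od) k where "i = 2*k+1" by (metis evenE oddE)
    then have "(\<exists>i'. i div 2 \<le> i' \<and> i' \<le> (i+1) div 2 \<and> f i \<le> f (2*i') + e) \<and>
        (\<exists>i'. i div 2 \<le> i' \<and> i' \<le> (i+1) div 2 \<and> f (2*i') \<le> f i + e)"
    proof cases
      case ev then show ?thesis using e by (intro conjI exI[of _ k]) auto
    next
      case od
      then have "k < K" using that by simp
      from odd[OF this] have m: "min (f (2*k)) (f (2*k+2)) \<le> f i + e"
          "f i \<le> max (f (2*k)) (f (2*k+2)) + e"
        unfolding Mfun_le_iff[OF e] od by auto
      have "f i \<le> f (2*k) + e \<or> f i \<le> f (2*(k+1)) + e" using m(2) by (auto simp: max_def split: if_splits)
      moreover have "f (2*k) \<le> f i + e \<or> f (2*(k+1)) \<le> f i + e" using m(1) by (auto simp: min_def split: if_splits)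
      moreover have "i div 2 = k" "(i+1) div 2 = k+1" using od by auto
      ultimately show ?thesis by (metis le_add1 le_refl)
    qed
    then show "\<exists>i'. i div 2 \<le> i' \<and> i' \<le> (i+1) div 2 \<and> f i \<le> f (2*i') + e"
      "\<exists>i'. i div 2 \<le> i' \<and> i' \<le> (i+1) div 2 \<and> f (2*i') \<le> f i + e" by auto
  qed
  have bd: "a \<le> 2*K" "b \<le> 2*K" "c \<le> 2*K" using le hi by auto
  consider (z) "Mfun (f a) (f b) (f c) = 0" | (lt) "a < b" "b < c"
    using le by (metis Mfun_left Mfun_right le_neq_implies_less)
  then show ?thesis
  proof cases
    case z
    have "l \<le> h" using le lo hi by simp
    then show ?thesis using z e Mfun_nonneg
      by (intro exI[of _ l]) auto
  next
    case lt
    \<comment> \<open>For i < j even opposite roundings keep the order, since i + 1 \<le> j. Equal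
      indices could be rounded past each other; they were disposed of beforehand, because there the
      \<open>M\<close>-value is 0.\<close>
    have sep: "i' \<le> j'" if "i < j" "i' \<le> (i+1) div 2" "j div 2 \<le> j'" for i j i' j' :: nat
      using that by presburger
    have lo': "l \<le> i'" if "a \<le> i" "i div 2 \<le> i'" for i i' using lo that by presburger
    have hi': "i' \<le> h" if "i \<le> c" "i' \<le> (i+1) div 2" for i i' using hi that by presburger
    show ?thesis
    proof (cases "f b \<ge> max (f a) (f c)")
      case True
      obtain a' where a': "a div 2 \<le> a'" "a' \<le> (a+1) div 2" "f (2*a') \<le> f a + e" using dn bd by blast
      obtain b' where b': "b div 2 \<le> b'" "b' \<le> (b+1) div 2" "f b \<le> f (2*b') + e" using up bd by blast
      obtain c' where c': "c div 2 \<le> c'" "c' \<le> (c+1) div 2" "f (2*c') \<le> f c + e" using dn bd by blast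
      have "Mfun (f a) (f b) (f c) \<le> Mfun (f (2*a')) (f (2*b')) (f (2*c')) + 2*e"
        using True c'(3) b'(3) a'(3) by (intro Mfun_le_exposed_above)
      moreover have "l \<le> a'" "a' \<le> b'" "b' \<le> c'" "c' \<le> h"
        using sep[OF lt(1) a'(2) b'(1)] sep[OF lt(2) b'(2) c'(1)] lo'[OF order_refl a'(1)] hi'[OF order_refl c'(2)] by blast+
      ultimately show ?thesis by blast
    next
      case F: False
      show ?thesis
      proof (cases "f b \<le> min (f a) (f c)")
        case True
        obtain a' where a': "a div 2 \<le> a'" "a' \<le> (a+1) div 2" "f a \<le> f (2*a') + e" using up bd by blast
        obtain b' where b': "b div 2 \<le> b'" "b' \<le> (b+1) div 2" "f (2*b') \<le> f b + e" using dn bd by blast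
        obtain c' where c': "c div 2 \<le> c'" "c' \<le> (c+1) div 2" "f c \<le> f (2*c') + e" using up bd by blast
        have "Mfun (f a) (f b) (f c) \<le> Mfun (f (2*a')) (f (2*b')) (f (2*c')) + 2*e"
          using True a'(3) b'(3) c'(3) by (intro Mfun_le_exposed_below)
        moreover have "l \<le> a'" "a' \<le> b'" "b' \<le> c'" "c' \<le> h"
          using sep[OF lt(1) a'(2) b'(1)] sep[OF lt(2) b'(2) c'(1)] lo'[OF order_refl a'(1)] hi'[OF order_refl c'(2)] by blast+
        ultimately show ?thesis by blast
      next
        case False
        have "min (f a) (f c) - f b \<le> 0" "f b - max (f a) (f c) \<le> 0"
          using F False by (simp_all only: not_le diff_le_0_iff_le less_imp_le)
        then have "Mfun (f a) (f b) (f c) = 0" unfolding Mfun_eq by (intro max_absorb1 max.boundedI)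
        moreover have "l \<le> h" using le lo hi by simp
        ultimately show ?thesis using e Mfun_nonneg by (intro exI[of _ l]) auto
      qed
    qed
  qed
qed

definition dyadic_control :: "(real \<Rightarrow> real) \<Rightarrow> nat \<Rightarrow> real \<Rightarrow> bool" where
  "dyadic_control f N \<beta> \<longleftrightarrow> (\<forall>m>N. \<forall>k. 1 \<le> k \<and> k < (2::nat)^m \<longrightarrow>
     Mfun (f ((real k - 1) / 2^m)) (f (real k / 2^m)) (f ((real k + 1) / 2^m)) \<le> 2 powr (- real m * \<beta>))"

text \<open>The indices stay in the window of two cells of level \<open>n\<close> around
  \<open>k\<close>. Its ends remain grid points at every coarser level, so coarsening never leaves
  it; after \<open>j\<close> steps only the triple k-1, k, k+1 of level \<open>n\<close> is left, to
  which the control applies directly.\<close>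

lemma Mfun_dyadic_chain:
  assumes dc: "dyadic_control f N \<beta>" and n: "n > N" and k: "1 \<le> k" "k < (2::nat)^n"
    and "(k-1) * 2^j \<le> a" "a \<le> b" "b \<le> c" "c \<le> (k+1) * 2^j"
  shows "Mfun (f (real a / 2^(n+j))) (f (real b / 2^(n+j))) (f (real c / 2^(n+j)))
     \<le> 2 * (\<Sum>i\<le>j. 2 powr (- real (n+i) * \<beta>)) "
  using assms(5-8)
proof (induction j arbitrary: a b c)
  case 0
  have abc: "a \<in> {k-1,k,k+1}" "b \<in> {k-1,k,k+1}" "c \<in> {k-1,k,k+1}" using 0 k by auto
  have "Mfun (f (real a / 2^n)) (f (real b / 2^n)) (f (real c / 2^n)) \<le> 2 powr (- real n * \<beta>)"
  proof (cases "a = b \<or> b = c")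
    case True then show ?thesis by auto
  next
    case False
    then have "a = k - 1" "b = k" "c = k + 1" using abc 0 by auto
    then show ?thesis using dc n k unfolding dyadic_control_def by (auto simp: of_nat_diff add.commute)
  qed
  also have "\<dots> \<le> 2 * 2 powr (- real n * \<beta>)" by simp
  finally show ?case by simp
next
  case (Suc j)
  let ?m = "n + Suc j"
  let ?g = "\<lambda>i::nat. f (real i / 2 ^ ?m)"
  have half: "?g (2*i) = f (real i / 2^(n+j))" for i by (simp add: field_simps)
  have odd: "Mfun (?g (2*i)) (?g (2*i+1)) (?g (2*i+2)) \<le> 2 powr (- real ?m * \<beta>)"
    if "i < 2^(n+j)" for i
  proof -
    have "?m > N" "1 \<le> 2*i+1" "2*i+1 < 2^?m" using n that by auto
    then show ?thesis using dc unfolding dyadic_control_def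
      by (metis (no_types, lifting) add_diff_cancel_right' of_nat_1 of_nat_add add.assoc one_add_one)
  qed
  have "(k+1) * 2^j \<le> 2^(n+j)" using k unfolding power_add by (intro mult_le_mono1) simp
  then obtain a' b' c' where "(k-1)*2^j \<le> a'" "a' \<le> b'" "b' \<le> c'" "c' \<le> (k+1)*2^j"
    "Mfun (?g a) (?g b) (?g c) \<le> Mfun (?g (2*a')) (?g (2*b')) (?g (2*c')) + 2*2 powr (- real ?m * \<beta>)"
    using Mfun_dyadic_coarsen[of "2 powr (- real ?m * \<beta>)" "2^(n+j)" ?g a b c "(k-1)*2^j" "(k+1)*2^j", OF _ odd]
      Suc.prems by (auto simp: mult.assoc mult.commute mult.left_commute)
  with Suc.IH[of a' b' c'] show ?case unfolding half by (simp add: algebra_simps)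
qed

text \<open>The sum of 2 * 2^(-m \<beta>) over all m \<ge> n, which is the threshold in the first
  claim of the theorem.\<close>

definition chain_bound :: "real \<Rightarrow> nat \<Rightarrow> real" where
  "chain_bound \<beta> n = 2 * (2 powr (- real n * \<beta>) / (1 - 2 powr (- \<beta>)))"

lemma sum_powr_le_chain_bound:
  assumes "0 < \<beta>"
  shows "2 * (\<Sum>i\<le>j. 2 powr (- real (n+i) * \<beta>)) \<le> chain_bound \<beta> n"
proof -
  let ?x = "2 powr (-\<beta>)"
  have x: "0 < ?x" "?x < 1" using assms by (auto intro: powr_less_one)
  have "2 powr (- real (n+i) * \<beta>) = 2 powr (- real n * \<beta>) * ?x ^ i" for i
    by (simp add: powr_realpow[symmetric] powr_powr powr_add[symmetric] algebra_simps)
  then have "(\<Sum>i\<le>j. 2 powr (- real (n+i) * \<beta>)) = 2 powr (- real n * \<beta>) * (\<Sum>i\<le>j. ?x ^ i)"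
    by (simp add: sum_distrib_left)
  also have "(\<Sum>i\<le>j. ?x ^ i) \<le> 1 / (1 - ?x)"
  proof -
    have "(\<Sum>i\<le>j. ?x ^ i) \<le> (\<Sum>i. ?x ^ i)"
      by (rule sum_le_suminf) (use x in \<open>auto intro: summable_geometric\<close>)
    then show ?thesis using x by (simp add: suminf_geometric)
  qed
  finally show ?thesis unfolding chain_bound_def by (simp add: mult_left_mono)
qed

lemma chain_bound_tendsto_0:
  assumes "0 < \<beta>"
  shows "chain_bound \<beta> \<longlonglongrightarrow> 0"
proof -
  let ?x = "2 powr (-\<beta>)"
  have x: "0 < ?x" "?x < 1" using assms by (auto intro: powr_less_one)
  have "chain_bound \<beta> = (\<lambda>n. 2 * (?x ^ n / (1 - ?x)))"
    unfolding chain_bound_def by (auto simp: powr_realpow[symmetric] powr_powr algebra_simps)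
  moreover have "(\<lambda>n. 2 * (?x ^ n / (1 - ?x))) \<longlonglongrightarrow> 2 * (0 / (1 - ?x))"
    by (intro tendsto_intros LIMSEQ_power_zero) (use x in auto)
  ultimately show ?thesis by simp
qed

lemma chain_bound_pos: "0 < \<beta> \<Longrightarrow> 0 < chain_bound \<beta> n"
  unfolding chain_bound_def by (auto intro!: mult_pos_pos divide_pos_pos powr_less_one)

text \<open>Adding 1 to the floor keeps the approximants strictly to the right of \<open>t\<close>,
  also for dyadic \<open>t\<close>, as a limit at \<open>at_right t\<close> demands.\<close>

lemma dyadic_approx_right:
  assumes "0 \<le> t" "t < 1"
  shows "filterlim (\<lambda>j. (real_of_int \<lfloor>t * 2^j\<rfloor> + 1) / 2^j) (at_right t) sequentially"
proof -
  let ?a = "\<lambda>j. (real_of_int \<lfloor>t * 2^j\<rfloor> + 1) / 2^j"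
  have gt: "t < ?a j" for j :: nat
    using floor_correct[of "t * 2^j"] by (simp add: field_simps)
  have le: "?a j \<le> t + (1/2)^j" for j :: nat
    using floor_correct[of "t * 2^j"] by (simp add: field_simps power_one_over)
  have "(\<lambda>j. t + (1/2::real)^j) \<longlonglongrightarrow> t + 0" by (intro tendsto_intros) auto
  then have "?a \<longlonglongrightarrow> t"
    by (intro tendsto_sandwich[of "\<lambda>_. t" ?a sequentially "\<lambda>j. t + (1/2)^j"])
       (use gt le in \<open>auto intro!: always_eventually less_imp_le\<close>)
  then show ?thesis unfolding filterlim_at using gt less_imp_neq[OF gt]
    by (metis (mono_tags, lifting) always_eventually greaterThan_iff)
qed

text \<open>An interval shorter than one cell of level \<open>n\<close> meets at most two adjacent
  cells, hence fits into a window centred at an interior grid point of that level.\<close>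

lemma Mfun_dyadic_triple:
  assumes dc: "dyadic_control f N \<beta>" and b: "0 < \<beta>" and n: "n > N"
    and abc: "a \<le> b" "b \<le> c" "c \<le> (2::nat)^(n+j)" and len: "real c / 2^(n+j) - real a / 2^(n+j) < 1/2^n"
  shows "Mfun (f (real a / 2^(n+j))) (f (real b / 2^(n+j))) (f (real c / 2^(n+j))) \<le> chain_bound \<beta> n"
proof -
  have "(real c - real a) / 2^(n+j) < 1/2^n" using len by (simp add: diff_divide_distrib)
  then have "real c - real a < 1/2^n * 2^(n+j)" by (subst (asm) pos_divide_less_eq) auto
  then have "real c - real a < 2^j" by (simp add: power_add)
  then have "real c < real (a + 2^j)" by simp
  then have ca: "c < a + 2^j" by (simp only: of_nat_less_iff)
  \<comment> \<open>The right end of the level \<open>n\<close> cell containing \<open>a\<close>,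
    capped at 2^n - 1 so that the window around it does not reach beyond 1.\<close>
  define k where "k = max 1 (min (a div 2^j + 1) (2^n - 1))"
  have n2: "(2::nat)^n \<ge> 2" using n self_le_power[of "2::nat" n] by simp
  have k: "1 \<le> k" "k < 2^n" using n2 unfolding k_def by auto
  have dm: "a div 2^j * 2^j \<le> a" "a < (a div 2^j + 1) * 2^j"
    by (simp_all add: div_times_less_eq_dividend dividend_less_div_times)
  have "(k-1) \<le> a div 2^j" unfolding k_def by auto
  then have 1: "(k-1) * 2^j \<le> a" using dm(1) by (meson le_trans mult_le_mono1)
  have 2: "c \<le> (k+1) * 2^j"
  proof (cases "a div 2^j + 1 \<le> 2^n - 1")
    case True
    then have "k = a div 2^j + 1" unfolding k_def by simp
    then show ?thesis using dm ca by simp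
  next
    case False
    then have "k = 2^n - 1" unfolding k_def using n2 by simp
    then have "k + 1 = 2^n" by simp
    then show ?thesis using abc by (simp add: power_add)
  qed
  from Mfun_dyadic_chain[OF dc n k 1 abc(1,2) 2] sum_powr_le_chain_bound[OF b, of n j]
  show ?thesis by linarith
qed

lemma Mfun_le_chain_bound:
  assumes dc: "dyadic_control f N \<beta>" and b: "0 < \<beta>" and n: "n > N"
    and D: "f \<in> Dspace"
    and stu: "0 \<le> s" "s < t" "t < u" "u \<le> 1" and len: "u - s < 1/2^n"
  shows "Mfun (f s) (f t) (f u) \<le> chain_bound \<beta> n"
proof -
  \<comment> \<open>A point of level \<open>j\<close> strictly to the right of \<open>t\<close>; at
    \<open>t = 1\<close> there is no room on the right, but 1 is itself dyadic.\<close>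
  define d where "d t j = (if t = 1 then 1 else (real_of_int \<lfloor>t * 2^j\<rfloor> + 1) / 2^j)" for t :: real and j :: nat
  have dn: "\<exists>a::nat. a \<le> 2^j \<and> d t j = real a / 2^j" if "0 \<le> t" "t \<le> 1" for t j
  proof (cases "t = 1")
    case True then show ?thesis unfolding d_def by (intro exI[of _ "2^j"]) auto
  next
    case False
    have "\<lfloor>t * 2^j\<rfloor> < 2^j" using that False by (simp add: floor_less_iff)
    moreover have "0 \<le> \<lfloor>t * 2^j\<rfloor>" using that by simp
    ultimately have "nat (\<lfloor>t * 2^j\<rfloor> + 1) \<le> 2^j" "real (nat (\<lfloor>t * 2^j\<rfloor> + 1)) = real_of_int \<lfloor>t * 2^j\<rfloor> + 1"
      by (auto simp: nat_le_iff)
    then show ?thesis using False unfolding d_def by (intro exI[of _ "nat (\<lfloor>t * 2^j\<rfloor> + 1)"]) auto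
  qed
  have lim: "d t \<longlonglongrightarrow> t" if "0 \<le> t" "t \<le> 1" for t
  proof (cases "t = 1")
    case False
    then show ?thesis using dyadic_approx_right[of t] that unfolding d_def filterlim_at by auto
  qed (simp add: d_def[abs_def])
  have flim: "(\<lambda>j. f (d t j)) \<longlonglongrightarrow> f t" if "0 \<le> t" "t \<le> 1" for t
  proof (cases "t = 1")
    case False
    have "(f \<longlongrightarrow> f t) (at_right t)" using D that False unfolding Dspace_def cadlag_def by auto
    then show ?thesis using dyadic_approx_right[of t] that False unfolding d_def
      by (auto intro: filterlim_compose)
  qed (auto simp: d_def)
  have "(\<lambda>j. Mfun (f (d s j)) (f (d t j)) (f (d u j))) \<longlonglongrightarrow> Mfun (f s) (f t) (f u)"
    by (intro tendsto_Mfun flim) (use stu in auto)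
  moreover have "\<forall>\<^sub>F j in sequentially. Mfun (f (d s j)) (f (d t j)) (f (d u j)) \<le> chain_bound \<beta> n"
  proof -
    have e1: "\<forall>\<^sub>F j in sequentially. d t j - d s j > 0"
      using tendsto_diff[OF lim[of t] lim[of s]] stu by (intro order_tendstoD(1)[of _ "t-s"]) auto
    have e2: "\<forall>\<^sub>F j in sequentially. d u j - d t j > 0"
      using tendsto_diff[OF lim[of u] lim[of t]] stu by (intro order_tendstoD(1)[of _ "u-t"]) auto
    have e3: "\<forall>\<^sub>F j in sequentially. d u j - d s j < 1/2^n"
      using tendsto_diff[OF lim[of u] lim[of s]] stu len by (intro order_tendstoD(2)[of _ "u-s"]) auto
    show ?thesis using e1 e2 e3 eventually_ge_at_top[of n]
    proof eventually_elim
      case (elim j)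
      obtain i where i: "j = n + i" using elim(4) le_Suc_ex by blast
      obtain a b c where abc: "d s j = real a / 2^j" "d t j = real b / 2^j" "d u j = real c / 2^j" "c \<le> 2^j"
        using dn[of s j] dn[of t j] dn[of u j] stu by auto
      have "a \<le> b" "b \<le> c" using elim(1,2) unfolding abc by (auto simp: field_simps)
      then show ?case using Mfun_dyadic_triple[OF dc b n, of a b c i] elim(3) abc unfolding i by auto
    qed
  qed
  ultimately show ?thesis by (rule tendsto_upperbound) simp
qed

lemma tendsto_left_lim:
  assumes "f \<in> Dspace" "0 < t" "t \<le> 1"
  shows "(f \<longlongrightarrow> left_lim f t) (at_left t)"
proof -
  obtain l where l: "(f \<longlongrightarrow> l) (at_left t)" using assms unfolding Dspace_def cadlag_def by (fastforce simp: Ball_def)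
  then have "Lim (at_left t) f = l" by (intro tendsto_Lim trivial_limit_at_left_real)
  then show ?thesis using l assms unfolding left_lim_def by simp
qed

text \<open>Since the length condition in \<open>wM\<close> is strict, \<open>t1\<close> may be
  moved slightly to the left, and the bound for \<open>f s\<close> passes to the left limit. At
  \<open>t1 = 0\<close> the convention f(0-) = 0 agrees with \<open>f 0 = 0\<close>.\<close>

lemma wM_le_chain_bound:
  assumes dc: "dyadic_control f N \<beta>" and b: "0 < \<beta>" and n: "n > N"
    and D: "f \<in> Dspace" and f0: "f 0 = 0"
  shows "wM f (2 powr (- real n)) \<le> ereal (chain_bound \<beta> n)"
  unfolding wM_def
proof (rule Sup_least, clarify)
  fix t1 t t2 :: real
  assume *: "0 \<le> t1" "t1 < t" "t < t2" "t2 \<le> 1" "\<bar>t2 - t1\<bar> < 2 powr (- real n)"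
  have p2: "2 powr (- real n) = 1/2^n" by (simp add: powr_minus_divide powr_realpow)
  have "Mfun (left_lim f t1) (f t) (f t2) \<le> chain_bound \<beta> n"
  proof (cases "t1 = 0")
    case True
    then have "left_lim f t1 = f t1" unfolding left_lim_def using f0 by simp
    then show ?thesis using Mfun_le_chain_bound[OF dc b n D, of t1 t t2] * p2 by auto
  next
    case False
    have "((\<lambda>s. Mfun (f s) (f t) (f t2)) \<longlongrightarrow> Mfun (left_lim f t1) (f t) (f t2)) (at_left t1)"
      by (intro tendsto_Mfun tendsto_left_lim tendsto_const) (use * D False in auto)
    moreover have "\<forall>\<^sub>F s in at_left t1. Mfun (f s) (f t) (f t2) \<le> chain_bound \<beta> n"
    proof -
      have "max 0 (t2 - 1/2^n) < t1" using * False p2 by auto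
      then have "\<forall>\<^sub>F s in at_left t1. s \<in> {max 0 (t2 - 1/2^n)<..<t1}" by (rule eventually_at_left_real)
      then show ?thesis
        by eventually_elim (rule Mfun_le_chain_bound[OF dc b n D], use * in auto)
    qed
    ultimately show ?thesis by (rule tendsto_upperbound) simp
  qed
  then show "ereal (Mfun (left_lim f t1) (f t) (f t2)) \<le> ereal (chain_bound \<beta> n)" by simp
qed

section \<open>Exponential moments\<close>

lemma outer_prob_le:
  assumes "A \<in> sets M" "S \<inter> space M \<subseteq> A"
  shows "outer_prob M S \<le> measure M A"
  unfolding outer_prob_def
  by (rule cInf_lower) (use assms in \<open>auto intro!: bdd_belowI[of _ 0]\<close>)

lemma outer_prob_mono:
  assumes "S \<inter> space M \<subseteq> T"
  shows "outer_prob M S \<le> outer_prob M T"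
  unfolding outer_prob_def
proof (rule cInf_superset_mono)
  show "{measure M A |A. A \<in> sets M \<and> T \<inter> space M \<subseteq> A} \<noteq> {}"
    using sets.top by blast
  show "bdd_below {measure M A |A. A \<in> sets M \<and> S \<inter> space M \<subseteq> A}"
    by (auto intro!: bdd_belowI[of _ 0])
  show "{measure M A |A. A \<in> sets M \<and> T \<inter> space M \<subseteq> A} \<subseteq> {measure M A |A. A \<in> sets M \<and> S \<inter> space M \<subseteq> A}"
    using assms by blast
qed

lemma outer_prob_less_obtain:
  assumes "outer_prob M S < x"
  obtains A where "A \<in> sets M" "S \<inter> space M \<subseteq> A" "measure M A < x"
proof -
  have "{measure M A |A. A \<in> sets M \<and> S \<inter> space M \<subseteq> A} \<noteq> {}" using sets.top by blast
  from cInf_lessD[OF this assms[unfolded outer_prob_def]] that show ?thesis by blast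
qed

lemma outer_prob_Un_le:
  assumes "prob_space M"
  shows "outer_prob M (S \<union> T) \<le> outer_prob M S + outer_prob M T"
proof (rule field_le_epsilon)
  interpret prob_space M by fact
  fix e :: real assume e: "e > 0"
  obtain A where A: "A \<in> sets M" "S \<inter> space M \<subseteq> A" "measure M A < outer_prob M S + e/2"
    using outer_prob_less_obtain[of M S "outer_prob M S + e/2"] e by (metis half_gt_zero less_add_same_cancel1)
  obtain B where B: "B \<in> sets M" "T \<inter> space M \<subseteq> B" "measure M B < outer_prob M T + e/2"
    using outer_prob_less_obtain[of M T "outer_prob M T + e/2"] e by (metis half_gt_zero less_add_same_cancel1)
  have "outer_prob M (S \<union> T) \<le> measure M (A \<union> B)" using A B by (intro outer_prob_le) auto
  also have "\<dots> \<le> measure M A + measure M B" using A B by (intro measure_Un_le) auto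
  finally show "outer_prob M (S \<union> T) \<le> outer_prob M S + outer_prob M T + e" using A B by simp
qed

lemma outer_prob_UN_le:
  assumes "prob_space M" "finite I"
  shows "outer_prob M (\<Union>i\<in>I. S i) \<le> (\<Sum>i\<in>I. outer_prob M (S i))"
  using assms(2)
proof induction
  case empty
  show ?case using outer_prob_le[of "{}" M "{}"] by simp
next
  case (insert i I)
  then show ?case using outer_prob_Un_le[OF assms(1), of "S i" "\<Union>i\<in>I. S i"] by simp
qed

lemma exponential_Markov:
  assumes "prob_space M" and Y [measurable]: "Y \<in> borel_measurable M" and lam: "0 < lam" and B: "0 \<le> B"
    and bd: "(\<integral>\<^sup>+ \<omega>. ennreal (exp (lam * Y \<omega>)) \<partial>M) \<le> ennreal B"
  shows "measure M {\<omega> \<in> space M. a < Y \<omega>} \<le> B * exp (- lam * a)"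
proof -
  interpret prob_space M by fact
  let ?u = "\<lambda>\<omega>. ennreal (exp (lam * Y \<omega>))"
  let ?c = "ennreal (exp (- lam * a))"
  have "{\<omega> \<in> space M. a < Y \<omega>} \<subseteq> {\<omega> \<in> space M. 1 \<le> ?c * ?u \<omega>}"
  proof safe
    fix \<omega> assume "a < Y \<omega>"
    then have "lam * a \<le> lam * Y \<omega>" using lam by (intro mult_left_mono) auto
    then have "1 \<le> exp (- lam * a) * exp (lam * Y \<omega>)" by (simp add: mult_exp_exp)
    then show "1 \<le> ?c * ?u \<omega>" by (simp add: ennreal_mult[symmetric] ennreal_1[symmetric] del: ennreal_1)
  qed
  then have "emeasure M {\<omega> \<in> space M. a < Y \<omega>} \<le> emeasure M {\<omega> \<in> space M. 1 \<le> ?c * ?u \<omega>}"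
    by (intro emeasure_mono) auto
  also have "\<dots> \<le> ?c * (\<integral>\<^sup>+ \<omega>. ?u \<omega> * indicator (space M) \<omega> \<partial>M)"
    by (intro nn_integral_Markov_inequality) auto
  also have "(\<integral>\<^sup>+ \<omega>. ?u \<omega> * indicator (space M) \<omega> \<partial>M) = (\<integral>\<^sup>+ \<omega>. ?u \<omega> \<partial>M)"
    by (intro nn_integral_cong) auto
  also have "?c * \<dots> \<le> ?c * ennreal B" using bd by (intro mult_left_mono) auto
  also have "\<dots> = ennreal (B * exp (- lam * a))" using B by (simp add: ennreal_mult[symmetric] mult.commute)
  finally show ?thesis using B unfolding emeasure_eq_measure by (subst (asm) ennreal_le_iff) auto
qed

lemma powr_neg_tendsto_at_top:
  assumes "0 < (a::real)"
  shows "filterlim (\<lambda>x. x powr (- a)) at_top (at_right 0)"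
proof -
  have "filterlim (\<lambda>x::real. exp (a * - ln x)) at_top (at_right 0)"
    by (intro filterlim_compose[OF exp_at_top] filterlim_tendsto_pos_mult_at_top[OF tendsto_const assms]
          filterlim_compose[OF filterlim_uminus_at_top_at_bot ln_at_0])
  moreover have "\<forall>\<^sub>F x in at_right 0. exp (a * - ln x) = x powr (- a)"
    using eventually_at_right_less by eventually_elim (simp add: powr_def)
  ultimately show ?thesis by (rule filterlim_mono_eventually[OF _ order_refl order_refl])
qed

text \<open>Asking for the rate \<open>L + 1\<close> leaves a spare factor exp(-\<epsilon>^(-s)),
  which absorbs any constant \<open>K\<close>: the sum of a series in the chaining bound, the number
  of exceptional events in the tightness proof.\<close>

lemma eventually_exp_absorbs_const:
  assumes "0 < (s::real)"
  shows "\<exists>\<delta>>0. \<forall>\<epsilon>. 0 < \<epsilon> \<and> \<epsilon> < \<delta> \<longrightarrow> 1 \<le> \<epsilon> powr (- s) \<and> K * exp (- (L+1) * \<epsilon> powr (- s)) \<le> exp (- L / \<epsilon> powr s)"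
proof -
  have "\<forall>\<^sub>F \<epsilon> in at_right 0. max 1 K \<le> \<epsilon> powr (- s)"
    using powr_neg_tendsto_at_top[OF assms] unfolding filterlim_at_top by blast
  then obtain \<delta> where d: "\<delta> > 0" "\<And>\<epsilon>. 0 < \<epsilon> \<Longrightarrow> \<epsilon> < \<delta> \<Longrightarrow> max 1 K \<le> \<epsilon> powr (- s)"
    unfolding eventually_at_right_field by auto
  show ?thesis
  proof (intro exI[of _ \<delta>] conjI allI impI)
    fix \<epsilon> :: real assume "0 < \<epsilon> \<and> \<epsilon> < \<delta>"
    then have q: "max 1 K \<le> \<epsilon> powr (- s)" (is "_ \<le> ?q") using d by auto
    then show "1 \<le> ?q" by simp
    have "K \<le> exp ?q" using q exp_ge_add_one_self[of ?q] by linarith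
    then have "K * exp (- (L+1) * ?q) \<le> exp ?q * exp (- (L+1) * ?q)" by (intro mult_right_mono) auto
    also have "\<dots> = exp (- L * ?q)" by (simp add: mult_exp_exp algebra_simps)
    also have "- L * ?q = - L / \<epsilon> powr s" by (simp add: powr_minus divide_inverse)
    finally show "K * exp (- (L+1) * ?q) \<le> exp (- L / \<epsilon> powr s)" .
  qed (use d in auto)
qed

text \<open>For this \<open>lam\<close> the moment exponent is at most 2 C \<epsilon>^(-\<alpha>'),
  because \<alpha> \<gamma> \<le> 1 makes 2^(m \<alpha> \<gamma>) times the length 2^(1-m) at most
  2. Markov at height 2^(-m \<beta>) subtracts \<epsilon>^(-\<alpha>')
  2^(m(\<gamma>-\<beta>)).\<close>

lemma prob_dyadic_triple:
  fixes Y :: "'a \<Rightarrow> real \<Rightarrow> real"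
  assumes "prob_space M" and \<alpha>: "\<alpha> > 1" and \<alpha>': "\<alpha>' = \<alpha> / (\<alpha> - 1)"
    and meas: "\<And>t. t \<in> {0..1} \<Longrightarrow> (\<lambda>\<omega>. Y \<omega> t) \<in> borel_measurable M"
    and c: "0 < c" "0 < C"
    and bd: "\<And>lam t1 t t2. \<lbrakk>lam > 0; 0 \<le> t1; t1 \<le> t; t \<le> t2; t2 \<le> 1\<rbrakk> \<Longrightarrow>
       (\<integral>\<^sup>+ \<omega>. ennreal (exp (lam * Mfun (Y \<omega> t1) (Y \<omega> t) (Y \<omega> t2))) \<partial>M)
         \<le> ennreal (c * exp (C * (lam * \<epsilon>) powr \<alpha> * \<bar>t2 - t1\<bar>))"
    and \<epsilon>: "\<epsilon> > 0" and \<gamma>: "\<alpha> * \<gamma> \<le> 1" and k: "1 \<le> k" "k < (2::nat)^m"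
  shows "measure M {\<omega> \<in> space M. 2 powr (- real m * \<beta>) <
       Mfun (Y \<omega> ((real k - 1) / 2^m)) (Y \<omega> (real k / 2^m)) (Y \<omega> ((real k + 1) / 2^m))}
     \<le> c * exp (- (\<epsilon> powr (- \<alpha>')) * (2 powr (real m * (\<gamma> - \<beta>)) - 2 * C))"
proof -
  define q where "q = \<epsilon> powr (- \<alpha>')"
  define lam where "lam = q * 2 powr (real m * \<gamma>)"
  have q: "q > 0" unfolding q_def using \<epsilon> by simp
  have lam: "lam > 0" unfolding lam_def using q by simp
  let ?t1 = "(real k - 1) / 2^m" and ?t = "real k / 2^m" and ?t2 = "(real k + 1) / 2^m"
  have "real (k + 1) \<le> real (2^m)" using k(2) unfolding of_nat_le_iff by simp
  then have k1: "real k + 1 \<le> 2^m" by simp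
  have t: "0 \<le> ?t1" "?t1 \<le> ?t" "?t \<le> ?t2" "?t2 \<le> 1"
    using k k1 by (auto simp: divide_right_mono)
  have t': "?t1 \<in> {0..1}" "?t \<in> {0..1}" "?t2 \<in> {0..1}" unfolding atLeastAtMost_iff using t by linarith+
  have diff: "\<bar>?t2 - ?t1\<bar> = 2 * 2 powr (- real m)"
    by (simp add: powr_minus_divide powr_realpow flip: diff_divide_distrib)
  have exps: "(1 - \<alpha>') * \<alpha> = - \<alpha>'" unfolding \<alpha>' using \<alpha> by (simp add: field_simps)
  have "lam * \<epsilon> = \<epsilon> powr (1 - \<alpha>') * 2 powr (real m * \<gamma>)"
    unfolding lam_def q_def using \<epsilon> by (simp add: powr_diff powr_minus divide_inverse)
  then have "(lam * \<epsilon>) powr \<alpha> = (\<epsilon> powr (1 - \<alpha>')) powr \<alpha> * (2 powr (real m * \<gamma>)) powr \<alpha>"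
    by (simp add: powr_mult)
  also have "\<dots> = q * 2 powr (real m * (\<alpha> * \<gamma>))"
    unfolding powr_powr exps q_def by (simp add: mult.commute mult.left_commute)
  finally have la: "(lam * \<epsilon>) powr \<alpha> = q * 2 powr (real m * (\<alpha> * \<gamma>))" .
  have "2 powr (real m * (\<alpha> * \<gamma>)) * 2 powr (- real m) = 2 powr (real m * (\<alpha> * \<gamma> - 1))"
    by (simp add: powr_add[symmetric] algebra_simps)
  also have "\<dots> \<le> 2 powr 0" using \<gamma> by (intro powr_mono mult_nonneg_nonpos) auto
  finally have p1: "2 powr (real m * (\<alpha> * \<gamma>)) * 2 powr (- real m) \<le> 1" by simp
  have "C * (lam * \<epsilon>) powr \<alpha> * \<bar>?t2 - ?t1\<bar> = 2 * C * q * (2 powr (real m * (\<alpha> * \<gamma>)) * 2 powr (- real m))"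
    unfolding la diff by (simp add: mult_ac)
  also have "\<dots> \<le> 2 * C * q * 1" using p1 c q by (intro mult_left_mono) auto
  finally have e1: "C * (lam * \<epsilon>) powr \<alpha> * \<bar>?t2 - ?t1\<bar> \<le> 2 * C * q" by simp
  have e2: "lam * 2 powr (- real m * \<beta>) = q * 2 powr (real m * (\<gamma> - \<beta>))"
    unfolding lam_def by (simp add: powr_add[symmetric] algebra_simps)
  have "measure M {\<omega> \<in> space M. 2 powr (- real m * \<beta>) < Mfun (Y \<omega> ?t1) (Y \<omega> ?t) (Y \<omega> ?t2)}
     \<le> c * exp (C * (lam * \<epsilon>) powr \<alpha> * \<bar>?t2 - ?t1\<bar>) * exp (- lam * 2 powr (- real m * \<beta>))"
    by (rule exponential_Markov[OF assms(1) measurable_Mfun[OF meas[OF t'(1)] meas[OF t'(2)] meas[OF t'(3)]] lam _ bd[OF lam t]])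
       (use c in simp)
  also have "\<dots> \<le> c * exp (2 * C * q) * exp (- lam * 2 powr (- real m * \<beta>))"
    using c e1 by (intro mult_right_mono mult_left_mono) auto
  also have "\<dots> = c * exp (- q * (2 powr (real m * (\<gamma> - \<beta>)) - 2 * C))"
    using e2 by (simp add: mult.assoc mult_exp_exp algebra_simps)
  finally show ?thesis unfolding q_def .
qed

lemma two_powr_dominates_linear:
  assumes "0 < (d::real)"
  shows "\<exists>N0::nat. \<forall>m>N0. 2 powr (real m * d) \<ge> real m + K"
proof -
  let ?a = "2 powr d"
  have a: "?a > 1" using assms by simp
  have pw: "2 powr (real m * d) = ?a ^ m" for m
    by (simp add: powr_realpow[symmetric] powr_powr mult.commute)
  have "(\<lambda>m. (real m ^ 1 + K) / ?a ^ m) \<longlonglongrightarrow> 0"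
  proof -
    have "(\<lambda>m. real m * (1/?a)^m) \<longlonglongrightarrow> 0" by (rule powser_times_n_limit_0) (use a in auto)
    moreover have "(\<lambda>m. K * (1/?a)^m) \<longlonglongrightarrow> K * 0"
      by (intro tendsto_intros LIMSEQ_power_zero) (use a in auto)
    ultimately have "(\<lambda>m. real m * (1/?a)^m + K * (1/?a)^m) \<longlonglongrightarrow> 0 + K * 0" by (rule tendsto_add)
    then show ?thesis by (simp add: power_one_over add_divide_distrib)
  qed
  then have "\<forall>\<^sub>F m in sequentially. (real m ^ 1 + K) / ?a ^ m < 1" by (rule order_tendstoD) simp
  then obtain N0 where "\<And>m. m \<ge> N0 \<Longrightarrow> (real m ^ 1 + K) / ?a ^ m < 1"
    unfolding eventually_sequentially by auto
  then have "real m + K \<le> ?a ^ m" if "m > N0" for m using that less_imp_le[of N0 m]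
    by (simp add: divide_less_eq less_imp_le)
  then show ?thesis unfolding pw by blast
qed

text \<open>A union bound over all levels m > N. Beyond \<open>N0\<close> the gain exceeds
  \<open>m + L + 1\<close> after paying 2 C, so a single triple has probability at most c exp(-q (m
  + L + 1)) with q = \<epsilon>^(-\<alpha>'); fewer than 2^m triples of level m then contribute at
  most c exp(-(L+1) q) (2/e)^m.\<close>

lemma prob_not_dyadic_control:
  fixes X :: "real \<Rightarrow> 'a \<Rightarrow> real \<Rightarrow> real"
  assumes P: "prob_space M" and \<alpha>: "\<alpha> > 1" and \<alpha>': "\<alpha>' = \<alpha> / (\<alpha> - 1)"
    and meas: "\<And>\<epsilon> t. \<epsilon> > 0 \<Longrightarrow> t \<in> {0..1} \<Longrightarrow> (\<lambda>\<omega>. X \<epsilon> \<omega> t) \<in> borel_measurable M"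
    and c: "0 < c" "0 < C"
    and bd: "\<And>lam \<epsilon> t1 t t2. \<lbrakk>lam > 0; \<epsilon> > 0; 0 \<le> t1; t1 \<le> t; t \<le> t2; t2 \<le> 1\<rbrakk> \<Longrightarrow>
       (\<integral>\<^sup>+ \<omega>. ennreal (exp (lam * Mfun (X \<epsilon> \<omega> t1) (X \<epsilon> \<omega> t) (X \<epsilon> \<omega> t2))) \<partial>M)
         \<le> ennreal (c * exp (C * (lam * \<epsilon>) powr \<alpha> * \<bar>t2 - t1\<bar>))"
    and \<beta>: "0 < \<beta>" "\<beta> < 1 / \<alpha>"
  shows "\<exists>N0. \<forall>N\<ge>N0. \<exists>\<delta>>0. \<forall>\<epsilon>. 0 < \<epsilon> \<and> \<epsilon> < \<delta> \<longrightarrow>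
     outer_prob M {\<omega> \<in> space M. \<not> dyadic_control (X \<epsilon> \<omega>) N \<beta>} \<le> exp (- L / \<epsilon> powr \<alpha>')"
proof -
  interpret prob_space M by fact
  define \<gamma> where "\<gamma> = (\<beta> + 1/\<alpha>) / 2"
  have \<gamma>: "\<alpha> * \<gamma> \<le> 1" "\<gamma> - \<beta> > 0" using \<alpha> \<beta> unfolding \<gamma>_def by (auto simp: field_simps)
  have \<alpha>'0: "\<alpha>' > 0" using \<alpha> unfolding \<alpha>' by simp
  obtain N0 where N0: "\<And>m. m > N0 \<Longrightarrow> 2 powr (real m * (\<gamma> - \<beta>)) \<ge> real m + (2*C + L + 1)"
    using two_powr_dominates_linear[OF \<gamma>(2)] by blast
  \<comment> \<open>This makes the ratio 2/e of the series over the levels smaller than 1.\<close>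
  have e2: "(2::real) < exp 1" using exp_lower_Taylor_quadratic[of "1::real"] by simp
  define x where "x = 2 / exp (1::real)"
  have x: "0 < x" "x < 1" unfolding x_def using e2 by auto
  define S where "S = (\<Sum>m. x^m)"
  obtain \<delta> where \<delta>: "\<delta> > 0" "\<And>\<epsilon>. 0 < \<epsilon> \<Longrightarrow> \<epsilon> < \<delta> \<Longrightarrow> 1 \<le> \<epsilon> powr (- \<alpha>') \<and>
      c * S * exp (- (L+1) * \<epsilon> powr (- \<alpha>')) \<le> exp (- L / \<epsilon> powr \<alpha>')"
    using eventually_exp_absorbs_const[OF \<alpha>'0, of "c*S" L] by blast
  have "outer_prob M {\<omega> \<in> space M. \<not> dyadic_control (X \<epsilon> \<omega>) N \<beta>} \<le> exp (- L / \<epsilon> powr \<alpha>')"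
    if N: "N \<ge> N0" and \<epsilon>: "0 < \<epsilon>" "\<epsilon> < \<delta>" for N \<epsilon>
  proof -
    define q where "q = \<epsilon> powr (- \<alpha>')"
    have q: "1 \<le> q" "c * S * exp (- (L+1) * q) \<le> exp (- L / \<epsilon> powr \<alpha>')"
      using \<delta>(2)[OF \<epsilon>] unfolding q_def by auto
    define E where "E m k = {\<omega> \<in> space M. 2 powr (- real m * \<beta>) <
       Mfun (X \<epsilon> \<omega> ((real k - 1) / 2^m)) (X \<epsilon> \<omega> (real k / 2^m)) (X \<epsilon> \<omega> ((real k + 1) / 2^m))}" for m k :: nat
    \<comment> \<open>Levels up to \<open>N\<close> are set to the empty event so that the union can
      run over all naturals.\<close>
    define B where "B m = (if m > N then \<Union>k\<in>{1..<2^m}. E m k else {})" for m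
    have Em: "E m k \<in> sets M" if "1 \<le> k" "k < (2::nat)^m" for m k
    proof -
      have "real (k + 1) \<le> real (2^m)" using that(2) unfolding of_nat_le_iff by simp
      then have k1: "real k + 1 \<le> 2^m" by simp
      moreover have k2: "1 \<le> real k" using that(1) by simp
      ultimately have k: "real k + 1 \<le> 2^m" "real k \<le> 2^m" "real k - 1 \<le> 2^m" "1 \<le> real k" by linarith+
      have t': "(real k - 1) / 2^m \<in> {0..1}" "real k / 2^m \<in> {0..1}" "(real k + 1) / 2^m \<in> {0..1}"
        unfolding atLeastAtMost_iff using k by (simp_all add: pos_divide_le_eq del: of_nat_le_numeral_power_cancel_iff)
      have "(\<lambda>\<omega>. Mfun (X \<epsilon> \<omega> ((real k - 1) / 2^m)) (X \<epsilon> \<omega> (real k / 2^m)) (X \<epsilon> \<omega> ((real k + 1) / 2^m)))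
          \<in> borel_measurable M"
        by (intro measurable_Mfun meas \<epsilon> t')
      then show ?thesis unfolding E_def by (intro borel_measurable_less) auto
    qed
    have Bm: "B m \<in> sets M" for m unfolding B_def using Em by auto
    have Bp: "measure M (B m) \<le> c * exp (- (L+1) * q) * x^m" for m
    proof (cases "m > N")
      case True
      have "measure M (E m k) \<le> c * exp (- q * (real m + (L + 1)))" if "1 \<le> k" "k < (2::nat)^m" for k
      proof -
        have "measure M (E m k) \<le> c * exp (- q * (2 powr (real m * (\<gamma> - \<beta>)) - 2 * C))"
          unfolding E_def q_def
          by (rule prob_dyadic_triple[where Y = "X \<epsilon>", OF P \<alpha> \<alpha>' meas[OF \<epsilon>(1)] c bd[OF _ \<epsilon>(1)] \<epsilon>(1) \<gamma>(1) that])
        also have "\<dots> \<le> c * exp (- q * (real m + (L + 1)))"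
          using N0[of m] True N q c by auto
        finally show ?thesis .
      qed
      then have le: "(\<Sum>k\<in>{1..<(2::nat)^m}. measure M (E m k)) \<le> (\<Sum>k\<in>{1..<(2::nat)^m}. c * exp (- q * (real m + (L + 1))))"
        by (intro sum_mono) auto
      have "measure M (B m) \<le> (\<Sum>k\<in>{1..<(2::nat)^m}. measure M (E m k))"
        unfolding B_def using True Em by (auto intro!: finite_measure_subadditive_finite)
      also have "\<dots> \<le> 2^m * (c * exp (- q * (real m + (L + 1))))"
        by (rule order_trans[OF le]) (use c in \<open>auto intro!: mult_right_mono\<close>)
      also have "\<dots> = c * exp (- (L+1) * q) * (2^m * exp (- (q * real m)))"
        by (simp add: mult_exp_exp algebra_simps)
      \<comment> \<open>Here q \<ge> 1 enters: exp(-q m) is replaced by exp(-m), which removes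
        \<epsilon> from the ratio of the series.\<close>
      also have "\<dots> \<le> c * exp (- (L+1) * q) * (2^m * exp (- real m))"
        using mult_right_mono[OF q(1), of "real m"] c by (intro mult_left_mono) auto
      also have "2^m * exp (- real m) = x^m"
        using exp_of_nat_mult[of m "1::real"] by (simp add: x_def exp_minus power_divide field_simps)
      finally show ?thesis .
    next
      case False then show ?thesis using c x by (simp add: B_def)
    qed
    have sx: "summable (\<lambda>m. x^m)" using x by (intro summable_geometric) auto
    have sB: "summable (\<lambda>m. measure M (B m))"
      by (rule summable_comparison_test'[OF summable_mult[OF sx, of "c * exp (- (L+1) * q)"], of 0])
         (simp only: real_norm_def abs_of_nonneg[OF measure_nonneg] Bp)
    have "outer_prob M {\<omega> \<in> space M. \<not> dyadic_control (X \<epsilon> \<omega>) N \<beta>} \<le> measure M (\<Union>m. B m)"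
    proof (rule outer_prob_le)
      show "(\<Union>m. B m) \<in> sets M" using Bm by auto
      show "{\<omega> \<in> space M. \<not> dyadic_control (X \<epsilon> \<omega>) N \<beta>} \<inter> space M \<subseteq> (\<Union>m. B m)"
      proof safe
        fix \<omega> assume w: "\<omega> \<in> space M" "\<not> dyadic_control (X \<epsilon> \<omega>) N \<beta>"
        then obtain m k where mk: "m > N" "1 \<le> k" "k < (2::nat)^m" "\<omega> \<in> E m k"
          unfolding dyadic_control_def E_def by (auto simp: not_le)
        then show "\<omega> \<in> (\<Union>m. B m)" unfolding B_def by (intro UN_I[of m]) auto
      qed
    qed
    also have "\<dots> \<le> (\<Sum>m. measure M (B m))"
      by (rule finite_measure_subadditive_countably[OF _ sB]) (use Bm in auto)
    also have "\<dots> \<le> (\<Sum>m. c * exp (- (L+1) * q) * x^m)"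
      by (rule suminf_le[OF Bp sB summable_mult[OF sx]])
    also have "\<dots> = c * S * exp (- (L+1) * q)" unfolding suminf_mult[OF sx] S_def by (simp only: mult_ac)
    finally show ?thesis using q by linarith
  qed
  then show ?thesis using \<delta>(1) by blast
qed

section \<open>Matching almost monotone paths\<close>

lemma continuous_on_running_max:
  fixes x :: "real \<Rightarrow> real"
  assumes x: "continuous_on {a..b} x"
  shows "continuous_on {a..b} (\<lambda>r. Sup (x ` {a..r}))" (is "continuous_on _ ?F")
proof -
  have bdd: "bdd_above (x ` {a..r})" if "r \<le> b" for r
    by (intro bounded_imp_bdd_above compact_imp_bounded compact_continuous_image
          continuous_on_subset[OF x]) (use that in auto)
  have mono: "?F r \<le> ?F s" if "a \<le> r" "r \<le> s" "s \<le> b" for r s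
    using that bdd by (intro cSup_subset_mono) auto
  show ?thesis
    unfolding continuous_on_iff
  proof safe
    fix r e :: real assume r: "r \<in> {a..b}" and e: "0 < e"
    have "uniformly_continuous_on {a..b} x" using x by (intro compact_uniformly_continuous) auto
    moreover have "e/2 > 0" using e by simp
    ultimately obtain d where d: "d > 0"
      "\<And>s t. s \<in> {a..b} \<Longrightarrow> t \<in> {a..b} \<Longrightarrow> dist t s < d \<Longrightarrow> dist (x t) (x s) < e/2"
      unfolding uniformly_continuous_on_def by metis
    have up: "?F t \<le> ?F s + e/2" if "a \<le> s" "s \<le> t" "t \<le> b" "t - s < d" for s t
    proof (rule cSup_least)
      fix y assume "y \<in> x ` {a..t}"
      then obtain u where u: "u \<in> {a..t}" "y = x u" by auto
      show "y \<le> ?F s + e/2"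
      proof (cases "u \<le> s")
        case True
        then have "x u \<le> ?F s" using u bdd[of s] that by (intro cSup_upper) auto
        then show ?thesis using e u by simp
      next
        case False
        then have "dist (x u) (x s) < e/2" using u that by (intro d(2)) (auto simp: dist_real_def)
        moreover have "x s \<le> ?F s" using bdd[of s] that by (intro cSup_upper) auto
        ultimately show ?thesis using u unfolding dist_real_def by linarith
      qed
    qed (use that in auto)
    show "\<exists>d>0. \<forall>r'\<in>{a..b}. dist r' r < d \<longrightarrow> dist (?F r') (?F r) < e"
    proof (intro exI[of _ d] conjI ballI impI d(1))
      fix r' assume r': "r' \<in> {a..b}" "dist r' r < d"
      show "dist (?F r') (?F r) < e"
      proof (cases "r \<le> r'")
        case True
        then show ?thesis using up[of r r'] mono[of r r'] r r' e by (simp add: dist_real_def)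
      next
        case False
        then show ?thesis using up[of r' r] mono[of r' r] r r' e by (simp add: dist_real_def)
      qed
    qed
  qed
qed

text \<open>The running maximum exceeds \<open>x\<close> by at most \<open>k\<close> by almost
  monotonicity. A linear ramp of total height \<open>k\<close> is added to make it strictly
  increasing, hence the \<open>2 * k\<close>.\<close>

lemma strict_mono_envelope:
  fixes x :: "real \<Rightarrow> real"
  assumes ab: "a < b" and x: "continuous_on {a..b} x" and k: "0 < k"
    and am: "\<And>r s. a \<le> r \<Longrightarrow> r \<le> s \<Longrightarrow> s \<le> b \<Longrightarrow> x r \<le> x s + k"
  obtains F where "continuous_on {a..b} F" "strict_mono_on {a..b} F" "F a = x a"
    "\<And>r. r \<in> {a..b} \<Longrightarrow> x r \<le> F r" "\<And>r. r \<in> {a..b} \<Longrightarrow> F r \<le> x r + 2 * k"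
proof
  define G where "G r = Sup (x ` {a..r})" for r
  define F where "F r = G r + k * ((r - a) / (b - a))" for r
  have bdd: "bdd_above (x ` {a..r})" if "r \<le> b" for r
    by (intro bounded_imp_bdd_above compact_imp_bounded compact_continuous_image
          continuous_on_subset[OF x]) (use that in auto)
  have mono: "G r \<le> G s" if "a \<le> r" "r \<le> s" "s \<le> b" for r s
    unfolding G_def using that bdd by (intro cSup_subset_mono) auto
  show "continuous_on {a..b} F" unfolding F_def G_def
    using ab by (intro continuous_intros continuous_on_running_max x) auto
  show "strict_mono_on {a..b} F"
  proof (rule strict_mono_onI)
    fix r s assume "r \<in> {a..b}" "s \<in> {a..b}" "r < s"
    moreover from this have "k * ((r - a) / (b - a)) < k * ((s - a) / (b - a))"
      using k ab by (intro mult_strict_left_mono divide_strict_right_mono) auto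
    ultimately show "F r < F s" unfolding F_def using mono[of r s] by auto
  qed
  show "F a = x a" unfolding F_def G_def by simp
  fix r assume r: "r \<in> {a..b}"
  have "x r \<le> G r" unfolding G_def using r bdd by (intro cSup_upper) auto
  moreover have "0 \<le> k * ((r - a) / (b - a))" using r k ab by simp
  ultimately show "x r \<le> F r" unfolding F_def by simp
  have "G r \<le> x r + k" unfolding G_def using r am by (intro cSup_least) auto
  moreover have "k * ((r - a) / (b - a)) \<le> k * 1" using r k ab by (intro mult_left_mono) auto
  ultimately show "F r \<le> x r + 2 * k" unfolding F_def by simp
qed

lemma strict_mono_on_image_Icc:
  fixes F :: "real \<Rightarrow> real"
  assumes "continuous_on {a..b} F" "strict_mono_on {a..b} F" "a \<le> b"
  shows "F ` {a..b} = {F a..F b}"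
proof
  show "F ` {a..b} \<subseteq> {F a..F b}"
    using strict_mono_on_leD[OF assms(2)] assms(3) by auto
  show "{F a..F b} \<subseteq> F ` {a..b}"
  proof
    fix v assume "v \<in> {F a..F b}"
    then have "\<exists>r\<ge>a. r \<le> b \<and> F r = v" using assms by (intro IVT') auto
    then show "v \<in> F ` {a..b}" by auto
  qed
qed

text \<open>With strictly increasing envelopes F of \<open>x\<close> and G of \<open>y\<close> and
  the affine map A from the range of F onto the range of G, take h = G^(-1) o A o F. A moves points
  by at most 3k and each envelope is within 2k of its function, so the triangle inequality gives
  7k.\<close>

lemma match_almost_increasing:
  fixes x y :: "real \<Rightarrow> real"
  assumes ab: "a < b" and cd: "c < d" and k: "0 < k"
    and x: "continuous_on {a..b} x" and y: "continuous_on {c..d} y"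
    and amx: "\<And>r s. a \<le> r \<Longrightarrow> r \<le> s \<Longrightarrow> s \<le> b \<Longrightarrow> x r \<le> x s + k"
    and amy: "\<And>r s. c \<le> r \<Longrightarrow> r \<le> s \<Longrightarrow> s \<le> d \<Longrightarrow> y r \<le> y s + k"
    and ends: "\<bar>x a - y c\<bar> \<le> k" "\<bar>x b - y d\<bar> \<le> k"
  shows "\<exists>h. strict_mono_on {a..b} h \<and> h ` {a..b} = {c..d} \<and> (\<forall>r\<in>{a..b}. \<bar>x r - y (h r)\<bar> \<le> 7 * k)"
proof -
  obtain F where F: "continuous_on {a..b} F" "strict_mono_on {a..b} F" "F a = x a"
    "\<And>r. r \<in> {a..b} \<Longrightarrow> x r \<le> F r" "\<And>r. r \<in> {a..b} \<Longrightarrow> F r \<le> x r + 2 * k"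
    using strict_mono_envelope[OF ab x k amx] by blast
  obtain G where G: "continuous_on {c..d} G" "strict_mono_on {c..d} G" "G c = y c"
    "\<And>r. r \<in> {c..d} \<Longrightarrow> y r \<le> G r" "\<And>r. r \<in> {c..d} \<Longrightarrow> G r \<le> y r + 2 * k"
    using strict_mono_envelope[OF cd y k amy] by blast
  have Fab: "F a < F b" using F(2) ab by (auto simp: strict_mono_on_def)
  have Gcd: "G c < G d" using G(2) cd by (auto simp: strict_mono_on_def)
  have Fi: "F ` {a..b} = {F a..F b}" using F ab by (intro strict_mono_on_image_Icc) auto
  have Gi: "G ` {c..d} = {G c..G d}" using G cd by (intro strict_mono_on_image_Icc) auto
  define l where "l v = (v - F a) / (F b - F a)" for v
  define A where "A v = G c + l v * (G d - G c)" for v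
  have l01: "0 \<le> l v" "l v \<le> 1" if "v \<in> {F a..F b}" for v
    unfolding l_def using that Fab by auto
  have Adisp: "\<bar>A v - v\<bar> \<le> 3 * k" if v: "v \<in> {F a..F b}" for v
  proof -
    have "l v * (F b - F a) = v - F a" unfolding l_def using Fab by simp
    \<comment> \<open>The displacement of an affine map is a convex combination of its displacements
      at the two ends. These are at most 3k: k from the hypothesis on the end values and, on the
      right, up to 2k from the envelopes.\<close>
    then have "A v - v = (1 - l v) * (G c - F a) + l v * (G d - F b)"
      unfolding A_def by (simp add: algebra_simps)
    then have "\<bar>A v - v\<bar> \<le> (1 - l v) * \<bar>G c - F a\<bar> + l v * \<bar>G d - F b\<bar>"
      using l01[OF v] abs_triangle_ineq[of "(1 - l v) * (G c - F a)" "l v * (G d - F b)"]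
      by (simp only: abs_mult abs_of_nonneg diff_ge_0_iff_ge)
    also have "\<dots> \<le> (1 - l v) * (3*k) + l v * (3*k)"
    proof (intro add_mono mult_left_mono)
      show "\<bar>G c - F a\<bar> \<le> 3*k" using F(3) G(3) ends(1) k by simp
      show "\<bar>G d - F b\<bar> \<le> 3*k" using F(4,5)[of b] G(4,5)[of d] ends(2) k ab cd by simp
    qed (use l01[OF v] in auto)
    finally show ?thesis by (simp add: algebra_simps)
  qed
  have Arange: "A v \<in> {G c..G d}" if "v \<in> {F a..F b}" for v
  proof -
    have "l v * (G d - G c) \<le> G d - G c" "0 \<le> l v * (G d - G c)"
      using l01[OF that] Gcd by (auto intro: mult_left_le_one_le)
    then show ?thesis unfolding A_def by simp
  qed
  have Aless: "A v < A w" if "v < w" for v w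
    unfolding A_def l_def using that Fab Gcd by (auto intro!: mult_strict_right_mono divide_strict_right_mono)
  have "\<forall>r\<in>{a..b}. \<exists>w. w \<in> {c..d} \<and> G w = A (F r)"
  proof
    fix r assume "r \<in> {a..b}"
    then have "A (F r) \<in> G ` {c..d}" unfolding Gi using Fi by (intro Arange) auto
    then show "\<exists>w. w \<in> {c..d} \<and> G w = A (F r)" by auto
  qed
  then obtain h where h: "\<And>r. r \<in> {a..b} \<Longrightarrow> h r \<in> {c..d}" "\<And>r. r \<in> {a..b} \<Longrightarrow> G (h r) = A (F r)"
    by metis
  have "strict_mono_on {a..b} h"
  proof (rule strict_mono_onI)
    fix r s assume rs: "r \<in> {a..b}" "s \<in> {a..b}" "r < s"
    then have "F r < F s" using F(2) by (auto simp: strict_mono_on_def)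
    then have "G (h r) < G (h s)" using h rs Aless by auto
    then show "h r < h s" using strict_mono_on_less[OF G(2) h(1)[OF rs(1)] h(1)[OF rs(2)]] by blast
  qed
  moreover have "h ` {a..b} = {c..d}"
  proof
    show "h ` {a..b} \<subseteq> {c..d}" using h by auto
    show "{c..d} \<subseteq> h ` {a..b}"
    proof
      fix w assume w: "w \<in> {c..d}"
      then have Gw: "G w \<in> {G c..G d}" using Gi by auto
      define mu where "mu = (G w - G c) / (G d - G c)"
      define v where "v = F a + mu * (F b - F a)"
      have lv: "l v = mu" unfolding l_def v_def using Fab by simp
      have mu: "0 \<le> mu" "mu \<le> 1" unfolding mu_def using Gw Gcd by auto
      then have "mu * (F b - F a) \<le> F b - F a" "0 \<le> mu * (F b - F a)"
        using Fab by (auto intro: mult_left_le_one_le)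
      then have "v \<in> {F a..F b}" unfolding v_def by simp
      then obtain r where r: "r \<in> {a..b}" "F r = v" using Fi by (metis imageE)
      have "A v = G w" unfolding A_def lv mu_def using Gcd by simp
      then have "G (h r) = G w" using h r by auto
      then have "h r = w" using strict_mono_on_imp_inj_on[OF G(2)] h(1)[OF r(1)] w by (auto dest: inj_onD)
      then show "w \<in> h ` {a..b}" using r by auto
    qed
  qed
  moreover have "\<bar>x r - y (h r)\<bar> \<le> 7 * k" if r: "r \<in> {a..b}" for r
  proof -
    have "F r \<in> {F a..F b}" using r Fi by auto
    from Adisp[OF this] F(4,5)[OF r] G(4,5)[OF h(1)[OF r]] h(2)[OF r] show ?thesis by linarith
  qed
  ultimately show ?thesis by blast
qed

lemma strict_mono_on_image_Icc_ends:
  fixes h :: "real \<Rightarrow> real"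
  assumes "strict_mono_on {a..b} h" "h ` {a..b} = {c..d}" "a \<le> b"
  shows "h a = c" "h b = d"
proof -
  have m: "h a \<le> h r" "h r \<le> h b" if "r \<in> {a..b}" for r
    using strict_mono_on_leD[OF assms(1)] that assms(3) by auto
  have r: "h a \<in> {c..d}" "h b \<in> {c..d}" using assms by auto
  then have "c \<in> h ` {a..b}" "d \<in> h ` {a..b}" unfolding assms(2) by auto
  then obtain r s where "r \<in> {a..b}" "h r = c" "s \<in> {a..b}" "h s = d" by blast
  with m[of r] m[of s] r show "h a = c" "h b = d" by auto
qed

lemma glue_strict_mono:
  fixes h1 h2 :: "real \<Rightarrow> real"
  assumes h1: "strict_mono_on {a..b} h1" "h1 ` {a..b} = {a'..b'}" "a \<le> b"
    and h2: "strict_mono_on {b..c} h2" "h2 ` {b..c} = {b'..c'}" "b \<le> c"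
  defines "h \<equiv> \<lambda>r. if r \<le> b then h1 r else h2 r"
  shows "strict_mono_on {a..c} h" "h ` {a..c} = {a'..c'}"
    "\<And>r. r \<in> {a..b} \<Longrightarrow> h r = h1 r" "\<And>r. r \<in> {b..c} \<Longrightarrow> h r = h2 r"
proof -
  note e1 = strict_mono_on_image_Icc_ends[OF h1] and e2 = strict_mono_on_image_Icc_ends[OF h2]
  show 1: "h r = h1 r" if "r \<in> {a..b}" for r using that by (simp add: h_def)
  show 2: "h r = h2 r" if "r \<in> {b..c}" for r using that e1 e2 by (auto simp: h_def)
  have "a' \<le> b'" "b' \<le> c'" using h1 h2 by (metis atLeastatMost_empty_iff image_is_empty)+
  have "{a..c} = {a..b} \<union> {b..c}" using h1(3) h2(3) by auto
  then have "h ` {a..c} = h ` {a..b} \<union> h ` {b..c}" by (simp only: image_Un)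
  also have "\<dots> = h1 ` {a..b} \<union> h2 ` {b..c}" using 1 2 by (intro arg_cong2[of _ _ _ _ "(\<union>)"] image_cong) auto
  also have "\<dots> = {a'..c'}" unfolding h1(2) h2(2) using \<open>a' \<le> b'\<close> \<open>b' \<le> c'\<close> by auto
  finally show "h ` {a..c} = {a'..c'}" .
  show "strict_mono_on {a..c} h"
  proof (rule strict_mono_onI)
    fix r s assume rs: "r \<in> {a..c}" "s \<in> {a..c}" "r < s"
    consider "s \<le> b" | "b \<le> r" | "r < b" "b < s" by linarith
    then show "h r < h s"
    proof cases
      case 1 then show ?thesis using rs strict_mono_onD[OF h1(1), of r s] by (auto simp: h_def)
    next
      case 2 then show ?thesis using rs strict_mono_onD[OF h2(1), of r s] \<open>\<And>r. r \<in> {b..c} \<Longrightarrow> h r = h2 r\<close> by auto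
    next
      case 3
      then have "h1 r < h1 b" "h2 b < h2 s"
        using rs strict_mono_onD[OF h1(1), of r b] strict_mono_onD[OF h2(1), of b s] by auto
      then show ?thesis using 3 e1 e2 by (simp add: h_def)
    qed
  qed
qed

text \<open>\<open>P\<close> relates \<open>r\<close> to its image, so that an estimate proved cell
  by cell is carried along by the gluing. The inequality in the conclusion is there for the
  induction, since gluing needs a nonempty left piece.\<close>

lemma glue_cells:
  fixes \<rho> \<sigma> :: "nat \<Rightarrow> real"
  assumes "\<And>i. i \<le> m \<Longrightarrow> \<rho> i < \<rho> (Suc i)"
    and "\<And>i. i \<le> m \<Longrightarrow> \<exists>h. strict_mono_on {\<rho> i..\<rho> (Suc i)} h \<and> h ` {\<rho> i..\<rho> (Suc i)} = {\<sigma> i..\<sigma> (Suc i)} \<and>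
           (\<forall>r\<in>{\<rho> i..\<rho> (Suc i)}. P r (h r))"
  shows "\<rho> 0 \<le> \<rho> (Suc m) \<and> (\<exists>h. strict_mono_on {\<rho> 0..\<rho> (Suc m)} h \<and> h ` {\<rho> 0..\<rho> (Suc m)} = {\<sigma> 0..\<sigma> (Suc m)} \<and>
           (\<forall>r\<in>{\<rho> 0..\<rho> (Suc m)}. P r (h r)))"
  using assms
proof (induction m)
  case 0
  from less_imp_le[OF 0(1)[OF order_refl]] 0(2)[OF order_refl] show ?case by (rule conjI)
next
  case (Suc m)
  note IH = Suc.IH[OF Suc.prems(1)[OF le_SucI] Suc.prems(2)[OF le_SucI]]
  note le1 = IH[THEN conjunct1]
  from IH[THEN conjunct2]
  obtain h1 where h1: "strict_mono_on {\<rho> 0..\<rho> (Suc m)} h1" "h1 ` {\<rho> 0..\<rho> (Suc m)} = {\<sigma> 0..\<sigma> (Suc m)}"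
    and P1: "\<And>r. r \<in> {\<rho> 0..\<rho> (Suc m)} \<Longrightarrow> P r (h1 r)" by blast
  have le2: "\<rho> (Suc m) \<le> \<rho> (Suc (Suc m))" using Suc.prems(1)[of "Suc m"] by simp
  obtain h2 where h2: "strict_mono_on {\<rho> (Suc m)..\<rho> (Suc (Suc m))} h2"
      "h2 ` {\<rho> (Suc m)..\<rho> (Suc (Suc m))} = {\<sigma> (Suc m)..\<sigma> (Suc (Suc m))}"
    and P2: "\<And>r. r \<in> {\<rho> (Suc m)..\<rho> (Suc (Suc m))} \<Longrightarrow> P r (h2 r)" using Suc.prems(2)[of "Suc m"] by blast
  note g = glue_strict_mono[OF h1 le1 h2 le2]
  let ?h = "\<lambda>r. if r \<le> \<rho> (Suc m) then h1 r else h2 r"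
  have "P r (?h r)" if "r \<in> {\<rho> 0..\<rho> (Suc (Suc m))}" for r
    using that P1[of r] P2[of r] by auto
  then show ?case using g(1,2) le1 le2 by (intro conjI exI[of _ ?h]) auto
qed

section \<open>Parametrizations of completed graphs\<close>

text \<open>Extending a path by \<open>0\<close> to the left of \<open>0\<close> and by its final value to the right of \<open>1\<close> turns the
  convention \<open>f(0-) = 0\<close> into an ordinary left limit and removes all boundary cases.\<close>

definition cadlag_line :: "(real \<Rightarrow> real) \<Rightarrow> bool" where
  "cadlag_line f \<longleftrightarrow> (\<forall>t<0. f t = 0) \<and> (\<forall>t\<ge>1. f t = f 1) \<and>
     (\<forall>t. (f \<longlongrightarrow> f t) (at_right t)) \<and> (\<forall>t. \<exists>l. (f \<longlongrightarrow> l) (at_left t))"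

lemma cadlag_line_tendsto_left_lim:
  assumes "cadlag_line f" "0 \<le> t"
  shows "(f \<longlongrightarrow> left_lim f t) (at_left t)"
proof (cases "t = 0")
  case True
  have "\<forall>\<^sub>F s in at_left 0. f s = 0"
    using assms unfolding cadlag_line_def eventually_at_left_field by (intro exI[of _ "-1"]) auto
  then show ?thesis using True unfolding left_lim_def by (simp add: tendsto_eventually)
next
  case False
  obtain l where l: "(f \<longlongrightarrow> l) (at_left t)" using assms unfolding cadlag_line_def by blast
  then have "Lim (at_left t) f = l" by (intro tendsto_Lim trivial_limit_at_left_real)
  then show ?thesis using l False unfolding left_lim_def by simp
qed

lemma cadlag_line_tendsto_right: "cadlag_line f \<Longrightarrow> (f \<longlongrightarrow> f t) (at_right t)"
  unfolding cadlag_line_def by blast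

text \<open>Such a \<open>t\<close> gets a rational \<open>a\<close> between \<open>L t\<close> and
  \<open>f t\<close> and a rational \<open>b < t\<close> with f < a on (b, t). If t < u had the same
  pair, then t would lie in (b, u) and f t < a < f t.\<close>

lemma countable_left_limit_less:
  fixes f L :: "real \<Rightarrow> real"
  assumes "\<And>t. t \<in> T \<Longrightarrow> (f \<longlongrightarrow> L t) (at_left t)"
  shows "countable {t \<in> T. L t < f t}"
proof -
  have "\<exists>a b. a \<in> \<rat> \<and> b \<in> \<rat> \<and> a < f t \<and> b < t \<and> (\<forall>s. b < s \<and> s < t \<longrightarrow> f s < a)"
    if tT: "t \<in> T" "L t < f t" for t
  proof -
    obtain a where a: "a \<in> \<rat>" "L t < a" "a < f t" using Rats_dense_in_real[OF tT(2)] by blast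
    have "\<forall>\<^sub>F s in at_left t. f s < a" using order_tendstoD(2)[OF assms[OF tT(1)] a(2)] .
    then obtain b where b: "b < t" "\<And>s. b < s \<Longrightarrow> s < t \<Longrightarrow> f s < a"
      unfolding eventually_at_left_field by blast
    obtain b' where "b' \<in> \<rat>" "b < b'" "b' < t" using Rats_dense_in_real[OF b(1)] by blast
    with a b show ?thesis by (intro exI[of _ a] exI[of _ b']) auto
  qed
  then obtain a b where ab: "\<And>t. t \<in> T \<Longrightarrow> L t < f t \<Longrightarrow> a t \<in> \<rat> \<and> b t \<in> \<rat> \<and> a t < f t \<and> b t < t \<and>
      (\<forall>s. b t < s \<and> s < t \<longrightarrow> f s < a t)" by metis
  have no: "\<not> t < u" if tu: "t \<in> T" "L t < f t" "u \<in> T" "L u < f u" "a t = a u" "b t = b u" for t u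
  proof
    assume "t < u"
    then have "f t < a u" using ab[OF tu(1,2)] ab[OF tu(3,4)] tu(6) by simp
    then show False using ab[OF tu(1,2)] tu(5) by simp
  qed
  have "inj_on (\<lambda>t. (a t, b t)) {t \<in> T. L t < f t}"
  proof (rule inj_onI)
    fix t u assume "t \<in> {t \<in> T. L t < f t}" "u \<in> {t \<in> T. L t < f t}" "(a t, b t) = (a u, b u)"
    then show "t = u" using no[of t u] no[of u t] by (simp add: not_less_iff_gr_or_eq)
  qed
  moreover have "countable ((\<lambda>t. (a t, b t)) ` {t \<in> T. L t < f t})"
    using ab by (intro countable_subset[OF _ countable_SIGMA[OF countable_rat countable_rat]]) auto
  ultimately show ?thesis by (rule countable_image_inj_on[rotated])
qed

lemma countable_jumps:
  assumes "cadlag_line f"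
  shows "countable {t. 0 \<le> t \<and> left_lim f t \<noteq> f t}"
proof -
  note l = cadlag_line_tendsto_left_lim[OF assms]
  have "countable {t \<in> {0..}. left_lim f t < f t}"
    by (intro countable_left_limit_less l) auto
  moreover have "countable {t \<in> {0..}. - left_lim f t < - f t}"
    by (intro countable_left_limit_less tendsto_minus l) auto
  ultimately have "countable ({t \<in> {0..}. left_lim f t < f t} \<union> {t \<in> {0..}. - left_lim f t < - f t})"
    by (rule countable_Un)
  then show ?thesis by (rule countable_subset[rotated]) auto
qed

section \<open>The order on a completed graph\<close>

lemma Gamma0_iff: "(t, x) \<in> Gamma0 f \<longleftrightarrow>
    0 \<le> t \<and> t \<le> 1 \<and> min (left_lim f t) (f t) \<le> x \<and> x \<le> max (left_lim f t) (f t)"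
  unfolding Gamma0_def by auto

text \<open>On the segment from \<open>L\<close> to \<open>R\<close> the distance to
  \<open>L\<close> is an isometric coordinate. \<open>graph_le\<close> orders each vertical segment
  by it, so estimates of the order become estimates of the values, whichever way the jump
  goes.\<close>

lemma abs_diff_on_segment:
  fixes L R x y :: real
  assumes "min L R \<le> x" "x \<le> max L R" "min L R \<le> y" "y \<le> max L R"
  shows "\<bar>y - x\<bar> = \<bar>\<bar>y - L\<bar> - \<bar>x - L\<bar>\<bar>"
  using assms by (cases "L \<le> R") (auto simp: min_def max_def split: if_splits)

lemma abs_diff_on_segment_le:
  fixes L R x :: real
  assumes "min L R \<le> x" "x \<le> max L R"
  shows "\<bar>x - L\<bar> \<le> \<bar>R - L\<bar>"
  using assms by (cases "L \<le> R") (auto simp: min_def max_def split: if_splits)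

lemma Gamma0_abs_diff:
  "(t, x) \<in> Gamma0 f \<Longrightarrow> (t, y) \<in> Gamma0 f \<Longrightarrow>
    \<bar>y - x\<bar> = \<bar>\<bar>y - left_lim f t\<bar> - \<bar>x - left_lim f t\<bar>\<bar>"
  unfolding Gamma0_iff by (rule abs_diff_on_segment[of _ "f t"]) auto

lemma Gamma0_left: "0 \<le> t \<Longrightarrow> t \<le> 1 \<Longrightarrow> (t, left_lim f t) \<in> Gamma0 f"
  and Gamma0_right: "0 \<le> t \<Longrightarrow> t \<le> 1 \<Longrightarrow> (t, f t) \<in> Gamma0 f"
  unfolding Gamma0_iff by auto

lemma graph_le_refl [simp]: "graph_le f z z"
  and graph_le_total: "graph_le f z w \<or> graph_le f w z"
  unfolding graph_le_def by auto

lemma graph_le_antisym: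
  assumes "z \<in> Gamma0 f" "w \<in> Gamma0 f" "graph_le f z w" "graph_le f w z"
  shows "z = w"
proof -
  obtain t x u y where zw: "z = (t, x)" "w = (u, y)" by (metis surj_pair)
  have tu: "t = u" using assms(3,4) unfolding zw graph_le_def by auto
  then have "\<bar>x - left_lim f t\<bar> = \<bar>y - left_lim f t\<bar>" using assms(3,4) unfolding zw graph_le_def by auto
  then have "\<bar>y - x\<bar> = 0" using Gamma0_abs_diff[of t x f y] assms(1,2) unfolding zw tu by simp
  then show ?thesis unfolding zw tu by simp
qed

lemma Gamma0_move_towards:
  assumes z: "(t, x) \<in> Gamma0 f" and y: "(t, y) \<in> Gamma0 f" and ne: "x \<noteq> y" and e: "0 < (e::real)"
  obtains x' where "(t, x') \<in> Gamma0 f" "x' \<noteq> x" "\<bar>x' - x\<bar> < e" "min x y \<le> x'" "x' \<le> max x y"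
proof
  define d where "d = min (e/2) \<bar>y - x\<bar>"
  define x' where "x' = (if x < y then x + d else x - d)"
  have d: "0 < d" "d < e" "d \<le> \<bar>y - x\<bar>" using ne e unfolding d_def by auto
  show "x' \<noteq> x" "\<bar>x' - x\<bar> < e" "min x y \<le> x'" "x' \<le> max x y" using d unfolding x'_def by auto
  then show "(t, x') \<in> Gamma0 f" using z y unfolding Gamma0_iff by linarith
qed

lemma Gamma0_values_close:
  assumes f: "cadlag_line f" and z: "(u, y) \<in> Gamma0 f" and b: "b < u"
    and cl: "\<And>s. b < s \<Longrightarrow> s \<le> u \<Longrightarrow> \<bar>f s - L\<bar> \<le> e"
  shows "\<bar>y - L\<bar> \<le> e"
proof -
  have u: "0 \<le> u" using z unfolding Gamma0_iff by auto
  have "((\<lambda>s. \<bar>f s - L\<bar>) \<longlongrightarrow> \<bar>left_lim f u - L\<bar>) (at_left u)"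
    by (intro tendsto_intros cadlag_line_tendsto_left_lim f u)
  moreover have "\<forall>\<^sub>F s in at_left u. \<bar>f s - L\<bar> \<le> e"
    using cl b unfolding eventually_at_left_field by (intro exI[of _ b]) auto
  ultimately have "\<bar>left_lim f u - L\<bar> \<le> e" by (rule tendsto_upperbound) simp
  moreover have "\<bar>f u - L\<bar> \<le> e" using cl b by simp
  ultimately show ?thesis using z unfolding Gamma0_iff by linarith
qed

text \<open>Left continuity of the height, phrased by the order alone so that every parametrization
  inherits it. Above the foot of a jump segment one steps back along the segment; at the foot one
  steps back to an earlier time by the left limit; at time 0 the foot is the least point of the
  graph.\<close>

lemma Gamma0_left_nbhd:
  assumes f: "cadlag_line f" and z: "z \<in> Gamma0 f" and e: "0 < e"
  shows "(\<forall>w\<in>Gamma0 f. graph_le f w z \<longrightarrow> w = z) \<or>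
    (\<exists>w\<in>Gamma0 f. graph_le f w z \<and> w \<noteq> z \<and>
       (\<forall>v\<in>Gamma0 f. graph_le f w v \<and> graph_le f v z \<longrightarrow> \<bar>snd v - snd z\<bar> < e))"
proof -
  obtain t x where zt: "z = (t, x)" by (metis surj_pair)
  let ?L = "left_lim f t"
  have t: "0 \<le> t" "t \<le> 1" using z unfolding zt Gamma0_iff by auto
  consider (seg) "x \<noteq> ?L" | (zero) "x = ?L" "t = 0" | (pos) "x = ?L" "t > 0" using t by linarith
  then show ?thesis
  proof cases
    case seg
    obtain x' where x': "(t, x') \<in> Gamma0 f" "x' \<noteq> x" "\<bar>x' - x\<bar> < e" "min x ?L \<le> x'" "x' \<le> max x ?L"
      using Gamma0_move_towards[OF z[unfolded zt] Gamma0_left[OF t] seg e] by metis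
    have x'L: "\<bar>x' - ?L\<bar> \<le> \<bar>x - ?L\<bar>" using x'(4,5) by linarith
    have "\<bar>snd v - snd z\<bar> < e" if v: "v \<in> Gamma0 f" "graph_le f (t, x') v" "graph_le f v z" for v
    proof -
      obtain u y where vu: "v = (u, y)" by (metis surj_pair)
      have u: "u = t" using v(2,3) unfolding vu zt graph_le_def by auto
      have "\<bar>x' - ?L\<bar> \<le> \<bar>y - ?L\<bar>" "\<bar>y - ?L\<bar> \<le> \<bar>x - ?L\<bar>" using v(2,3) unfolding vu zt u graph_le_def by auto
      then have "\<bar>y - x\<bar> \<le> \<bar>x' - x\<bar>"
        using Gamma0_abs_diff[of t x f y] Gamma0_abs_diff[of t x f x'] z v(1) x'(1) x'L unfolding vu zt u by simp
      then show ?thesis using x'(3) unfolding vu zt by simp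
    qed
    moreover have "graph_le f (t, x') z" using x'L unfolding zt graph_le_def by simp
    moreover have "(t, x') \<noteq> z" using x'(2) unfolding zt by simp
    ultimately show ?thesis using x'(1) by blast
  next
    case zero
    have "w = z" if w: "w \<in> Gamma0 f" "graph_le f w z" for w
    proof -
      have "graph_le f z w" using w zero unfolding zt graph_le_def
        by (cases w) (auto simp: Gamma0_iff)
      then show ?thesis using graph_le_antisym w z by blast
    qed
    then show ?thesis by blast
  next
    case pos
    have "\<forall>\<^sub>F s in at_left t. dist (f s) ?L < e/2"
      by (rule tendstoD[OF cadlag_line_tendsto_left_lim[OF f t(1)] half_gt_zero[OF e]])
    then obtain b where b: "b < t" "\<And>s. b < s \<Longrightarrow> s < t \<Longrightarrow> \<bar>f s - ?L\<bar> < e/2"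
      unfolding eventually_at_left_field dist_real_def by blast
    define s where "s = (max 0 b + t) / 2"
    have s: "0 < s" "b < s" "s < t" using pos b(1) unfolding s_def by (auto simp: max_def split: if_splits)
    have "\<bar>snd v - snd z\<bar> < e" if v: "v \<in> Gamma0 f" "graph_le f (s, f s) v" "graph_le f v z" for v
    proof -
      obtain u y where vu: "v = (u, y)" by (metis surj_pair)
      have u: "s \<le> u" "u \<le> t" using v(2,3) unfolding vu zt graph_le_def by auto
      show ?thesis
      proof (cases "u = t")
        case True
        then have "\<bar>y - ?L\<bar> \<le> 0" using v(3) pos unfolding vu zt graph_le_def by simp
        then show ?thesis using e pos unfolding vu zt by simp
      next
        case False
        have "\<bar>y - ?L\<bar> \<le> e/2"
        proof (rule Gamma0_values_close[OF f v(1)[unfolded vu]])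
          show "b < u" using s u by simp
          show "\<bar>f s - ?L\<bar> \<le> e/2" if "b < s" "s \<le> u" for s
            using b(2)[of s] that u False by simp
        qed
        then show ?thesis using e pos unfolding vu zt by simp
      qed
    qed
    moreover have "(s, f s) \<in> Gamma0 f" using s t by (intro Gamma0_right) auto
    moreover have "graph_le f (s, f s) z" "(s, f s) \<noteq> z" using s unfolding zt graph_le_def by auto
    ultimately show ?thesis by blast
  qed
qed

text \<open>The mirror image, with right continuity of \<open>f\<close> in place of the left limit
  and (1, f 1) as greatest point. At the top of a segment no later point has the same time, because
  f t is farthest from the left limit.\<close>

lemma Gamma0_right_nbhd:
  assumes f: "cadlag_line f" and z: "z \<in> Gamma0 f" and e: "0 < e"
  shows "(\<forall>w\<in>Gamma0 f. graph_le f z w \<longrightarrow> w = z) \<or>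
    (\<exists>w\<in>Gamma0 f. graph_le f z w \<and> w \<noteq> z \<and>
       (\<forall>v\<in>Gamma0 f. graph_le f z v \<and> graph_le f v w \<longrightarrow> \<bar>snd v - snd z\<bar> < e))"
proof -
  obtain t x where zt: "z = (t, x)" by (metis surj_pair)
  let ?L = "left_lim f t"
  have t: "0 \<le> t" "t \<le> 1" using z unfolding zt Gamma0_iff by auto
  have far: "\<bar>y - ?L\<bar> \<le> \<bar>f t - ?L\<bar>" if "(t, y) \<in> Gamma0 f" for y
    using that unfolding Gamma0_iff by (intro abs_diff_on_segment_le) auto
  consider (seg) "x \<noteq> f t" | (one) "x = f t" "t = 1" | (lt) "x = f t" "t < 1" using t by linarith
  then show ?thesis
  proof cases
    case seg
    obtain x' where x': "(t, x') \<in> Gamma0 f" "x' \<noteq> x" "\<bar>x' - x\<bar> < e" "min x (f t) \<le> x'" "x' \<le> max x (f t)"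
      using Gamma0_move_towards[OF z[unfolded zt] Gamma0_right[OF t] seg e] by metis
    have xR: "min ?L (f t) \<le> x" "x \<le> max ?L (f t)" using z unfolding zt Gamma0_iff by auto
    have x'L: "\<bar>x - ?L\<bar> \<le> \<bar>x' - ?L\<bar>" using x'(4,5) xR by (cases "?L \<le> f t") auto
    have "\<bar>snd v - snd z\<bar> < e" if v: "v \<in> Gamma0 f" "graph_le f z v" "graph_le f v (t, x')" for v
    proof -
      obtain u y where vu: "v = (u, y)" by (metis surj_pair)
      have u: "u = t" using v(2,3) unfolding vu zt graph_le_def by auto
      have "\<bar>x - ?L\<bar> \<le> \<bar>y - ?L\<bar>" "\<bar>y - ?L\<bar> \<le> \<bar>x' - ?L\<bar>" using v(2,3) unfolding vu zt u graph_le_def by auto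
      then have "\<bar>y - x\<bar> \<le> \<bar>x' - x\<bar>"
        using Gamma0_abs_diff[of t x f y] Gamma0_abs_diff[of t x f x'] z v(1) x'(1) x'L unfolding vu zt u by simp
      then show ?thesis using x'(3) unfolding vu zt by simp
    qed
    moreover have "graph_le f z (t, x')" using x'L unfolding zt graph_le_def by simp
    moreover have "(t, x') \<noteq> z" using x'(2) unfolding zt by simp
    ultimately show ?thesis using x'(1) by blast
  next
    case one
    have "w = z" if w: "w \<in> Gamma0 f" "graph_le f z w" for w
    proof -
      obtain u y where wu: "w = (u, y)" by (metis surj_pair)
      have "u = t" using w one unfolding wu zt graph_le_def Gamma0_iff by auto
      then have "graph_le f w z" using w far[of y] one unfolding wu zt graph_le_def by auto
      then show ?thesis using graph_le_antisym w z by blast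
    qed
    then show ?thesis by blast
  next
    case lt
    have "\<forall>\<^sub>F s in at_right t. dist (f s) (f t) < e/2"
      by (rule tendstoD[OF cadlag_line_tendsto_right[OF f] half_gt_zero[OF e]])
    then obtain b where b: "b > t" "\<And>s. t < s \<Longrightarrow> s < b \<Longrightarrow> \<bar>f s - f t\<bar> < e/2"
      unfolding eventually_at_right_field dist_real_def by blast
    define s where "s = (min 1 b + t) / 2"
    have s: "s < 1" "s < b" "t < s" using lt b(1) unfolding s_def by (auto simp: min_def split: if_splits)
    have "\<bar>snd v - snd z\<bar> < e" if v: "v \<in> Gamma0 f" "graph_le f z v" "graph_le f v (s, f s)" for v
    proof -
      obtain u y where vu: "v = (u, y)" by (metis surj_pair)
      have u: "t \<le> u" "u \<le> s" using v(2,3) unfolding vu zt graph_le_def by auto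
      show ?thesis
      proof (cases "u = t")
        case True
        then have "\<bar>y - ?L\<bar> = \<bar>x - ?L\<bar>" using v lt far[of y] unfolding vu zt graph_le_def by auto
        then have "\<bar>y - x\<bar> = 0" using Gamma0_abs_diff[of t x f y] z v(1) True unfolding vu zt by simp
        then show ?thesis using e unfolding vu zt by simp
      next
        case False
        have "\<bar>y - f t\<bar> \<le> e/2"
        proof (rule Gamma0_values_close[OF f v(1)[unfolded vu]])
          show "t < u" using False u by simp
          show "\<bar>f s' - f t\<bar> \<le> e/2" if "t < s'" "s' \<le> u" for s'
            using b(2)[of s'] that u s by simp
        qed
        then show ?thesis using e lt unfolding vu zt by simp
      qed
    qed
    moreover have "(s, f s) \<in> Gamma0 f" using s t by (intro Gamma0_right) auto
    moreover have "graph_le f z (s, f s)" "(s, f s) \<noteq> z" using s unfolding zt graph_le_def by auto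
    ultimately show ?thesis by blast
  qed
qed

section \<open>Parametrizations as order isomorphisms\<close>

lemma Pi_par_bij: "p \<in> Pi_par f \<Longrightarrow> bij_betw p {0..1} (Gamma0 f)"
  and Pi_par_mono: "p \<in> Pi_par f \<Longrightarrow> r \<in> {0..1} \<Longrightarrow> s \<in> {0..1} \<Longrightarrow> r \<le> s \<Longrightarrow> graph_le f (p r) (p s)"
  unfolding Pi_par_def by simp_all

lemma Pi_par_mem: "p \<in> Pi_par f \<Longrightarrow> r \<in> {0..1} \<Longrightarrow> p r \<in> Gamma0 f"
  by (rule bij_betw_apply[OF Pi_par_bij])

lemma Pi_par_ex: "p \<in> Pi_par f \<Longrightarrow> z \<in> Gamma0 f \<Longrightarrow> \<exists>r\<in>{0..1}. p r = z"
  using bij_betw_imp_surj_on[OF Pi_par_bij, of p f] by (metis imageE)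

lemma Pi_par_eq_iff:
  assumes p: "p \<in> Pi_par f" and r: "r \<in> {0..1}" "s \<in> {0..1}"
  shows "p r = p s \<longleftrightarrow> r = s"
  by (rule inj_on_eq_iff[OF bij_betw_imp_inj_on[OF Pi_par_bij[OF p]] r])

lemma Pi_par_le_iff:
  assumes p: "p \<in> Pi_par f" and r: "r \<in> {0..1}" "s \<in> {0..1}"
  shows "graph_le f (p r) (p s) \<longleftrightarrow> r \<le> s"
proof
  assume le: "graph_le f (p r) (p s)"
  show "r \<le> s"
  proof (rule ccontr)
    assume n: "\<not> r \<le> s"
    then have "graph_le f (p s) (p r)" using Pi_par_mono[OF p r(2,1)] by simp
    with le have "p r = p s" using Pi_par_mem[OF p] r by (intro graph_le_antisym)
    then show False using n Pi_par_eq_iff[OF p r] by simp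
  qed
next
  assume "r \<le> s"
  then show "graph_le f (p r) (p s)" by (rule Pi_par_mono[OF p r])
qed

text \<open>A parametrization is an order isomorphism onto the graph, so the order neighbourhoods
  found above pull back to neighbourhoods in [0,1]. Continuity thus follows from monotonicity and
  bijectivity.\<close>

lemma continuous_on_snd_Pi_par:
  assumes f: "cadlag_line f" and p: "p \<in> Pi_par f"
  shows "continuous_on {0..1} (\<lambda>r. snd (p r))"
  unfolding continuous_on_iff
proof safe
  fix r e :: real assume r: "r \<in> {0..1}" and e: "0 < e"
  have z: "p r \<in> Gamma0 f" using p r by (rule Pi_par_mem)
  have "\<exists>a<r. \<forall>s\<in>{0..1}. a < s \<and> s \<le> r \<longrightarrow> \<bar>snd (p s) - snd (p r)\<bar> < e"
    using Gamma0_left_nbhd[OF f z e]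
  proof
    assume "\<forall>w\<in>Gamma0 f. graph_le f w (p r) \<longrightarrow> w = p r"
    then have "p s = p r" if "s \<in> {0..1}" "s \<le> r" for s
      using that p r by (metis Pi_par_le_iff Pi_par_mem)
    then show ?thesis using e by (intro exI[of _ "r - 1"]) auto
  next
    assume "\<exists>w\<in>Gamma0 f. graph_le f w (p r) \<and> w \<noteq> p r \<and>
       (\<forall>v\<in>Gamma0 f. graph_le f w v \<and> graph_le f v (p r) \<longrightarrow> \<bar>snd v - snd (p r)\<bar> < e)"
    then obtain a where a: "a \<in> {0..1}" "graph_le f (p a) (p r)" "p a \<noteq> p r"
       "\<And>v. v \<in> Gamma0 f \<Longrightarrow> graph_le f (p a) v \<Longrightarrow> graph_le f v (p r) \<Longrightarrow> \<bar>snd v - snd (p r)\<bar> < e"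
      using Pi_par_ex[OF p] by metis
    have "a < r" using a Pi_par_le_iff[OF p a(1) r] by (cases "a = r") auto
    moreover have "\<bar>snd (p s) - snd (p r)\<bar> < e" if "s \<in> {0..1}" "a < s" "s \<le> r" for s
      by (rule a(4)) (use that a(1) r p in \<open>auto simp: Pi_par_le_iff intro: Pi_par_mem\<close>)
    ultimately show ?thesis by blast
  qed
  then obtain a where a: "a < r" "\<And>s. s \<in> {0..1} \<Longrightarrow> a < s \<Longrightarrow> s \<le> r \<Longrightarrow> \<bar>snd (p s) - snd (p r)\<bar> < e" by blast
  have "\<exists>b>r. \<forall>s\<in>{0..1}. s < b \<and> r \<le> s \<longrightarrow> \<bar>snd (p s) - snd (p r)\<bar> < e"
    using Gamma0_right_nbhd[OF f z e]
  proof
    assume "\<forall>w\<in>Gamma0 f. graph_le f (p r) w \<longrightarrow> w = p r"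
    then have "p s = p r" if "s \<in> {0..1}" "r \<le> s" for s
      using that p r by (metis Pi_par_le_iff Pi_par_mem)
    then show ?thesis using e by (intro exI[of _ "r + 1"]) auto
  next
    assume "\<exists>w\<in>Gamma0 f. graph_le f (p r) w \<and> w \<noteq> p r \<and>
       (\<forall>v\<in>Gamma0 f. graph_le f (p r) v \<and> graph_le f v w \<longrightarrow> \<bar>snd v - snd (p r)\<bar> < e)"
    then obtain b where b: "b \<in> {0..1}" "graph_le f (p r) (p b)" "p b \<noteq> p r"
       "\<And>v. v \<in> Gamma0 f \<Longrightarrow> graph_le f (p r) v \<Longrightarrow> graph_le f v (p b) \<Longrightarrow> \<bar>snd v - snd (p r)\<bar> < e"
      using Pi_par_ex[OF p] by metis
    have "r < b" using b Pi_par_le_iff[OF p r b(1)] by (cases "b = r") auto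
    moreover have "\<bar>snd (p s) - snd (p r)\<bar> < e" if "s \<in> {0..1}" "s < b" "r \<le> s" for s
      by (rule b(4)) (use that b(1) r p in \<open>auto simp: Pi_par_le_iff intro: Pi_par_mem\<close>)
    ultimately show ?thesis by blast
  qed
  then obtain b where b: "r < b" "\<And>s. s \<in> {0..1} \<Longrightarrow> s < b \<Longrightarrow> r \<le> s \<Longrightarrow> \<bar>snd (p s) - snd (p r)\<bar> < e" by blast
  show "\<exists>d>0. \<forall>s\<in>{0..1}. dist s r < d \<longrightarrow> dist (snd (p s)) (snd (p r)) < e"
  proof (intro exI[of _ "min (r - a) (b - r)"] conjI ballI impI)
    fix s assume s: "s \<in> {0..1}" "dist s r < min (r - a) (b - r)"
    then have "a < s" "s < b" by (auto simp: dist_real_def)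
    then show "dist (snd (p s)) (snd (p r)) < e"
      using a(2)[OF s(1)] b(2)[OF s(1)] unfolding dist_real_def by linarith
  qed (use a b in auto)
qed

text \<open>A clock for the completed graph: a finite measure whose atoms are exactly the jump times, plus
  Lebesgue measure to make it strictly increasing. The atom at \<open>2\<close> only keeps the set of atoms nonempty.\<close>

lemma Pi_par_nonempty:
  assumes f: "cadlag_line f"
  shows "\<exists>p. p \<in> Pi_par f"
proof -
  define L where "L = left_lim f"
  define J where "J = insert 2 {t. 0 \<le> t \<and> L t \<noteq> f t}"
  have J: "countable J" "J \<noteq> {}" unfolding J_def L_def using countable_jumps[OF f] by auto
  define e where "e = from_nat_into J"
  have range_e: "range e = J" unfolding e_def using J by (rule range_from_nat_into[rotated])
  \<comment> \<open>The geometric law charges every natural number, so its image under an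
    enumeration of \<open>J\<close> charges every point of \<open>J\<close> and no other
    point.\<close>
  define \<nu> where "\<nu> = distr (measure_pmf (geometric_pmf (1/2))) borel e"
  interpret \<nu>: prob_space \<nu> unfolding \<nu>_def by (intro measure_pmf.prob_space_distr) auto
  interpret \<nu>: finite_borel_measure \<nu>
    by unfold_locales (simp add: \<nu>_def)
  have atom: "0 < measure \<nu> {t} \<longleftrightarrow> t \<in> J" for t
  proof -
    have m: "measure \<nu> {t} = measure (measure_pmf (geometric_pmf (1/2))) (e -` {t})"
      unfolding \<nu>_def by (subst measure_distr) auto
    show ?thesis
    proof
      assume "t \<in> J"
      then obtain n where "e n = t" using range_e by blast
      then show "0 < measure \<nu> {t}" unfolding m
        by (intro measure_pmf_posI[of n]) (auto simp: set_pmf_geometric)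
    next
      assume "0 < measure \<nu> {t}"
      then have "e -` {t} \<noteq> {}" unfolding m by (metis less_irrefl measure_empty)
      then show "t \<in> J" using range_e by blast
    qed
  qed
  \<comment> \<open>The clock after and before a possible jump at \<open>t\<close>. The gap between
    them is the atom at \<open>t\<close>, which provides the time to traverse the vertical
    segment.\<close>
  define S where "S t = t + measure \<nu> {..t}" for t
  define Sm where "Sm t = t + measure \<nu> {..<t}" for t
  have sets: "sets \<nu> = sets borel" by (simp add: \<nu>_def)
  have S_eq: "S t = Sm t + measure \<nu> {t}" for t
  proof -
    have "{..t} = {..<t} \<union> {t}" by auto
    then have "measure \<nu> {..t} = measure \<nu> {..<t} + measure \<nu> {t}"
      by (simp only:) (intro \<nu>.finite_measure_Union, auto simp: sets)
    then show ?thesis unfolding S_def Sm_def by simp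
  qed
  have Sm_le_S: "Sm t \<le> S t" for t unfolding S_eq by simp
  have S_less: "S s < Sm t" if "s < t" for s t
  proof -
    have "measure \<nu> {..s} \<le> measure \<nu> {..<t}"
      using that by (intro \<nu>.finite_measure_mono) (auto simp: sets)
    then show ?thesis using that unfolding S_def Sm_def by simp
  qed
  have S_left: "(S \<longlongrightarrow> Sm t) (at_left t)" for t
    using tendsto_add[OF tendsto_ident_at \<nu>.cdf_at_left[of t]] unfolding S_def[abs_def] Sm_def cdf_def by simp
  have S_right: "(S \<longlongrightarrow> S t) (at_right t)" for t
    using tendsto_add[OF tendsto_ident_at \<nu>.cdf_is_right_cont[of t, unfolded continuous_within]]
    unfolding S_def[abs_def] cdf_def by simp
  \<comment> \<open>The segment over a jump time is spread linearly over the gap from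
    \<open>Sm t\<close> to \<open>S t\<close>. At a continuity point the quotient is 0 by the
    convention for division by 0, and the atom vanishes as well.\<close>
  define \<Psi> where "\<Psi> z = Sm (fst z) + measure \<nu> {fst z} * (\<bar>snd z - L (fst z)\<bar> / \<bar>f (fst z) - L (fst z)\<bar>)" for z
  have frac: "0 \<le> \<bar>x - L t\<bar> / \<bar>f t - L t\<bar>" "\<bar>x - L t\<bar> / \<bar>f t - L t\<bar> \<le> 1" if "(t, x) \<in> Gamma0 f" for t x
    using that abs_diff_on_segment_le[of "L t" "f t" x] unfolding Gamma0_iff L_def by (auto simp: divide_le_eq_1)
  have \<Psi>_bd: "Sm t \<le> \<Psi> (t, x)" "\<Psi> (t, x) \<le> S t" if "(t, x) \<in> Gamma0 f" for t x
    using frac[OF that] mult_left_le[OF frac(2)[OF that], of "measure \<nu> {t}"] unfolding \<Psi>_def S_eq by auto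
  have \<Psi>_less: "\<Psi> z < \<Psi> w" if zw: "z \<in> Gamma0 f" "w \<in> Gamma0 f" "graph_le f z w" "z \<noteq> w" for z w
  proof -
    obtain t x u y where zt: "z = (t, x)" "w = (u, y)" by (metis surj_pair)
    show ?thesis
    proof (cases "t = u")
      case False
      then have "t < u" using zw(3) unfolding zt graph_le_def by auto
      then show ?thesis using \<Psi>_bd[of t x] \<Psi>_bd[of u y] S_less[of t u] zw(1,2) unfolding zt by simp
    next
      case True
      have "\<not> graph_le f w z" using graph_le_antisym[of w f z] zw by auto
      then have lt: "\<bar>x - L t\<bar> < \<bar>y - L t\<bar>" unfolding zt graph_le_def True L_def by auto
      moreover have "\<bar>y - L t\<bar> \<le> \<bar>f t - L t\<bar>"
        using zw(2) abs_diff_on_segment_le[of "L t" "f t" y] unfolding zt True Gamma0_iff L_def by auto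
      ultimately have pos: "0 < \<bar>f t - L t\<bar>" by linarith
      then have "t \<in> J" using zw(1) unfolding J_def zt Gamma0_iff by auto
      then have "0 < measure \<nu> {t}" using atom by simp
      then have "measure \<nu> {t} * (\<bar>x - L t\<bar> / \<bar>f t - L t\<bar>) < measure \<nu> {t} * (\<bar>y - L t\<bar> / \<bar>f t - L t\<bar>)"
        using lt pos by (intro mult_strict_left_mono divide_strict_right_mono) auto
      then show ?thesis unfolding \<Psi>_def zt True[symmetric] by simp
    qed
  qed
  have \<Psi>_ex: "\<exists>z\<in>Gamma0 f. \<Psi> z = y" if y: "y \<in> {Sm 0..S 1}" for y
  proof -
    \<comment> \<open>The time that the clock assigns to \<open>y\<close> is the supremum of
      \<open>A\<close>. The left limit of \<open>S\<close> gives \<open>Sm t \<le> y\<close>, its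
      right continuity gives \<open>y \<le> S t\<close>.\<close>
    define A where "A = {t \<in> {0..1}. Sm t \<le> y}"
    define t where "t = Sup A"
    have A: "0 \<in> A" "bdd_above A" unfolding A_def using y by (auto intro: bdd_aboveI[of _ 1])
    have t01: "0 \<le> t" "t \<le> 1" unfolding t_def using A cSup_upper[OF A]
      by (auto intro!: cSup_least simp: A_def)
    have "Sm t \<le> y"
    proof (rule tendsto_upperbound[OF S_left])
      have "S s \<le> y" if st: "s < t" for s
      proof -
        obtain s' where "s' \<in> A" "s < s'" using less_cSupD[of A s] A(1) st unfolding t_def by blast
        then show ?thesis using S_less[of s s'] unfolding A_def by auto
      qed
      then show "\<forall>\<^sub>F s in at_left t. S s \<le> y"
        unfolding eventually_at_left_field by (intro exI[of _ "t - 1"]) auto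
    qed simp
    have "y \<le> S t"
    proof (cases "t = 1")
      case True then show ?thesis using y by simp
    next
      case False
      show ?thesis
      proof (rule tendsto_lowerbound[OF S_right])
        have "y \<le> S s" if "t < s" "s < 1" for s
        proof -
          have "s \<notin> A" using cSup_upper[of s A] A that unfolding t_def by auto
          then have "y < Sm s" unfolding A_def using that t01 by auto
          then show ?thesis using Sm_le_S[of s] by simp
        qed
        then show "\<forall>\<^sub>F s in at_right t. y \<le> S s"
          unfolding eventually_at_right_field using False t01 by (intro exI[of _ 1]) auto
      qed simp
    qed
    \<comment> \<open>The fraction of the gap at which \<open>y\<close> sits. For an atom of mass 0
      the gap is a single point, and division by 0 yields \<open>l = 0\<close>, which is the correct
      value.\<close>
    define l where "l = (y - Sm t) / measure \<nu> {t}"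
    have l: "0 \<le> l" "l \<le> 1" "Sm t + measure \<nu> {t} * l = y"
      using \<open>Sm t \<le> y\<close> \<open>y \<le> S t\<close> unfolding l_def S_eq
      by (auto simp: divide_le_eq_1 zero_less_measure_iff)
    define x where "x = L t + l * (f t - L t)"
    have "(t, x) \<in> Gamma0 f"
    proof -
      have "x = (1 - l) * L t + l * f t" unfolding x_def by (simp add: algebra_simps)
      moreover have "(1 - l) * L t + l * f t \<le> max (L t) (f t)" using l by (intro convex_bound_le) auto
      moreover have "(1 - l) * - L t + l * - f t \<le> - min (L t) (f t)" using l by (intro convex_bound_le) auto
      ultimately show ?thesis using t01 unfolding Gamma0_iff L_def by auto
    qed
    moreover have "\<Psi> (t, x) = y"
    proof (cases "f t = L t")
      case True
      then have "t \<notin> J" unfolding J_def using t01 by auto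
      then have "measure \<nu> {t} = 0" using atom[of t] by (simp add: order_less_le)
      then show ?thesis using l unfolding \<Psi>_def by simp
    next
      case False
      then have "\<bar>x - L t\<bar> / \<bar>f t - L t\<bar> = l" unfolding x_def using l by (simp add: abs_mult)
      then show ?thesis using l unfolding \<Psi>_def by simp
    qed
    ultimately show ?thesis by blast
  qed
  have inj: "inj_on \<Psi> (Gamma0 f)"
  proof (rule inj_onI)
    fix z w assume "z \<in> Gamma0 f" "w \<in> Gamma0 f" "\<Psi> z = \<Psi> w"
    then show "z = w" using \<Psi>_less[of z w] \<Psi>_less[of w z] graph_le_total[of f z w] by auto
  qed
  have mono_S: "Sm s \<le> Sm t" "S s \<le> S t" if "s \<le> t" for s t
    using S_less[of s t] Sm_le_S[of s] Sm_le_S[of t] that by (cases "s = t", auto)+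
  have "\<Psi> ` Gamma0 f = {Sm 0..S 1}"
  proof
    show "\<Psi> ` Gamma0 f \<subseteq> {Sm 0..S 1}"
    proof safe
      fix t x assume z: "(t, x) \<in> Gamma0 f"
      then have "0 \<le> t" "t \<le> 1" unfolding Gamma0_iff by auto
      then show "\<Psi> (t, x) \<in> {Sm 0..S 1}" using \<Psi>_bd[OF z] mono_S[of 0 t] mono_S[of t 1] by auto
    qed
    show "{Sm 0..S 1} \<subseteq> \<Psi> ` Gamma0 f" using \<Psi>_ex by blast
  qed
  with inj have bij: "bij_betw \<Psi> (Gamma0 f) {Sm 0..S 1}" unfolding bij_betw_def by simp
  define d where "d = S 1 - Sm 0"
  have d: "d > 0" using S_less[of 0 1] Sm_le_S[of 0] Sm_le_S[of 1] unfolding d_def by simp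
  define A where "A r = Sm 0 + r * d" for r
  have bijA: "bij_betw A {0..1} {Sm 0..S 1}"
  proof (rule bij_betw_byWitness[where f' = "\<lambda>v. (v - Sm 0) / d"])
    show "A ` {0..1} \<subseteq> {Sm 0..S 1}"
    proof safe
      fix r :: real assume r: "r \<in> {0..1}"
      then have "r * d \<le> d" "0 \<le> r * d" using d by (auto intro: mult_left_le_one_le)
      then show "A r \<in> {Sm 0..S 1}" unfolding A_def by (auto simp: d_def)
    qed
  qed (use d in \<open>auto simp: A_def d_def\<close>)
  have "bij_betw (inv_into (Gamma0 f) \<Psi> \<circ> A) {0..1} (Gamma0 f)"
    by (rule bij_betw_trans[OF bijA bij_betw_inv_into[OF bij]])
  moreover have "graph_le f ((inv_into (Gamma0 f) \<Psi> \<circ> A) r) ((inv_into (Gamma0 f) \<Psi> \<circ> A) s)"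
    if rs: "r \<in> {0..1}" "s \<in> {0..1}" "r \<le> s" for r s
  proof (rule ccontr)
    let ?p = "inv_into (Gamma0 f) \<Psi> \<circ> A"
    assume n: "\<not> graph_le f (?p r) (?p s)"
    have mem: "?p r \<in> Gamma0 f" "?p s \<in> Gamma0 f"
      using \<open>bij_betw ?p {0..1} (Gamma0 f)\<close> rs bij_betwE by blast+
    have val: "\<Psi> (?p r) = A r" "\<Psi> (?p s) = A s"
      using bij_betw_inv_into_right[OF bij bij_betw_apply[OF bijA rs(1)]]
        bij_betw_inv_into_right[OF bij bij_betw_apply[OF bijA rs(2)]] by simp_all
    have "graph_le f (?p s) (?p r)" "?p s \<noteq> ?p r" using n graph_le_total[of f "?p r" "?p s"] by auto
    then have "A s < A r" using \<Psi>_less[OF mem(2,1)] val by simp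
    then show False using mult_right_mono[OF rs(3), of d] d unfolding A_def by simp
  qed
  ultimately show ?thesis unfolding Pi_par_def by blast
qed

section \<open>Comparing graphs along a grid\<close>

text \<open>If f s exceeds f u by more than \<open>a\<close>, the triple p, s, u forces f s \<le> f
  p + a and the triple s, u, q forces f q \<le> f u + a. Comparing the ends p and q closes the chain
  with 2a + c.\<close>

lemma Mfun_le_imp_almost_increasing:
  fixes f :: "real \<Rightarrow> real"
  assumes M: "\<And>s t u. p \<le> s \<Longrightarrow> s < t \<Longrightarrow> t < u \<Longrightarrow> u \<le> q \<Longrightarrow> Mfun (f s) (f t) (f u) \<le> a"
    and a: "0 \<le> a" and pq: "f p \<le> f q + c" and c: "0 \<le> c" and su: "p \<le> s" "s \<le> u" "u \<le> q"
  shows "f s \<le> f u + (2 * a + c)"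
proof -
  have M': "Mfun (f s) (f t) (f u) \<le> a" if "p \<le> s" "s \<le> t" "t \<le> u" "u \<le> q" for s t u
    using M[of s t u] that a by (cases "s = t \<or> t = u") auto
  have "f s \<le> max (f p) (f u) + a" using M'[of p s u] su unfolding Mfun_le_iff[OF a] by auto
  moreover have "min (f s) (f q) \<le> f u + a" using M'[of s u q] su unfolding Mfun_le_iff[OF a] by auto
  ultimately show ?thesis using pq a c by linarith
qed

text \<open>A height on the graph is bounded through values of \<open>f\<close>: its right value or
  values at slightly earlier times approaching the left limit. The hypothesis \<open>lo\<close>
  keeps these earlier times inside the cell, since the time \<tau> itself may occur only at the top
  of its segment.\<close>

lemma Gamma0_almost_increasing:
  assumes f: "cadlag_line f" and z: "(t, x) \<in> Gamma0 f" "(t', x') \<in> Gamma0 f"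
    and le: "graph_le f (t, x) (t', x')"
    and lo: "\<tau> < t \<or> t = \<tau> \<and> x = f t" and hi: "t' \<le> \<tau>'"
    and am: "\<And>s u. \<tau> \<le> s \<Longrightarrow> s \<le> u \<Longrightarrow> u \<le> \<tau>' \<Longrightarrow> f s \<le> f u + k" and k: "0 \<le> k"
  shows "x \<le> x' + k"
proof (rule field_le_epsilon)
  fix e :: real assume e: "0 < e"
  have t: "0 \<le> t" "0 \<le> t'" "t \<le> t'" using z le unfolding Gamma0_iff graph_le_def by auto
  have x: "x \<le> left_lim f t \<or> x \<le> f t" using z unfolding Gamma0_iff by linarith
  have x': "left_lim f t' \<le> x' \<or> f t' \<le> x'" using z unfolding Gamma0_iff by linarith
  have near: "\<exists>s. b < s \<and> s < v \<and> \<bar>f s - left_lim f v\<bar> < e/2" if bv: "b < v" "0 \<le> v" for b v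
  proof -
    have "\<forall>\<^sub>F s in at_left v. dist (f s) (left_lim f v) < e/2"
      by (rule tendstoD[OF cadlag_line_tendsto_left_lim[OF f bv(2)] half_gt_zero[OF e]])
    moreover have "\<forall>\<^sub>F s in at_left v. s \<in> {b<..<v}" by (rule eventually_at_left_real[OF bv(1)])
    ultimately have "\<forall>\<^sub>F s in at_left v. b < s \<and> s < v \<and> \<bar>f s - left_lim f v\<bar> < e/2"
      by eventually_elim (auto simp: dist_real_def)
    then show ?thesis by (rule eventually_happens'[rotated]) simp
  qed
  show "x \<le> x' + k + e"
  proof (cases "t < t'")
    case True
    obtain s where s: "\<tau> \<le> s" "s \<le> t" "x \<le> f s + e/2"
    proof (cases "x \<le> f t")
      case True then show ?thesis using that[of t] lo e by auto
    next
      case False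
      then have lt: "\<tau> < t" and xl: "x \<le> left_lim f t" using lo x by auto
      from near[OF lt t(1)] obtain s where "\<tau> < s" "s < t" "\<bar>f s - left_lim f t\<bar> < e/2" by blast
      with xl show ?thesis by (intro that[of s]) linarith+
    qed
    obtain u where u: "t < u" "u \<le> t'" "f u \<le> x' + e/2"
    proof (cases "f t' \<le> x'")
      case True then show ?thesis using that[of t'] \<open>t < t'\<close> e by auto
    next
      case False
      then have xl: "left_lim f t' \<le> x'" using x' by auto
      from near[OF \<open>t < t'\<close> t(2)] obtain u where "t < u" "u < t'" "\<bar>f u - left_lim f t'\<bar> < e/2" by blast
      with xl show ?thesis by (intro that[of u]) linarith+
    qed
    show ?thesis using am[of s u] s u hi by linarith
  next
    case False
    then have tt: "t' = t" using t by simp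
    have d: "\<bar>x - left_lim f t\<bar> \<le> \<bar>x' - left_lim f t\<bar>" using le unfolding graph_le_def tt by auto
    show ?thesis
    proof (cases "\<tau> < t")
      case False
      then have "x = f t" using lo by auto
      moreover have "\<bar>x' - left_lim f t\<bar> \<le> \<bar>f t - left_lim f t\<bar>"
        using z(2) unfolding tt Gamma0_iff by (intro abs_diff_on_segment_le) auto
      ultimately have "\<bar>x' - left_lim f t\<bar> = \<bar>x - left_lim f t\<bar>" using d by simp
      then have "\<bar>x' - x\<bar> = 0" using Gamma0_abs_diff[OF z(1) z(2)[unfolded tt]] by simp
      then show ?thesis using e k by simp
    next
      case True
      show ?thesis
      proof (cases "left_lim f t \<le> f t")
        case True
        then have "left_lim f t \<le> x" "left_lim f t \<le> x'" using z unfolding tt Gamma0_iff by simp_all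
        then show ?thesis using d e k by linarith
      next
        case False
        \<comment> \<open>A downward jump inside the cell: its height is a limit of differences f s
          - f t with s < t, each of which is at most \<open>k\<close>.\<close>
        then have xx: "x \<le> left_lim f t" "f t \<le> x'" using z unfolding tt Gamma0_iff by simp_all
        obtain s where s: "\<tau> < s" "s < t" "\<bar>f s - left_lim f t\<bar> < e/2" using near[OF True t(1)] by blast
        then have "f s \<le> f t + k" using hi tt by (intro am) auto
        then show ?thesis using s(3) xx e by linarith
      qed
    qed
  qed
qed

lemma cadlag_line_uminus:
  assumes f: "cadlag_line f"
  shows "cadlag_line (\<lambda>t. - f t)"
  unfolding cadlag_line_def
proof (intro conjI allI impI)
  fix t :: real
  show "- f t = 0" if "t < 0" using f that unfolding cadlag_line_def by simp
  show "- f t = - f 1" if "1 \<le> t" using f that unfolding cadlag_line_def by metis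
  show "((\<lambda>t. - f t) \<longlongrightarrow> - f t) (at_right t)" by (intro tendsto_minus cadlag_line_tendsto_right f)
  obtain l where "(f \<longlongrightarrow> l) (at_left t)" using f unfolding cadlag_line_def by blast
  then show "\<exists>l. ((\<lambda>t. - f t) \<longlongrightarrow> l) (at_left t)" by (intro exI[of _ "- l"] tendsto_minus)
qed

lemma left_lim_uminus:
  assumes f: "cadlag_line f" and "0 \<le> t"
  shows "left_lim (\<lambda>s. - f s) t = - left_lim f t"
  by (rule tendsto_unique[OF trivial_limit_at_left_real
        cadlag_line_tendsto_left_lim[OF cadlag_line_uminus[OF f]] tendsto_minus[OF cadlag_line_tendsto_left_lim[OF f]]])
     (use assms in auto)

lemma Gamma0_uminus:
  assumes "cadlag_line f" "(t, x) \<in> Gamma0 f"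
  shows "(t, - x) \<in> Gamma0 (\<lambda>s. - f s)"
proof -
  have "0 \<le> t" using assms(2) unfolding Gamma0_iff by simp
  then show ?thesis using assms(2) unfolding Gamma0_iff left_lim_uminus[OF assms(1) \<open>0 \<le> t\<close>] by auto
qed

lemma graph_le_uminus:
  assumes "cadlag_line f" "0 \<le> t" "graph_le f (t, x) (u, y)"
  shows "graph_le (\<lambda>s. - f s) (t, - x) (u, - y)"
  using assms(3) unfolding graph_le_def fst_conv snd_conv left_lim_uminus[OF assms(1,2)] by auto

text \<open>Reflection f to -f preserves the order of the graph, because distances to the left limit
  do not change.\<close>

lemma Gamma0_almost_decreasing:
  assumes f: "cadlag_line f" and z: "(t, x) \<in> Gamma0 f" "(t', x') \<in> Gamma0 f"
    and le: "graph_le f (t, x) (t', x')"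
    and lo: "\<tau> < t \<or> t = \<tau> \<and> x = f t" and hi: "t' \<le> \<tau>'"
    and am: "\<And>s u. \<tau> \<le> s \<Longrightarrow> s \<le> u \<Longrightarrow> u \<le> \<tau>' \<Longrightarrow> f u \<le> f s + k" and k: "0 \<le> k"
  shows "x' \<le> x + k"
proof -
  have "0 \<le> t" using z(1) unfolding Gamma0_iff by simp
  have "- x \<le> - x' + k"
    by (rule Gamma0_almost_increasing[OF cadlag_line_uminus[OF f] Gamma0_uminus[OF f z(1)]
          Gamma0_uminus[OF f z(2)] graph_le_uminus[OF f \<open>0 \<le> t\<close> le] _ hi _ k])
       (use lo am in force)+
  then show ?thesis by simp
qed

lemma Pi_par_ends:
  assumes p: "p \<in> Pi_par f"
  shows "p 0 = (0, 0)" "p 1 = (1, f 1)"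
proof -
  have L0: "left_lim f 0 = 0" unfolding left_lim_def by simp
  have z: "(0, 0) \<in> Gamma0 f" using Gamma0_left[of 0 f] L0 by simp
  obtain r where r: "r \<in> {0..1}" "p r = (0, 0)" using Pi_par_ex[OF p z] by blast
  have m0: "p 0 \<in> Gamma0 f" using p by (intro Pi_par_mem) auto
  have "graph_le f (p r) (p 0)" unfolding r(2) using m0 unfolding graph_le_def
    by (cases "p 0") (auto simp: Gamma0_iff L0)
  then have "r \<le> 0" using Pi_par_le_iff[OF p r(1), of 0] by simp
  then show "p 0 = (0, 0)" using r by (metis antisym atLeastAtMost_iff)
  have z: "(1, f 1) \<in> Gamma0 f" using Gamma0_right[of 1 f] by simp
  obtain s where s: "s \<in> {0..1}" "p s = (1, f 1)" using Pi_par_ex[OF p z] by blast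
  obtain t x where tx: "p 1 = (t, x)" by (metis surj_pair)
  have m1: "(t, x) \<in> Gamma0 f" unfolding tx[symmetric] using p by (intro Pi_par_mem) auto
  have "graph_le f (p 1) (p s)"
  proof (cases "t = 1")
    case True
    have "\<bar>x - left_lim f 1\<bar> \<le> \<bar>f 1 - left_lim f 1\<bar>"
      using m1 unfolding True Gamma0_iff by (intro abs_diff_on_segment_le) auto
    then show ?thesis unfolding s(2) tx True graph_le_def by simp
  next
    case False
    then show ?thesis using m1 unfolding s(2) tx Gamma0_iff graph_le_def by simp
  qed
  then have "1 \<le> s" using Pi_par_le_iff[OF p _ s(1), of 1] by simp
  then show "p 1 = (1, f 1)" using s by (metis antisym atLeastAtMost_iff)
qed

text \<open>The cell boundary \<open>\<rho> i\<close> is the parameter of the top point (T i, f (T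
  i)), so a jump at T i belongs to the cell ending there. As T 0 is negative, f (T 0) = 0 is the
  height of the starting point (0, 0), and a jump at time 0 lies inside the first cell.\<close>

lemma Pi_par_cells:
  assumes f: "cadlag_line f" and p: "p \<in> Pi_par f"
    and T0: "T 0 < 0" "0 < T 1" and Tm: "T (Suc m) = 1" and T: "\<And>i. i \<le> m \<Longrightarrow> T i < T (Suc i)"
  obtains \<rho> :: "nat \<Rightarrow> real" where "\<rho> 0 = 0" "\<rho> (Suc m) = 1" "\<And>i. i \<le> m \<Longrightarrow> \<rho> i < \<rho> (Suc i)"
    "\<And>i. i \<le> Suc m \<Longrightarrow> \<rho> i \<in> {0..1}" "\<And>i. i \<le> Suc m \<Longrightarrow> snd (p (\<rho> i)) = f (T i)"
    "\<And>i r. i \<le> m \<Longrightarrow> r \<in> {\<rho> i..\<rho> (Suc i)} \<Longrightarrow> fst (p r) \<le> T (Suc i)"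
    "\<And>i r. i \<le> m \<Longrightarrow> r \<in> {\<rho> i..\<rho> (Suc i)} \<Longrightarrow> T i < fst (p r) \<or> fst (p r) = T i \<and> snd (p r) = f (fst (p r))"
proof -
  have mono: "T i \<le> T j" if "i \<le> j" "j \<le> Suc m" for i j
    using that
  proof (induction j rule: dec_induct)
    case (step n) then show ?case using T[of n] by simp
  qed simp
  have pos: "0 < T i" "T i \<le> 1" if "1 \<le> i" "i \<le> Suc m" for i
    using mono[of 1 i] mono[of i "Suc m"] that T0 Tm by auto
  have "\<forall>i. \<exists>r. 1 \<le> i \<and> i \<le> Suc m \<longrightarrow> r \<in> {0..1} \<and> p r = (T i, f (T i))"
  proof
    fix i
    show "\<exists>r. 1 \<le> i \<and> i \<le> Suc m \<longrightarrow> r \<in> {0..1} \<and> p r = (T i, f (T i))"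
    proof (cases "1 \<le> i \<and> i \<le> Suc m")
      case True
      then have "(T i, f (T i)) \<in> Gamma0 f" using pos[of i] by (intro Gamma0_right) auto
      then show ?thesis using Pi_par_ex[OF p] by blast
    qed auto
  qed
  then obtain \<rho>' where \<rho>': "\<And>i. 1 \<le> i \<Longrightarrow> i \<le> Suc m \<Longrightarrow> \<rho>' i \<in> {0..1} \<and> p (\<rho>' i) = (T i, f (T i))"
    by metis
  define \<rho> where "\<rho> i = (if i = 0 then 0 else \<rho>' i)" for i
  have r0: "\<rho> 0 = 0" unfolding \<rho>_def by simp
  have r01: "\<rho> i \<in> {0..1}" if "i \<le> Suc m" for i using \<rho>'[of i] that unfolding \<rho>_def by auto
  have pr: "p (\<rho> i) = (T i, f (T i))" if "1 \<le> i" "i \<le> Suc m" for i using \<rho>'[OF that] that unfolding \<rho>_def by auto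
  have p0: "p (\<rho> 0) = (0, 0)" using Pi_par_ends[OF p] r0 by simp
  have "p (\<rho> (Suc m)) = p 1" using pr[of "Suc m"] Pi_par_ends[OF p] Tm by simp
  then have r1: "\<rho> (Suc m) = 1" using Pi_par_eq_iff[OF p r01] by simp
  have lt: "\<rho> i < \<rho> (Suc i)" if "i \<le> m" for i
  proof -
    have "\<not> graph_le f (p (\<rho> (Suc i))) (p (\<rho> i))"
    proof (cases "i = 0")
      case True
      then show ?thesis using p0 pr[of 1] T0 unfolding graph_le_def by simp
    next
      case False
      then show ?thesis using pr[of i] pr[of "Suc i"] T[of i] that unfolding graph_le_def by simp
    qed
    then show ?thesis using Pi_par_le_iff[OF p r01 r01, of "Suc i" i] that by simp
  qed
  have snd: "snd (p (\<rho> i)) = f (T i)" if "i \<le> Suc m" for i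
  proof (cases "i = 0")
    case True
    then show ?thesis using p0 T0 f unfolding cadlag_line_def by simp
  next
    case False then show ?thesis using pr[of i] that by simp
  qed
  have hi: "fst (p r) \<le> T (Suc i)" if "i \<le> m" "r \<in> {\<rho> i..\<rho> (Suc i)}" for i r
  proof -
    have r: "r \<in> {0..1}" using that r01[of i] r01[of "Suc i"] by auto
    have "graph_le f (p r) (p (\<rho> (Suc i)))" using Pi_par_le_iff[OF p r r01, of "Suc i"] that by simp
    then show ?thesis using pr[of "Suc i"] that unfolding graph_le_def by auto
  qed
  have lo: "T i < fst (p r) \<or> fst (p r) = T i \<and> snd (p r) = f (fst (p r))"
    if "i \<le> m" "r \<in> {\<rho> i..\<rho> (Suc i)}" for i r
  proof -
    have r: "r \<in> {0..1}" using that r01[of i] r01[of "Suc i"] by auto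
    obtain t x where tx: "p r = (t, x)" by (metis surj_pair)
    have g: "(t, x) \<in> Gamma0 f" unfolding tx[symmetric] by (rule Pi_par_mem[OF p r])
    show ?thesis
    proof (cases "i = 0")
      case True
      then show ?thesis using g T0 unfolding tx Gamma0_iff by auto
    next
      case False
      have le: "graph_le f (p (\<rho> i)) (p r)" using Pi_par_le_iff[OF p r01 r, of i] that by simp
      then have "T i < t \<or> t = T i \<and> \<bar>f t - left_lim f t\<bar> \<le> \<bar>x - left_lim f t\<bar>"
        using pr[of i] False that unfolding tx graph_le_def by auto
      moreover have "\<bar>x - left_lim f t\<bar> \<le> \<bar>f t - left_lim f t\<bar>"
        using g unfolding Gamma0_iff by (intro abs_diff_on_segment_le) auto
      moreover have "(t, f t) \<in> Gamma0 f" using g Gamma0_right unfolding Gamma0_iff by auto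
      ultimately show ?thesis using Gamma0_abs_diff[OF g, of "f t"] unfolding tx by auto
    qed
  qed
  show ?thesis using that[OF r0 r1 lt r01 snd hi lo] by blast
qed

lemma Mdist_le:
  assumes "p \<in> Pi_par f" "q \<in> Pi_par g"
    and "\<And>r. r \<in> {0..1} \<Longrightarrow> \<bar>fst (p r) - fst (q r)\<bar> \<le> e" "\<And>r. r \<in> {0..1} \<Longrightarrow> \<bar>snd (p r) - snd (q r)\<bar> \<le> e"
  shows "Mdist f g \<le> ereal e"
proof -
  have "Mdist f g \<le> (SUP r\<in>{0..1}. ereal (max \<bar>fst (p r) - fst (q r)\<bar> \<bar>snd (p r) - snd (q r)\<bar>))"
    unfolding Mdist_def using assms(1,2) by (intro Inf_lower) blast
  also have "\<dots> \<le> ereal e" using assms(3,4) by (intro SUP_least) simp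
  finally show ?thesis .
qed

lemma Pi_par_reparametrize:
  assumes q: "q \<in> Pi_par g" and h: "strict_mono_on {0..1} h" "h ` {0..1} = {0..1::real}"
  shows "q \<circ> h \<in> Pi_par g"
proof -
  have "bij_betw h {0..1} {0..1}" using h strict_mono_on_imp_inj_on unfolding bij_betw_def by blast
  then have "bij_betw (q \<circ> h) {0..1} (Gamma0 g)" by (rule bij_betw_trans[OF _ Pi_par_bij[OF q]])
  moreover have "graph_le g ((q \<circ> h) r) ((q \<circ> h) s)" if rs: "r \<in> {0..1}" "s \<in> {0..1}" "r \<le> s" for r s
  proof -
    have "h r \<in> {0..1}" "h s \<in> {0..1}" using h(2) rs by blast+
    moreover have "h r \<le> h s" by (rule strict_mono_on_leD[OF h(1) rs])
    ultimately show ?thesis unfolding comp_def by (rule Pi_par_mono[OF q])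
  qed
  ultimately show ?thesis unfolding Pi_par_def by blast
qed

text \<open>On each cell both graphs are almost monotone in the same direction, with nearby end
  values, so their heights can be matched up to 7k. Times need no matching: both points belong to
  the same cell, and its length bounds their difference.\<close>

lemma Mdist_le_of_grid:
  assumes f: "cadlag_line f" and g: "cadlag_line g" and k: "0 < k"
    and T0: "T 0 < 0" "0 < T 1" and Tm: "T (Suc m) = 1" and T: "\<And>i. i \<le> m \<Longrightarrow> T i < T (Suc i)"
    and mesh: "\<And>i. i \<le> m \<Longrightarrow> T (Suc i) - T i \<le> d"
    and near: "\<And>i. i \<le> Suc m \<Longrightarrow> \<bar>f (T i) - g (T i)\<bar> \<le> k"
    and am: "\<And>i. i \<le> m \<Longrightarrow>
       (\<forall>s u. T i \<le> s \<and> s \<le> u \<and> u \<le> T (Suc i) \<longrightarrow> f s \<le> f u + k \<and> g s \<le> g u + k) \<or>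
       (\<forall>s u. T i \<le> s \<and> s \<le> u \<and> u \<le> T (Suc i) \<longrightarrow> f u \<le> f s + k \<and> g u \<le> g s + k)"
  shows "Mdist f g \<le> ereal (max d (7 * k))"
proof -
  obtain p where p: "p \<in> Pi_par f" using Pi_par_nonempty[OF f] by blast
  obtain q where q: "q \<in> Pi_par g" using Pi_par_nonempty[OF g] by blast
  obtain \<rho> where \<rho>: "\<rho> 0 = 0" "\<rho> (Suc m) = 1" "\<And>i. i \<le> m \<Longrightarrow> \<rho> i < \<rho> (Suc i)"
    "\<And>i. i \<le> Suc m \<Longrightarrow> \<rho> i \<in> {0..1}" "\<And>i. i \<le> Suc m \<Longrightarrow> snd (p (\<rho> i)) = f (T i)"
    "\<And>i r. i \<le> m \<Longrightarrow> r \<in> {\<rho> i..\<rho> (Suc i)} \<Longrightarrow> fst (p r) \<le> T (Suc i)"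
    "\<And>i r. i \<le> m \<Longrightarrow> r \<in> {\<rho> i..\<rho> (Suc i)} \<Longrightarrow> T i < fst (p r) \<or> fst (p r) = T i \<and> snd (p r) = f (fst (p r))"
    using Pi_par_cells[OF f p T0 Tm T] by blast
  obtain \<sigma> where \<sigma>: "\<sigma> 0 = 0" "\<sigma> (Suc m) = 1" "\<And>i. i \<le> m \<Longrightarrow> \<sigma> i < \<sigma> (Suc i)"
    "\<And>i. i \<le> Suc m \<Longrightarrow> \<sigma> i \<in> {0..1}" "\<And>i. i \<le> Suc m \<Longrightarrow> snd (q (\<sigma> i)) = g (T i)"
    "\<And>i r. i \<le> m \<Longrightarrow> r \<in> {\<sigma> i..\<sigma> (Suc i)} \<Longrightarrow> fst (q r) \<le> T (Suc i)"
    "\<And>i r. i \<le> m \<Longrightarrow> r \<in> {\<sigma> i..\<sigma> (Suc i)} \<Longrightarrow> T i < fst (q r) \<or> fst (q r) = T i \<and> snd (q r) = g (fst (q r))"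
    using Pi_par_cells[OF g q T0 Tm T] by blast
  let ?P = "\<lambda>r s. \<bar>fst (p r) - fst (q s)\<bar> \<le> d \<and> \<bar>snd (p r) - snd (q s)\<bar> \<le> 7 * k"
  have "\<exists>h. strict_mono_on {\<rho> i..\<rho> (Suc i)} h \<and> h ` {\<rho> i..\<rho> (Suc i)} = {\<sigma> i..\<sigma> (Suc i)} \<and>
      (\<forall>r\<in>{\<rho> i..\<rho> (Suc i)}. ?P r (h r))" if i: "i \<le> m" for i
  proof -
    have sub: "{\<rho> i..\<rho> (Suc i)} \<subseteq> {0..1}" "{\<sigma> i..\<sigma> (Suc i)} \<subseteq> {0..1}"
      using \<rho>(4)[of i] \<rho>(4)[of "Suc i"] \<sigma>(4)[of i] \<sigma>(4)[of "Suc i"] i by auto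
    have cp: "continuous_on {\<rho> i..\<rho> (Suc i)} (\<lambda>r. snd (p r))"
      and cq: "continuous_on {\<sigma> i..\<sigma> (Suc i)} (\<lambda>r. snd (q r))"
      using continuous_on_subset[OF continuous_on_snd_Pi_par[OF f p] sub(1)]
        continuous_on_subset[OF continuous_on_snd_Pi_par[OF g q] sub(2)] by auto
    have ends: "\<bar>snd (p (\<rho> i)) - snd (q (\<sigma> i))\<bar> \<le> k" "\<bar>snd (p (\<rho> (Suc i))) - snd (q (\<sigma> (Suc i)))\<bar> \<le> k"
      using \<rho>(5)[of i] \<rho>(5)[of "Suc i"] \<sigma>(5)[of i] \<sigma>(5)[of "Suc i"] near[of i] near[of "Suc i"] i by auto
    have "\<exists>h. strict_mono_on {\<rho> i..\<rho> (Suc i)} h \<and> h ` {\<rho> i..\<rho> (Suc i)} = {\<sigma> i..\<sigma> (Suc i)} \<and>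
      (\<forall>r\<in>{\<rho> i..\<rho> (Suc i)}. \<bar>snd (p r) - snd (q (h r))\<bar> \<le> 7 * k)"
      using am[OF i]
    proof
      assume A: "\<forall>s u. T i \<le> s \<and> s \<le> u \<and> u \<le> T (Suc i) \<longrightarrow> f s \<le> f u + k \<and> g s \<le> g u + k"
      have "snd (p r) \<le> snd (p s) + k" if "\<rho> i \<le> r" "r \<le> s" "s \<le> \<rho> (Suc i)" for r s
      proof -
        have rs: "r \<in> {0..1}" "s \<in> {0..1}" using sub(1) that by auto
        show ?thesis
          by (rule Gamma0_almost_increasing[OF f, of "fst (p r)" _ "fst (p s)" _ "T i" "T (Suc i)"])
             (use \<rho>(6)[OF i, of s] \<rho>(7)[OF i, of r] A that k Pi_par_mem[OF p rs(1)] Pi_par_mem[OF p rs(2)]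
                Pi_par_mono[OF p rs that(2)] in auto)
      qed
      moreover have "snd (q r) \<le> snd (q s) + k" if "\<sigma> i \<le> r" "r \<le> s" "s \<le> \<sigma> (Suc i)" for r s
      proof -
        have rs: "r \<in> {0..1}" "s \<in> {0..1}" using sub(2) that by auto
        show ?thesis
          by (rule Gamma0_almost_increasing[OF g, of "fst (q r)" _ "fst (q s)" _ "T i" "T (Suc i)"])
             (use \<sigma>(6)[OF i, of s] \<sigma>(7)[OF i, of r] A that k Pi_par_mem[OF q rs(1)] Pi_par_mem[OF q rs(2)]
                Pi_par_mono[OF q rs that(2)] in auto)
      qed
      ultimately show ?thesis
        by (intro match_almost_increasing[OF \<rho>(3)[OF i] \<sigma>(3)[OF i] k cp cq _ _ ends])
    next
      assume A: "\<forall>s u. T i \<le> s \<and> s \<le> u \<and> u \<le> T (Suc i) \<longrightarrow> f u \<le> f s + k \<and> g u \<le> g s + k"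
      have dp: "snd (p s) \<le> snd (p r) + k" if "\<rho> i \<le> r" "r \<le> s" "s \<le> \<rho> (Suc i)" for r s
      proof -
        have rs: "r \<in> {0..1}" "s \<in> {0..1}" using sub(1) that by auto
        show ?thesis
          by (rule Gamma0_almost_decreasing[OF f, of "fst (p r)" _ "fst (p s)" _ "T i" "T (Suc i)"])
             (use \<rho>(6)[OF i, of s] \<rho>(7)[OF i, of r] A that k Pi_par_mem[OF p rs(1)] Pi_par_mem[OF p rs(2)]
                Pi_par_mono[OF p rs that(2)] in auto)
      qed
      have dq: "snd (q s) \<le> snd (q r) + k" if "\<sigma> i \<le> r" "r \<le> s" "s \<le> \<sigma> (Suc i)" for r s
      proof -
        have rs: "r \<in> {0..1}" "s \<in> {0..1}" using sub(2) that by auto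
        show ?thesis
          by (rule Gamma0_almost_decreasing[OF g, of "fst (q r)" _ "fst (q s)" _ "T i" "T (Suc i)"])
             (use \<sigma>(6)[OF i, of s] \<sigma>(7)[OF i, of r] A that k Pi_par_mem[OF q rs(1)] Pi_par_mem[OF q rs(2)]
                Pi_par_mono[OF q rs that(2)] in auto)
      qed
      \<comment> \<open>The matching for increasing functions is applied to the negated
        heights.\<close>
      have "\<exists>h. strict_mono_on {\<rho> i..\<rho> (Suc i)} h \<and> h ` {\<rho> i..\<rho> (Suc i)} = {\<sigma> i..\<sigma> (Suc i)} \<and>
        (\<forall>r\<in>{\<rho> i..\<rho> (Suc i)}. \<bar>- snd (p r) - - snd (q (h r))\<bar> \<le> 7 * k)"
        using dp dq ends
        by (intro match_almost_increasing[OF \<rho>(3)[OF i] \<sigma>(3)[OF i] k continuous_on_minus[OF cp] continuous_on_minus[OF cq]])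
           (auto simp: abs_minus_commute algebra_simps)
      then show ?thesis by (simp add: abs_minus_commute)
    qed
    then obtain h where h: "strict_mono_on {\<rho> i..\<rho> (Suc i)} h" "h ` {\<rho> i..\<rho> (Suc i)} = {\<sigma> i..\<sigma> (Suc i)}"
      "\<And>r. r \<in> {\<rho> i..\<rho> (Suc i)} \<Longrightarrow> \<bar>snd (p r) - snd (q (h r))\<bar> \<le> 7 * k" by blast
    have "\<bar>fst (p r) - fst (q (h r))\<bar> \<le> d" if r: "r \<in> {\<rho> i..\<rho> (Suc i)}" for r
    proof -
      have hr: "h r \<in> {\<sigma> i..\<sigma> (Suc i)}" using h(2) r by blast
      show ?thesis using \<rho>(6,7)[OF i r] \<sigma>(6,7)[OF i hr] mesh[OF i] by linarith
    qed
    with h show ?thesis by blast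
  qed
  from conjunct2[OF glue_cells[of m \<rho> \<sigma> ?P, OF \<rho>(3) this]]
  obtain h where h: "strict_mono_on {0..1} h" "h ` {0..1} = {0..1}" "\<And>r. r \<in> {0..1} \<Longrightarrow> ?P r (h r)"
    unfolding \<rho>(1,2) \<sigma>(1,2) by blast
  show ?thesis
    by (rule Mdist_le[OF p Pi_par_reparametrize[OF q h(1,2)]]) (use h(3) in \<open>force simp: le_max_iff_disj\<close>)+
qed

section \<open>A compactness criterion\<close>

lemma Mfun_uminus: "Mfun (- x) (- y) (- z) = Mfun x y z"
  unfolding Mfun_eq minus_max_eq_min[symmetric] minus_min_eq_max[symmetric]
  by (simp add: max.commute add.commute)

text \<open>Each condition involves finitely many values and is closed, so the set is stable under
  pointwise limits; a cadlag requirement would destroy this. \<open>\<delta>\<close> is an inverse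
  modulus: \<eta> is the permitted oscillation, \<open>\<delta> \<eta>\<close> the scale that
  guarantees it.\<close>

definition equi_osc :: "(real \<Rightarrow> real) \<Rightarrow> real \<Rightarrow> (real \<Rightarrow> real) set" where
  "equi_osc \<delta> R = {g. (\<forall>t<0. g t = 0) \<and> (\<forall>t\<ge>1. g t = g 1) \<and> (\<forall>t. \<bar>g t\<bar> \<le> R) \<and>
     (\<forall>\<eta>>0. \<forall>s t u. s < t \<longrightarrow> t < u \<longrightarrow> u - s < \<delta> \<eta> \<longrightarrow> Mfun (g s) (g t) (g u) \<le> \<eta>)}"

lemma equi_oscD:
  assumes "g \<in> equi_osc \<delta> R"
  shows "t < 0 \<Longrightarrow> g t = 0" "1 \<le> t \<Longrightarrow> g t = g 1" "\<bar>g t\<bar> \<le> R"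
    "0 < \<eta> \<Longrightarrow> s < t \<Longrightarrow> t < u \<Longrightarrow> u - s < \<delta> \<eta> \<Longrightarrow> Mfun (g s) (g t) (g u) \<le> \<eta>"
  using assms unfolding equi_osc_def by blast+

lemma compact_equi_osc: "compact (equi_osc \<delta> R)"
proof -
  have "closed (equi_osc \<delta> R)"
    unfolding equi_osc_def
    by (intro closed_Collect_conj closed_Collect_all closed_Collect_imp open_Collect_const
          closed_Collect_eq closed_Collect_le continuous_intros continuous_on_product_coordinates)
  moreover have "compact (PiE UNIV (\<lambda>_::real. {- R..R}))"
    using compactin_PiE[of "\<lambda>_. euclidean" UNIV "\<lambda>_::real. {- R..R}"]
    by (simp add: euclidean_product_topology)
  moreover have "equi_osc \<delta> R \<subseteq> PiE UNIV (\<lambda>_. {- R..R})"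
  proof
    fix g assume g: "g \<in> equi_osc \<delta> R"
    have "g t \<in> {- R..R}" for t using equi_oscD(3)[OF g, of t] by (simp add: abs_le_iff)
    then show "g \<in> PiE UNIV (\<lambda>_. {- R..R})" by (simp only: PiE_UNIV_domain Pi_iff) simp
  qed
  ultimately show ?thesis by (metis compact_Int_closed Int_absorb1)
qed

text \<open>An up-crossing of a gap larger than the oscillation followed by a down-crossing is impossible in a
  short interval, so lower and upper limits agree.\<close>

lemma osc_imp_right_limit:
  fixes g :: "real \<Rightarrow> real"
  assumes bd: "\<And>t. \<bar>g t\<bar> \<le> R"
    and osc: "\<And>\<eta>. 0 < \<eta> \<Longrightarrow> \<exists>d>0. \<forall>s t u. s < t \<longrightarrow> t < u \<longrightarrow> u - s < d \<longrightarrow> Mfun (g s) (g t) (g u) \<le> \<eta>"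
  shows "\<exists>l. (g \<longlongrightarrow> l) (at_right t)"
proof -
  let ?F = "at_right t" and ?G = "\<lambda>s. ereal (g s)"
  have nt: "?F \<noteq> bot" by simp
  have "Limsup ?F ?G \<le> Liminf ?F ?G"
  proof (rule ccontr)
    assume "\<not> Limsup ?F ?G \<le> Liminf ?F ?G"
    then have "Liminf ?F ?G < Limsup ?F ?G" by simp
    then obtain c where c: "Liminf ?F ?G < ereal c" "ereal c < Limsup ?F ?G" using ereal_dense2 by blast
    obtain d where d: "ereal c < ereal d" "ereal d < Limsup ?F ?G" using ereal_dense2[OF c(2)] by blast
    have lo: "\<exists>\<^sub>F s in ?F. g s < c"
    proof (rule ccontr)
      assume "\<not> (\<exists>\<^sub>F s in ?F. g s < c)"
      then have "\<forall>\<^sub>F s in ?F. ereal c \<le> ?G s" by (simp add: not_frequently not_less)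
      from Liminf_bounded[OF this] c(1) show False by simp
    qed
    have hi: "\<exists>\<^sub>F s in ?F. d < g s"
    proof (rule ccontr)
      assume "\<not> (\<exists>\<^sub>F s in ?F. d < g s)"
      then have "\<forall>\<^sub>F s in ?F. ?G s \<le> ereal d" by (simp add: not_frequently not_less)
      from Limsup_bounded[OF this] d(2) show False by simp
    qed
    have cd: "0 < (d - c) / 2" "c < d" using d(1) by auto
    obtain \<theta> where \<theta>: "\<theta> > 0" "\<And>s v u. s < v \<Longrightarrow> v < u \<Longrightarrow> u - s < \<theta> \<Longrightarrow> Mfun (g s) (g v) (g u) \<le> (d - c) / 2"
      using osc[OF cd(1)] by blast
    have pick: "\<exists>s. t < s \<and> s < b \<and> P s" if "\<exists>\<^sub>F s in ?F. P s" "t < b" for P b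
    proof -
      have "\<exists>\<^sub>F s in ?F. P s \<and> s \<in> {t<..<b}"
        by (rule frequently_eventually_frequently[OF that(1) eventually_at_right_real[OF that(2)]])
      then show ?thesis by (auto dest: frequently_ex)
    qed
    \<comment> \<open>The times are chosen from right to left, each closer to \<open>t\<close> than
      the one before, and form a low-high-low pattern whose \<open>M\<close>-value exceeds (d -
      c)/2.\<close>
    obtain u where u: "t < u" "u < t + \<theta>" "g u < c" using pick[OF lo, of "t + \<theta>"] \<theta> by auto
    obtain v where v: "t < v" "v < u" "d < g v" using pick[OF hi u(1)] by auto
    obtain s where s: "t < s" "s < v" "g s < c" using pick[OF lo v(1)] by auto
    have "Mfun (g s) (g v) (g u) \<le> (d - c) / 2" by (rule \<theta>(2)) (use s v u in auto)
    moreover have "g v - max (g s) (g u) \<le> Mfun (g s) (g v) (g u)" unfolding Mfun_eq by simp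
    moreover have "max (g s) (g u) < c" using s(3) u(3) by simp
    ultimately show False using v(3) cd by (simp add: field_simps)
  qed
  then have eq: "Limsup ?F ?G = Liminf ?F ?G" using Liminf_le_Limsup[OF nt, of ?G] by (rule antisym)
  have "ereal (- R) \<le> Liminf ?F ?G" "Limsup ?F ?G \<le> ereal R"
    using bd by (auto intro!: Liminf_bounded Limsup_bounded always_eventually simp: abs_le_iff minus_le_iff)
  then obtain l where l: "Liminf ?F ?G = ereal l" using eq by (cases "Liminf ?F ?G") auto
  have "(?G \<longlongrightarrow> ereal l) ?F" by (rule Liminf_eq_Limsup[OF nt l]) (use eq l in simp)
  then show ?thesis by (auto simp: lim_ereal)
qed

text \<open>Time reversal reduces this to right limits, since \<open>Mfun\<close> is symmetric in
  its outer arguments.\<close>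

lemma osc_imp_left_limit:
  fixes g :: "real \<Rightarrow> real"
  assumes bd: "\<And>t. \<bar>g t\<bar> \<le> R"
    and osc: "\<And>\<eta>. 0 < \<eta> \<Longrightarrow> \<exists>d>0. \<forall>s t u. s < t \<longrightarrow> t < u \<longrightarrow> u - s < d \<longrightarrow> Mfun (g s) (g t) (g u) \<le> \<eta>"
  shows "\<exists>l. (g \<longlongrightarrow> l) (at_left t)"
  unfolding filterlim_at_left_to_right
proof (rule osc_imp_right_limit[where R = R])
  fix \<eta> :: real assume "0 < \<eta>"
  then obtain d where d: "d > 0" "\<And>s t u. s < t \<Longrightarrow> t < u \<Longrightarrow> u - s < d \<Longrightarrow> Mfun (g s) (g t) (g u) \<le> \<eta>"
    using osc by blast
  have "Mfun (g (- s)) (g (- t)) (g (- u)) \<le> \<eta>" if "s < t" "t < u" "u - s < d" for s t u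
    using d(2)[of "- u" "- t" "- s"] that by (simp add: Mfun_sym)
  then show "\<exists>d>0. \<forall>s t u. s < t \<longrightarrow> t < u \<longrightarrow> u - s < d \<longrightarrow> Mfun (g (- s)) (g (- t)) (g (- u)) \<le> \<eta>"
    using d(1) by blast
qed (rule bd)

section \<open>The right-continuous regularisation and its neighbourhoods\<close>

definition right_reg :: "(real \<Rightarrow> real) \<Rightarrow> real \<Rightarrow> real" where
  "right_reg g t = Lim (at_right t) g"

context
  fixes \<delta> :: "real \<Rightarrow> real" and R :: real and g :: "real \<Rightarrow> real"
  assumes \<delta>: "\<And>\<eta>. 0 < \<eta> \<Longrightarrow> 0 < \<delta> \<eta>" and g: "g \<in> equi_osc \<delta> R"
begin

lemma equi_osc_osc: "0 < \<eta> \<Longrightarrow> \<exists>d>0. \<forall>s t u. s < t \<longrightarrow> t < u \<longrightarrow> u - s < d \<longrightarrow> Mfun (g s) (g t) (g u) \<le> \<eta>"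
  using \<delta> equi_oscD(4)[OF g] by blast

lemma right_reg_tendsto: "(g \<longlongrightarrow> right_reg g t) (at_right t)"
proof -
  obtain l where l: "(g \<longlongrightarrow> l) (at_right t)"
    using osc_imp_right_limit[OF equi_oscD(3)[OF g] equi_osc_osc] by blast
  then have "right_reg g t = l" unfolding right_reg_def by (intro tendsto_Lim) simp
  then show ?thesis using l by simp
qed

text \<open>A closed bound for \<open>g\<close> on an open interval passes to the regularisation,
  left end included. The one-sided limits and the boundary values of \<open>right_reg g\<close> are
  all obtained this way.\<close>

lemma right_reg_near:
  assumes "\<And>q. a < q \<Longrightarrow> q < b \<Longrightarrow> \<bar>g q - l\<bar> \<le> e" "a \<le> s" "s < b"
  shows "\<bar>right_reg g s - l\<bar> \<le> e"
proof (rule tendsto_upperbound)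
  show "((\<lambda>q. \<bar>g q - l\<bar>) \<longlongrightarrow> \<bar>right_reg g s - l\<bar>) (at_right s)"
    by (intro tendsto_intros right_reg_tendsto)
  show "\<forall>\<^sub>F q in at_right s. \<bar>g q - l\<bar> \<le> e"
    unfolding eventually_at_right_field using assms by (intro exI[of _ b]) auto
qed simp

lemma right_reg_right_cont: "(right_reg g \<longlongrightarrow> right_reg g t) (at_right t)"
proof (rule tendstoI)
  fix e :: real assume e: "0 < e"
  have "\<forall>\<^sub>F q in at_right t. dist (g q) (right_reg g t) < e/2"
    by (rule tendstoD[OF right_reg_tendsto half_gt_zero[OF e]])
  then obtain b where b: "t < b" "\<And>q. t < q \<Longrightarrow> q < b \<Longrightarrow> \<bar>g q - right_reg g t\<bar> < e/2"
    unfolding eventually_at_right_field dist_real_def by blast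
  have "\<bar>right_reg g s - right_reg g t\<bar> \<le> e/2" if "t < s" "s < b" for s
    by (rule right_reg_near[of t b]) (use b(2) that less_imp_le in auto)
  then have "dist (right_reg g s) (right_reg g t) < e" if "t < s" "s < b" for s
    using that e unfolding dist_real_def by fastforce
  then show "\<forall>\<^sub>F s in at_right t. dist (right_reg g s) (right_reg g t) < e"
    unfolding eventually_at_right_field using b(1) by blast
qed

lemma right_reg_left_limit:
  assumes "(g \<longlongrightarrow> l) (at_left t)"
  shows "(right_reg g \<longlongrightarrow> l) (at_left t)"
proof (rule tendstoI)
  fix e :: real assume e: "0 < e"
  have "\<forall>\<^sub>F q in at_left t. dist (g q) l < e/2"
    by (rule tendstoD[OF assms half_gt_zero[OF e]])
  then obtain b where b: "b < t" "\<And>q. b < q \<Longrightarrow> q < t \<Longrightarrow> \<bar>g q - l\<bar> < e/2"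
    unfolding eventually_at_left_field dist_real_def by blast
  have "\<bar>right_reg g s - l\<bar> \<le> e/2" if "b < s" "s < t" for s
    by (rule right_reg_near[of b t]) (use b(2) that less_imp_le in auto)
  then have "dist (right_reg g s) l < e" if "b < s" "s < t" for s
    using that e unfolding dist_real_def by fastforce
  then show "\<forall>\<^sub>F s in at_left t. dist (right_reg g s) l < e"
    unfolding eventually_at_left_field using b(1) by blast
qed

lemma right_reg_left: "t < 0 \<Longrightarrow> right_reg g t = 0"
  using right_reg_near[of t 0 0 0 t] equi_oscD(1)[OF g] by simp

lemma right_reg_right: "1 \<le> t \<Longrightarrow> right_reg g t = g 1"
proof -
  assume t: "1 \<le> t"
  have "\<bar>g q - g 1\<bar> \<le> 0" if "t < q" for q using equi_oscD(2)[OF g, of q] t that by simp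
  then show ?thesis using right_reg_near[of t "t + 1" "g 1" 0 t] by simp
qed

lemma cadlag_line_right_reg: "cadlag_line (right_reg g)"
  unfolding cadlag_line_def
proof (intro conjI allI impI)
  fix t :: real
  show "right_reg g t = 0" if "t < 0" using that by (rule right_reg_left)
  show "right_reg g t = right_reg g 1" if "1 \<le> t" using right_reg_right[OF that] right_reg_right[of 1] by simp
  show "(right_reg g \<longlongrightarrow> right_reg g t) (at_right t)" by (rule right_reg_right_cont)
  obtain l where "(g \<longlongrightarrow> l) (at_left t)"
    using osc_imp_left_limit[OF equi_oscD(3)[OF g] equi_osc_osc] by blast
  then show "\<exists>l. (right_reg g \<longlongrightarrow> l) (at_left t)" using right_reg_left_limit by blast
qed

lemma right_reg_equi_osc: "right_reg g \<in> equi_osc \<delta> R"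
  unfolding equi_osc_def
proof (intro CollectI conjI allI impI)
  fix t :: real
  show "right_reg g t = 0" if "t < 0" using that by (rule right_reg_left)
  show "right_reg g t = right_reg g 1" if "1 \<le> t" using right_reg_right[OF that] right_reg_right[of 1] by simp
  show "\<bar>right_reg g t\<bar> \<le> R" using right_reg_near[of t "t + 1" 0 R t] equi_oscD(3)[OF g] by simp
next
  fix \<eta> s t u :: real assume \<eta>: "0 < \<eta>" and stu: "s < t" "t < u" "u - s < \<delta> \<eta>"
  \<comment> \<open>Shifting the three times by the same h > 0 preserves u - s, so the
    regularisation keeps the same modulus.\<close>
  have shift: "((\<lambda>h. g (v + h)) \<longlongrightarrow> right_reg g v) (at_right 0)" for v
    using right_reg_tendsto[of v] unfolding filterlim_at_right_to_0[of _ _ v] by (simp add: add.commute)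
  show "Mfun (right_reg g s) (right_reg g t) (right_reg g u) \<le> \<eta>"
  proof (rule tendsto_upperbound[OF tendsto_Mfun[OF shift shift shift]])
    show "\<forall>\<^sub>F h in at_right 0. Mfun (g (s + h)) (g (t + h)) (g (u + h)) \<le> \<eta>"
      using stu by (intro always_eventually allI equi_oscD(4)[OF g \<eta>]) auto
  qed simp
qed

text \<open>If h is close to g at \<open>q1\<close> and \<open>q2\<close>, the modulus of h traps h
  t between two values near \<open>right_reg g t\<close>. In this way finitely many coordinates
  control h at a grid time.\<close>

lemma bracket_continuity_point:
  assumes l: "(g \<longlongrightarrow> right_reg g t) (at_left t)" and \<eta>: "0 < \<eta>" and d: "0 < d"
  shows "\<exists>q1 q2. q1 < t \<and> t < q2 \<and> q2 - q1 < d \<and> \<bar>g q1 - right_reg g t\<bar> < \<eta> \<and> \<bar>g q2 - right_reg g t\<bar> < \<eta>"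
proof -
  have "\<forall>\<^sub>F q in at_left t. q \<in> {t - d/2<..<t}" using d by (intro eventually_at_left_real) simp
  with tendstoD[OF l \<eta>] have "\<forall>\<^sub>F q in at_left t. q \<in> {t - d/2<..<t} \<and> \<bar>g q - right_reg g t\<bar> < \<eta>"
    by eventually_elim (simp add: dist_real_def)
  then obtain q1 where 1: "q1 \<in> {t - d/2<..<t} \<and> \<bar>g q1 - right_reg g t\<bar> < \<eta>"
    using eventually_happens'[OF trivial_limit_at_left_real] by blast
  have "\<forall>\<^sub>F q in at_right t. q \<in> {t<..<t + d/2}" using d by (intro eventually_at_right_real) simp
  with tendstoD[OF right_reg_tendsto \<eta>] have "\<forall>\<^sub>F q in at_right t. q \<in> {t<..<t + d/2} \<and> \<bar>g q - right_reg g t\<bar> < \<eta>"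
    by eventually_elim (simp add: dist_real_def)
  then obtain q2 where 2: "q2 \<in> {t<..<t + d/2} \<and> \<bar>g q2 - right_reg g t\<bar> < \<eta>"
    using eventually_happens'[OF trivial_limit_at_right_real] by blast
  from 1 2 show ?thesis by (intro exI[of _ q1] exI[of _ q2]) auto
qed

text \<open>\<open>g\<close> and its regularisation have the same left limits, so it suffices to
  avoid the countably many jumps of the regularisation.\<close>

lemma ex_continuity_point:
  assumes "a < b"
  shows "\<exists>t. a < t \<and> t < b \<and> (g \<longlongrightarrow> right_reg g t) (at_left t)"
proof -
  let ?f = "right_reg g"
  obtain t where t: "a < t" "t < b" "t \<notin> {t. 0 \<le> t \<and> left_lim ?f t \<noteq> ?f t}"
    using real_interval_avoid_countable_set[OF assms countable_jumps[OF cadlag_line_right_reg]] by auto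
  obtain l where l: "(g \<longlongrightarrow> l) (at_left t)"
    using osc_imp_left_limit[OF equi_oscD(3)[OF g] equi_osc_osc] by blast
  have "l = ?f t"
  proof (cases "t < 0")
    case True
    have "\<forall>\<^sub>F s in at_left t. g s = 0"
      unfolding eventually_at_left_field using True equi_oscD(1)[OF g] by (intro exI[of _ "t - 1"]) auto
    then have "(g \<longlongrightarrow> 0) (at_left t)" by (rule tendsto_eventually)
    then show ?thesis using tendsto_unique[OF trivial_limit_at_left_real l] right_reg_left[OF True] by simp
  next
    case False
    then have "left_lim ?f t = ?f t" using t(3) by auto
    moreover have "(?f \<longlongrightarrow> left_lim ?f t) (at_left t)"
      using False by (intro cadlag_line_tendsto_left_lim cadlag_line_right_reg) simp
    ultimately show ?thesis
      using tendsto_unique[OF trivial_limit_at_left_real right_reg_left_limit[OF l]] by simp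
  qed
  then show ?thesis using l t by blast
qed

lemma Mdist_right_reg_nbhd:
  assumes e: "0 < e"
  shows "\<exists>V. open V \<and> g \<in> V \<and> (\<forall>h\<in>V \<inter> equi_osc \<delta> R. cadlag_line h \<longrightarrow> Mdist (right_reg g) h < ereal e)"
proof -
  let ?f = "right_reg g"
  \<comment> \<open>The grid estimate yields 7k = e/2. Almost monotonicity will hold with 2\<eta> +
    6\<eta>, which the next line makes equal to \<open>k\<close>.\<close>
  define k where "k = e / 14"
  define \<eta> where "\<eta> = k / 8"
  have k: "0 < k" and \<eta>: "0 < \<eta>" unfolding \<eta>_def k_def using e by auto
  \<comment> \<open>The mesh will be below 2/n, which must be less than e/2 for the error in time
    and less than \<open>\<delta> \<eta>\<close> for the modulus to apply on a whole cell.\<close>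
  obtain N where N: "2 / min (e/2) (\<delta> \<eta>) < real N" using reals_Archimedean2 by blast
  define m where "m = N"
  define n where "n = real (Suc m)"
  have mn: "0 < min (e/2) (\<delta> \<eta>)" using e \<delta>[OF \<eta>] by simp
  have n: "0 < n" "2 / n < min (e/2) (\<delta> \<eta>)"
  proof -
    show "0 < n" unfolding n_def by simp
    have "2 / min (e/2) (\<delta> \<eta>) < n" using N unfolding n_def m_def by simp
    then show "2 / n < min (e/2) (\<delta> \<eta>)"
      by (simp only: pos_divide_less_eq[OF mn] pos_divide_less_eq[OF \<open>0 < n\<close>] mult.commute)
  qed
  have "\<forall>i. \<exists>t. (real i - 1) / n < t \<and> t < real i / n \<and> (g \<longlongrightarrow> ?f t) (at_left t)"
    using n(1) by (intro allI ex_continuity_point divide_strict_right_mono) auto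
  then obtain T' where T': "\<And>i. (real i - 1) / n < T' i" "\<And>i. T' i < real i / n"
    "\<And>i. (g \<longlongrightarrow> ?f (T' i)) (at_left (T' i))" by metis
  \<comment> \<open>One continuity point in each interval ((i-1)/n, i/n), so the grid starts left of
    0. It ends exactly at 1, where the regularisation keeps the value of \<open>g\<close> and
    continuity is not asked for.\<close>
  define T where "T i = (if i \<le> m then T' i else 1)" for i
  have Tb: "(real i - 1) / n < T i \<and> T i \<le> real i / n" if "i \<le> Suc m" for i
  proof (cases "i \<le> m")
    case True then show ?thesis using T'(1,2)[of i] unfolding T_def by simp
  next
    case False
    then have "i = Suc m" using that by simp
    then show ?thesis unfolding T_def n_def by simp
  qed
  note Tlo = Tb[THEN conjunct1] and Thi = Tb[THEN conjunct2]
  have T0: "T 0 < 0" using T'(2)[of 0] unfolding T_def by simp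
  have T1: "0 < T 1" using Tlo[of 1] by simp
  have Tm: "T (Suc m) = 1" unfolding T_def by simp
  have T: "T i < T (Suc i)" if "i \<le> m" for i
  proof -
    have "T i \<le> real i / n" using Thi[of i] that by simp
    also have "\<dots> < T (Suc i)" using Tlo[of "Suc i"] that by simp
    finally show ?thesis .
  qed
  have mesh: "T (Suc i) - T i < 2 / n" if "i \<le> m" for i
  proof -
    have "T (Suc i) \<le> (real i + 1) / n" "(real i - 1) / n < T i"
      using Thi[of "Suc i"] Tlo[of i] that by (auto simp: add.commute)
    then show ?thesis by (simp add: add_divide_distrib diff_divide_distrib)
  qed
  have "\<forall>i. \<exists>q1 q2. q1 < T' i \<and> T' i < q2 \<and> q2 - q1 < \<delta> \<eta> \<and> \<bar>g q1 - ?f (T' i)\<bar> < \<eta> \<and> \<bar>g q2 - ?f (T' i)\<bar> < \<eta>"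
    by (intro allI bracket_continuity_point T'(3) \<eta> \<delta>)
  then obtain q1 q2 where q: "\<And>i. q1 i < T' i" "\<And>i. T' i < q2 i" "\<And>i. q2 i - q1 i < \<delta> \<eta>"
    "\<And>i. \<bar>g (q1 i) - ?f (T' i)\<bar> < \<eta>" "\<And>i. \<bar>g (q2 i) - ?f (T' i)\<bar> < \<eta>" by metis
  define Q where "Q = insert 1 (q1 ` {..m} \<union> q2 ` {..m})"
  define V where "V = (\<Inter>q\<in>Q. {h :: real \<Rightarrow> real. \<bar>h q - g q\<bar> < \<eta>})"
  have "open V" unfolding V_def
    by (intro open_INT ballI open_Collect_less continuous_intros continuous_on_product_coordinates)
       (simp add: Q_def)
  moreover have "g \<in> V" unfolding V_def using \<eta> by simp
  moreover have "Mdist ?f h < ereal e" if h: "h \<in> V" "h \<in> equi_osc \<delta> R" "cadlag_line h" for h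
  proof -
    have hQ: "\<bar>h q - g q\<bar> < \<eta>" if "q \<in> Q" for q using h(1) that unfolding V_def by blast
    \<comment> \<open>One \<eta> each from the modulus of \<open>h\<close>, from \<open>h\<close>
      against \<open>g\<close> at the bracketing points, and from \<open>g\<close> against the
      regularised value.\<close>
    have near: "\<bar>?f (T i) - h (T i)\<bar> \<le> 3 * \<eta>" if i: "i \<le> Suc m" for i
    proof (cases "i \<le> m")
      case True
      have "Mfun (h (q1 i)) (h (T' i)) (h (q2 i)) \<le> \<eta>"
        by (rule equi_oscD(4)[OF h(2) \<eta> q(1,2,3)])
      then have "min (h (q1 i)) (h (q2 i)) \<le> h (T' i) + \<eta>" "h (T' i) \<le> max (h (q1 i)) (h (q2 i)) + \<eta>"
        using \<eta> by (simp_all only: Mfun_le_iff less_imp_le)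
      moreover have "\<bar>h (q1 i) - g (q1 i)\<bar> < \<eta>" "\<bar>h (q2 i) - g (q2 i)\<bar> < \<eta>"
        using hQ True unfolding Q_def by auto
      ultimately have "\<bar>?f (T' i) - h (T' i)\<bar> \<le> 3 * \<eta>" using q(4,5)[of i] by linarith
      then show ?thesis using True unfolding T_def by simp
    next
      case False
      then show ?thesis using hQ[of 1] right_reg_right[of 1] \<eta> i unfolding Q_def T_def by auto
    qed
    have f_osc: "Mfun (?f s) (?f t) (?f u) \<le> \<eta>" "Mfun (h s) (h t) (h u) \<le> \<eta>"
      if "i \<le> m" "T i \<le> s" "s < t" "t < u" "u \<le> T (Suc i)" for i s t u
    proof -
      have "u - s < \<delta> \<eta>" using mesh[of i] n(2) that by linarith
      then show "Mfun (?f s) (?f t) (?f u) \<le> \<eta>" "Mfun (h s) (h t) (h u) \<le> \<eta>"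
        using equi_oscD(4)[OF right_reg_equi_osc \<eta> that(3,4)] equi_oscD(4)[OF h(2) \<eta> that(3,4)] by auto
    qed
    have k8: "2 * \<eta> + 6 * \<eta> = k" unfolding \<eta>_def by simp
    have "Mdist ?f h \<le> ereal (max (2 / n) (7 * k))"
    proof (rule Mdist_le_of_grid[OF cadlag_line_right_reg h(3) k T0 T1 Tm T])
      show "T (Suc i) - T i \<le> 2 / n" if "i \<le> m" for i using mesh[OF that] by simp
      show "\<bar>?f (T i) - h (T i)\<bar> \<le> k" if "i \<le> Suc m" for i using near[OF that] k8 \<eta> by simp
      fix i assume i: "i \<le> m"
      note ne = near[of i] near[of "Suc i"]
      show "(\<forall>s u. T i \<le> s \<and> s \<le> u \<and> u \<le> T (Suc i) \<longrightarrow> ?f s \<le> ?f u + k \<and> h s \<le> h u + k) \<or>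
        (\<forall>s u. T i \<le> s \<and> s \<le> u \<and> u \<le> T (Suc i) \<longrightarrow> ?f u \<le> ?f s + k \<and> h u \<le> h s + k)"
      proof (cases "?f (T i) \<le> ?f (T (Suc i))")
        case True
        \<comment> \<open>The sign of the increment of the regularisation fixes the direction for
          both paths. The increment of \<open>h\<close> differs from it by at most 3\<eta> at each
          end, hence the slack 6\<eta>.\<close>
        then have "?f (T i) \<le> ?f (T (Suc i)) + 6 * \<eta>" "h (T i) \<le> h (T (Suc i)) + 6 * \<eta>"
          using ne i \<eta> by auto
        note ends = this
        have "?f s \<le> ?f u + (2 * \<eta> + 6 * \<eta>)" if "T i \<le> s" "s \<le> u" "u \<le> T (Suc i)" for s u
          by (rule Mfun_le_imp_almost_increasing[OF _ less_imp_le[OF \<eta>] ends(1) _ that]) (use f_osc(1)[OF i] \<eta> in auto)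
        moreover have "h s \<le> h u + (2 * \<eta> + 6 * \<eta>)" if "T i \<le> s" "s \<le> u" "u \<le> T (Suc i)" for s u
          by (rule Mfun_le_imp_almost_increasing[OF _ less_imp_le[OF \<eta>] ends(2) _ that]) (use f_osc(2)[OF i] \<eta> in auto)
        ultimately show ?thesis unfolding k8 by blast
      next
        case False
        then have "- ?f (T i) \<le> - ?f (T (Suc i)) + 6 * \<eta>" "- h (T i) \<le> - h (T (Suc i)) + 6 * \<eta>"
          using ne i \<eta> by auto
        note ends = this
        have "?f u \<le> ?f s + k" if "T i \<le> s" "s \<le> u" "u \<le> T (Suc i)" for s u
        proof -
          have "- ?f s \<le> - ?f u + (2 * \<eta> + 6 * \<eta>)"
            by (rule Mfun_le_imp_almost_increasing[where f = "\<lambda>t. - ?f t", OF _ less_imp_le[OF \<eta>] ends(1) _ that])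
               (use f_osc(1)[OF i] \<eta> in \<open>auto simp: Mfun_uminus\<close>)
          then show ?thesis unfolding k8 by simp
        qed
        moreover have "h u \<le> h s + k" if "T i \<le> s" "s \<le> u" "u \<le> T (Suc i)" for s u
        proof -
          have "- h s \<le> - h u + (2 * \<eta> + 6 * \<eta>)"
            by (rule Mfun_le_imp_almost_increasing[where f = "\<lambda>t. - h t", OF _ less_imp_le[OF \<eta>] ends(2) _ that])
               (use f_osc(2)[OF i] \<eta> in \<open>auto simp: Mfun_uminus\<close>)
          then show ?thesis unfolding k8 by simp
        qed
        ultimately show ?thesis by blast
      qed
    qed
    also have "\<dots> < ereal e" using n(2) e unfolding k_def by simp
    finally show ?thesis .
  qed
  ultimately show ?thesis by blast
qed

end

section \<open>Paths on [0,1], their extensions, and the topology of dist\<close>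

definition line_ext :: "(real \<Rightarrow> real) \<Rightarrow> real \<Rightarrow> real" where
  "line_ext f t = (if t < 0 then 0 else if t \<le> 1 then f t else f 1)"

lemma cadlag_line_ext:
  assumes f: "f \<in> Dspace"
  shows "cadlag_line (line_ext f)"
  unfolding cadlag_line_def
proof (intro conjI allI impI)
  fix t :: real
  show "line_ext f t = 0" if "t < 0" using that by (simp add: line_ext_def)
  show "line_ext f t = line_ext f 1" if "1 \<le> t" using that by (simp add: line_ext_def)
  consider "t < 0" | "0 \<le> t" "t < 1" | "1 \<le> t" by linarith
  then show "(line_ext f \<longlongrightarrow> line_ext f t) (at_right t)"
  proof cases
    case 1
    then have "\<forall>\<^sub>F s in at_right t. line_ext f s = line_ext f t"
      unfolding eventually_at_right_field by (intro exI[of _ 0]) (auto simp: line_ext_def)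
    then show ?thesis by (rule tendsto_eventually)
  next
    case 2
    have "(f \<longlongrightarrow> f t) (at_right t)" using f 2 unfolding Dspace_def cadlag_def by simp
    moreover have "\<forall>\<^sub>F s in at_right t. f s = line_ext f s"
      unfolding eventually_at_right_field using 2 by (intro exI[of _ 1]) (auto simp: line_ext_def)
    ultimately show ?thesis using 2 by (auto simp: line_ext_def[of f t] intro: Lim_transform_eventually)
  next
    case 3
    then have "\<forall>\<^sub>F s in at_right t. line_ext f s = line_ext f t"
      unfolding eventually_at_right_field by (intro exI[of _ "t + 1"]) (auto simp: line_ext_def)
    then show ?thesis by (rule tendsto_eventually)
  qed
  consider "t \<le> 0" | "0 < t" "t \<le> 1" | "1 < t" by linarith
  then show "\<exists>l. (line_ext f \<longlongrightarrow> l) (at_left t)"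
  proof cases
    case 1
    then have "\<forall>\<^sub>F s in at_left t. line_ext f s = 0"
      unfolding eventually_at_left_field by (intro exI[of _ "t - 1"]) (auto simp: line_ext_def)
    then show ?thesis by (blast intro: tendsto_eventually)
  next
    case 2
    have "(f \<longlongrightarrow> left_lim f t) (at_left t)" using f 2 by (rule tendsto_left_lim)
    moreover have "\<forall>\<^sub>F s in at_left t. f s = line_ext f s"
      unfolding eventually_at_left_field using 2 by (intro exI[of _ 0]) (auto simp: line_ext_def)
    ultimately show ?thesis by (blast intro: Lim_transform_eventually)
  next
    case 3
    then have "\<forall>\<^sub>F s in at_left t. line_ext f s = f 1"
      unfolding eventually_at_left_field by (intro exI[of _ 1]) (auto simp: line_ext_def)
    then show ?thesis by (blast intro: tendsto_eventually)
  qed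
qed

lemma cadlag_line_Dspace:
  assumes "cadlag_line f"
  shows "f \<in> Dspace" "line_ext f = f"
proof -
  show "f \<in> Dspace" using assms unfolding cadlag_line_def Dspace_def cadlag_def by blast
  show "line_ext f = f"
  proof
    fix t
    have "t < 0 \<Longrightarrow> f t = 0" "1 \<le> t \<Longrightarrow> f t = f 1" using assms unfolding cadlag_line_def by blast+
    then show "line_ext f t = f t" unfolding line_ext_def by (cases "t < 0"; cases "t \<le> 1") simp_all
  qed
qed

lemma left_lim_cong:
  assumes "\<And>s. s \<in> {0..1} \<Longrightarrow> f s = g s" "t \<in> {0..1}"
  shows "left_lim f t = left_lim g t"
proof (cases "t = 0")
  case False
  have "\<forall>\<^sub>F s in at_left t. f s = g s"
    unfolding eventually_at_left_field using assms False by (intro exI[of _ 0]) auto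
  then have "(f \<longlongrightarrow> l) (at_left t) \<longleftrightarrow> (g \<longlongrightarrow> l) (at_left t)" for l
    by (rule filterlim_cong[OF refl refl])
  then show ?thesis unfolding left_lim_def t2_space_class.Lim_def by simp
qed (simp add: left_lim_def)

text \<open>Graphs and parametrizations depend only on the values on [0,1], so a path may be
  replaced by its extension without changing distances.\<close>

lemma Pi_par_cong:
  assumes "\<And>s. s \<in> {0..1} \<Longrightarrow> f s = g s"
  shows "Pi_par f = Pi_par g"
proof -
  have G: "Gamma0 f = Gamma0 g"
    unfolding Gamma0_def using left_lim_cong[of f g, OF assms] assms by auto
  have gl: "graph_le f z w \<longleftrightarrow> graph_le g z w" if "z \<in> Gamma0 f" for z w
    using that left_lim_cong[of f g "fst z", OF assms] unfolding Gamma0_def graph_le_def by auto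
  show ?thesis unfolding Pi_par_def G[symmetric]
    by (intro Collect_cong conj_cong refl ball_cong imp_cong gl) (rule bij_betw_apply)
qed

lemma Mdist_line_ext: "Mdist g (line_ext f) = Mdist g f"
proof -
  have "Pi_par (line_ext f) = Pi_par f" by (rule Pi_par_cong) (simp add: line_ext_def)
  then show ?thesis unfolding Mdist_def by simp
qed

lemma openin_Dtop: "openin Dtop U \<longleftrightarrow> U \<subseteq> Dspace \<and> (\<forall>f\<in>U. \<exists>e>0. {g \<in> Dspace. Mdist f g < ereal e} \<subseteq> U)"
proof -
  let ?P = "\<lambda>U. U \<subseteq> Dspace \<and> (\<forall>f\<in>U. \<exists>e>0. {g \<in> Dspace. Mdist f g < ereal e} \<subseteq> U)"
  have "istopology ?P"
    unfolding istopology_def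
  proof (intro conjI allI impI)
    fix S T assume S: "?P S" and T: "?P T"
    show "S \<inter> T \<subseteq> Dspace" using S by blast
    show "\<forall>f\<in>S \<inter> T. \<exists>e>0. {g \<in> Dspace. Mdist f g < ereal e} \<subseteq> S \<inter> T"
    proof
      fix f assume "f \<in> S \<inter> T"
      then obtain a b where ab: "0 < a" "0 < b" "{g \<in> Dspace. Mdist f g < ereal a} \<subseteq> S" "{g \<in> Dspace. Mdist f g < ereal b} \<subseteq> T"
        using S T by blast
      have "{g \<in> Dspace. Mdist f g < ereal (min a b)} \<subseteq> S \<inter> T"
      proof
        fix g assume g: "g \<in> {g \<in> Dspace. Mdist f g < ereal (min a b)}"
        have "ereal (min a b) \<le> ereal a" "ereal (min a b) \<le> ereal b" by simp_all
        then show "g \<in> S \<inter> T" using g ab(3,4) by (auto dest: less_le_trans)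
      qed
      then show "\<exists>e>0. {g \<in> Dspace. Mdist f g < ereal e} \<subseteq> S \<inter> T" using ab(1,2)
        by (intro exI[of _ "min a b"]) simp
    qed
  next
    fix \<K> assume K: "\<forall>U\<in>\<K>. ?P U"
    then show "\<Union>\<K> \<subseteq> Dspace" by blast
    show "\<forall>f\<in>\<Union>\<K>. \<exists>e>0. {g \<in> Dspace. Mdist f g < ereal e} \<subseteq> \<Union>\<K>"
    proof
      fix f assume "f \<in> \<Union>\<K>"
      then obtain U where U: "U \<in> \<K>" "f \<in> U" by blast
      then obtain e where "e > 0" "{g \<in> Dspace. Mdist f g < ereal e} \<subseteq> U" using K by blast
      then show "\<exists>e>0. {g \<in> Dspace. Mdist f g < ereal e} \<subseteq> \<Union>\<K>" using U(1) by blast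
    qed
  qed
  then show ?thesis unfolding Dtop_def by (simp add: topology_inverse')
qed

lemma topspace_Dtop: "topspace Dtop = Dspace"
proof
  show "topspace Dtop \<subseteq> Dspace" using openin_topspace[of Dtop] unfolding openin_Dtop by blast
  have "openin Dtop Dspace" unfolding openin_Dtop by (auto intro: exI[of _ 1])
  then show "Dspace \<subseteq> topspace Dtop" by (rule openin_subset)
qed

text \<open>A continuous-image argument carried out on covers. Each g of the pointwise compact set
  is sent to \<open>right_reg g\<close>, which lies in some member W of the cover together with a
  ball; a product neighbourhood of g is small enough that every path whose extension lies in it
  belongs to W. Finitely many such neighbourhoods suffice.\<close>

lemma compactin_Dtop_equi_osc:
  assumes \<delta>: "\<And>\<eta>. 0 < \<eta> \<Longrightarrow> 0 < \<delta> \<eta>"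
  shows "compactin Dtop {f \<in> Dspace. line_ext f \<in> equi_osc \<delta> R}" (is "compactin _ ?K")
  unfolding compactin_def
proof (intro conjI allI impI)
  show "?K \<subseteq> topspace Dtop" unfolding topspace_Dtop by blast
next
  fix \<U> assume U: "Ball \<U> (openin Dtop) \<and> ?K \<subseteq> \<Union>\<U>"
  have ex: "\<forall>g\<in>equi_osc \<delta> R. \<exists>V W. open V \<and> g \<in> V \<and> W \<in> \<U> \<and> (\<forall>f\<in>?K. line_ext f \<in> V \<longrightarrow> f \<in> W)"
  proof
    fix g assume g: "g \<in> equi_osc \<delta> R"
    have cl: "cadlag_line (right_reg g)" by (rule cadlag_line_right_reg[OF \<delta> g])
    have "right_reg g \<in> ?K"
      using cadlag_line_Dspace[OF cl] right_reg_equi_osc[OF \<delta> g] by simp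
    then obtain W where W: "W \<in> \<U>" "right_reg g \<in> W" using U by blast
    then have "openin Dtop W" using U by blast
    then obtain e where e: "e > 0" "{h \<in> Dspace. Mdist (right_reg g) h < ereal e} \<subseteq> W"
      using W(2) unfolding openin_Dtop by blast
    obtain V where V: "open V" "g \<in> V" "\<And>h. h \<in> V \<inter> equi_osc \<delta> R \<Longrightarrow> cadlag_line h \<Longrightarrow> Mdist (right_reg g) h < ereal e"
      using Mdist_right_reg_nbhd[OF \<delta> g e(1)] by blast
    have "f \<in> W" if f: "f \<in> ?K" "line_ext f \<in> V" for f
    proof -
      have "Mdist (right_reg g) (line_ext f) < ereal e"
        using f by (intro V(3) cadlag_line_ext) auto
      then show ?thesis using e(2) f(1) unfolding Mdist_line_ext by blast
    qed
    with V(1,2) W(1) show "\<exists>V W. open V \<and> g \<in> V \<and> W \<in> \<U> \<and> (\<forall>f\<in>?K. line_ext f \<in> V \<longrightarrow> f \<in> W)" by blast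
  qed
  obtain V where V: "\<forall>g\<in>equi_osc \<delta> R. \<exists>W. open (V g) \<and> g \<in> V g \<and> W \<in> \<U> \<and> (\<forall>f\<in>?K. line_ext f \<in> V g \<longrightarrow> f \<in> W)"
    using bchoice[OF ex] by blast
  obtain W where VW: "\<And>g. g \<in> equi_osc \<delta> R \<Longrightarrow> open (V g) \<and> g \<in> V g \<and> W g \<in> \<U> \<and> (\<forall>f\<in>?K. line_ext f \<in> V g \<longrightarrow> f \<in> W g)"
    using bchoice[OF V] by blast
  obtain C where C: "C \<subseteq> equi_osc \<delta> R" "finite C" "equi_osc \<delta> R \<subseteq> (\<Union>g\<in>C. V g)"
  proof (rule compactE_image[OF compact_equi_osc])
    show "open (V g)" if "g \<in> equi_osc \<delta> R" for g using VW[OF that] by blast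
    show "equi_osc \<delta> R \<subseteq> (\<Union>g\<in>equi_osc \<delta> R. V g)" using VW by blast
  qed
  have "?K \<subseteq> \<Union>(W ` C)"
  proof
    fix f assume f: "f \<in> ?K"
    then obtain g where "g \<in> C" "line_ext f \<in> V g" using C(3) by blast
    then show "f \<in> \<Union>(W ` C)" using VW[of g] C(1) f by blast
  qed
  moreover have "finite (W ` C)" using C(2) by simp
  moreover have "W ` C \<subseteq> \<U>" using C(1) VW by blast
  ultimately show "\<exists>\<F>. finite \<F> \<and> \<F> \<subseteq> \<U> \<and> ?K \<subseteq> \<Union>\<F>" by blast
qed

section \<open>Exponential tightness\<close>

lemma finite_net_of_dense:
  fixes D :: "real set"
  assumes "{0..1} \<subseteq> closure D" "0 < \<eta>"
  obtains Q where "finite Q" "Q \<subseteq> D" "\<And>t. t \<in> {0..1} \<Longrightarrow> \<exists>q\<in>Q. \<bar>q - t\<bar> < \<eta>"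
proof -
  have cov: "{0..1} \<subseteq> (\<Union>q\<in>D. ball q \<eta>)"
  proof
    fix t :: real assume "t \<in> {0..1}"
    then have "t \<in> closure D" using assms(1) by blast
    then obtain q where "q \<in> D" "dist q t < \<eta>" using assms(2) unfolding closure_approachable by blast
    then show "t \<in> (\<Union>q\<in>D. ball q \<eta>)" by auto
  qed
  obtain Q where Q: "Q \<subseteq> D" "finite Q" "{0..1} \<subseteq> (\<Union>q\<in>Q. ball q \<eta>)"
  proof (rule compactE_image[OF compact_Icc])
    show "{0..1} \<subseteq> (\<Union>q\<in>D. ball q \<eta>)" by (rule cov)
  qed auto
  have "\<exists>q\<in>Q. \<bar>q - t\<bar> < \<eta>" if t: "t \<in> {0..1}" for t
  proof -
    obtain q where "q \<in> Q" "t \<in> ball q \<eta>" using Q(3) t by blast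
    then show ?thesis by (auto simp: dist_real_def)
  qed
  with Q show ?thesis using that by blast
qed

text \<open>If the middle time is outside (0, 1), two neighbouring values coincide and
  \<open>M\<close> vanishes. Otherwise the outer times are clamped to [0,1], which shortens the
  interval and, thanks to \<open>f 0 = 0\<close>, does not change the values.\<close>

lemma line_ext_equi_osc:
  assumes dc: "dyadic_control f N \<beta>" and \<beta>: "0 < \<beta>" and D: "f \<in> Dspace" and f0: "f 0 = 0"
    and bd: "\<And>t. t \<in> {0..1} \<Longrightarrow> \<bar>f t\<bar> \<le> R"
    and nn: "\<And>\<eta>. 0 < \<eta> \<Longrightarrow> N < nn \<eta> \<and> chain_bound \<beta> (nn \<eta>) \<le> \<eta>"
  shows "line_ext f \<in> equi_osc (\<lambda>\<eta>. 1/2^(nn \<eta>)) R"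
  unfolding equi_osc_def
proof (intro CollectI conjI allI impI)
  fix t :: real
  show "line_ext f t = 0" if "t < 0" using that by (simp add: line_ext_def)
  show "line_ext f t = line_ext f 1" if "1 \<le> t" using that by (simp add: line_ext_def)
  have "0 \<le> R" using bd[of 0] f0 by simp
  then show "\<bar>line_ext f t\<bar> \<le> R" using bd[of t] bd[of 1] by (simp add: line_ext_def)
next
  fix \<eta> s t u :: real
  assume \<eta>: "0 < \<eta>" and stu: "s < t" "t < u" "u - s < 1/2^(nn \<eta>)"
  consider "t \<le> 0" | "0 < t" "t < 1" | "1 \<le> t" by linarith
  then show "Mfun (line_ext f s) (line_ext f t) (line_ext f u) \<le> \<eta>"
  proof cases
    case 1
    then have "line_ext f s = 0" "line_ext f t = 0" using stu f0 by (auto simp: line_ext_def)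
    then show ?thesis using \<eta> by simp
  next
    case 2
    have "line_ext f s = f (max s 0)" "line_ext f t = f t" "line_ext f u = f (min u 1)"
      using 2 stu f0 by (auto simp: line_ext_def max_def min_def)
    moreover have "Mfun (f (max s 0)) (f t) (f (min u 1)) \<le> chain_bound \<beta> (nn \<eta>)"
      by (rule Mfun_le_chain_bound[OF dc \<beta> _ D]) (use nn[OF \<eta>] 2 stu in auto)
    ultimately show ?thesis using nn[OF \<eta>] by simp
  next
    case 3
    then have "line_ext f u = line_ext f t" using stu by (auto simp: line_ext_def)
    then show ?thesis using \<eta> by simp
  qed
qed

text \<open>An interior time has a controlled time within d/4 on each side, namely a net point or an
  end of [0,1]. The modulus at scale \<open>d\<close> traps the value within \<open>a\<close> of the
  range of these two.\<close>

lemma bounded_by_grid_values: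
  fixes f :: "real \<Rightarrow> real"
  assumes M: "\<And>s t u. 0 \<le> s \<Longrightarrow> s < t \<Longrightarrow> t < u \<Longrightarrow> u \<le> 1 \<Longrightarrow> u - s < d \<Longrightarrow> Mfun (f s) (f t) (f u) \<le> a"
    and a: "0 \<le> a" and d: "0 < d" and f0: "f 0 = 0"
    and Q: "Q \<subseteq> {0..1}" "\<And>t. t \<in> {0..1} \<Longrightarrow> \<exists>q\<in>Q. \<bar>q - t\<bar> < d/8"
    and B: "0 \<le> B" "\<And>q. q \<in> insert 1 Q \<Longrightarrow> \<bar>f q\<bar> \<le> B" and t: "t \<in> {0..1}"
  shows "\<bar>f t\<bar> \<le> B + a"
proof -
  consider "t = 0" | "t = 1" | "0 < t" "t < 1" using t by (metis atLeastAtMost_iff order_le_less)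
  then show ?thesis
  proof cases
    case 1 then show ?thesis using f0 B a by simp
  next
    case 2 then show ?thesis using B(2)[of 1] a by simp
  next
    case 3
    have "\<exists>q1. 0 \<le> q1 \<and> q1 < t \<and> t - q1 \<le> d/4 \<and> \<bar>f q1\<bar> \<le> B"
    proof (cases "t \<le> d/4")
      case True then show ?thesis using 3 f0 B(1) by (intro exI[of _ 0]) auto
    next
      case False
      \<comment> \<open>Aiming at t - d/8 with tolerance d/8 gives a net point strictly to the left
        of \<open>t\<close> and within d/4 of it.\<close>
      then obtain q where q: "q \<in> Q" "\<bar>q - (t - d/8)\<bar> < d/8" using Q(2)[of "t - d/8"] 3 d by auto
      moreover have "0 \<le> q" using q(1) Q(1) by auto
      moreover have "\<bar>f q\<bar> \<le> B" using q(1) B(2) by blast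
      moreover have "q < t" "t - q \<le> d/4" using q(2) by linarith+
      ultimately show ?thesis by blast
    qed
    then obtain q1 where q1: "0 \<le> q1" "q1 < t" "t - q1 \<le> d/4" "\<bar>f q1\<bar> \<le> B" by blast
    have "\<exists>q2. q2 \<le> 1 \<and> t < q2 \<and> q2 - t \<le> d/4 \<and> \<bar>f q2\<bar> \<le> B"
    proof (cases "1 - t \<le> d/4")
      case True then show ?thesis using 3 B(2)[of 1] by (intro exI[of _ 1]) auto
    next
      case False
      then obtain q where q: "q \<in> Q" "\<bar>q - (t + d/8)\<bar> < d/8" using Q(2)[of "t + d/8"] 3 d by auto
      moreover have "q \<le> 1" using q(1) Q(1) by auto
      moreover have "\<bar>f q\<bar> \<le> B" using q(1) B(2) by blast
      moreover have "t < q" "q - t \<le> d/4" using q(2) by linarith+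
      ultimately show ?thesis by blast
    qed
    then obtain q2 where q2: "q2 \<le> 1" "t < q2" "q2 - t \<le> d/4" "\<bar>f q2\<bar> \<le> B" by blast
    have "Mfun (f q1) (f t) (f q2) \<le> a" by (rule M) (use q1 q2 d in auto)
    then have "min (f q1) (f q2) \<le> f t + a" "f t \<le> max (f q1) (f q2) + a"
      by (simp_all only: Mfun_le_iff[OF a])
    then show ?thesis using q1(4) q2(4) by linarith
  qed
qed

lemma exp_tight_realD:
  assumes "exp_tight M s Y (euclidean :: real topology)"
  shows "\<exists>B. 0 \<le> B \<and> (\<forall>\<^sub>F \<epsilon> in at_right 0. outer_prob M {\<omega> \<in> space M. B < \<bar>Y \<epsilon> \<omega>\<bar>} \<le> exp (- L / \<epsilon> powr s))"
proof -
  obtain K \<delta> where K: "compactin euclidean K" and \<delta>: "\<delta> > 0"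
    "\<And>\<epsilon>. 0 < \<epsilon> \<Longrightarrow> \<epsilon> < \<delta> \<Longrightarrow> outer_prob M {\<omega> \<in> space M. Y \<epsilon> \<omega> \<notin> K} \<le> exp (- L / \<epsilon> powr s)"
    using assms unfolding exp_tight_def by blast
  have "bounded K" using K by (simp add: compact_imp_bounded)
  then obtain B where B: "B > 0" "\<And>x. x \<in> K \<Longrightarrow> \<bar>x\<bar> \<le> B" unfolding bounded_pos by auto
  have "outer_prob M {\<omega> \<in> space M. B < \<bar>Y \<epsilon> \<omega>\<bar>} \<le> exp (- L / \<epsilon> powr s)" if "0 < \<epsilon>" "\<epsilon> < \<delta>" for \<epsilon>
  proof -
    have "outer_prob M {\<omega> \<in> space M. B < \<bar>Y \<epsilon> \<omega>\<bar>} \<le> outer_prob M {\<omega> \<in> space M. Y \<epsilon> \<omega> \<notin> K}"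
      by (rule outer_prob_mono) (use B(2) in \<open>auto simp: not_less[symmetric]\<close>)
    then show ?thesis using \<delta>(2)[OF that] by linarith
  qed
  then have "\<forall>\<^sub>F \<epsilon> in at_right 0. outer_prob M {\<omega> \<in> space M. B < \<bar>Y \<epsilon> \<omega>\<bar>} \<le> exp (- L / \<epsilon> powr s)"
    unfolding eventually_at_right_field using \<delta>(1) by blast
  then show ?thesis using B(1) by (intro exI[of _ B]) simp
qed

text \<open>Dyadic control from level \<open>N\<close> on supplies the whole modulus at once. A
  uniform bound then needs only one scale, so finitely many points of the dense set suffice and the
  number of exceptional events does not depend on \<epsilon>.\<close>

lemma exp_tight_Dtop:
  fixes X :: "real \<Rightarrow> 'a \<Rightarrow> real \<Rightarrow> real"
  assumes P: "prob_space M" and s: "0 < s" and \<beta>: "0 < \<beta>"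
    and D: "\<And>\<epsilon> \<omega>. \<epsilon> > 0 \<Longrightarrow> \<omega> \<in> space M \<Longrightarrow> X \<epsilon> \<omega> \<in> Dspace"
    and X0: "\<And>\<epsilon> \<omega>. \<epsilon> > 0 \<Longrightarrow> \<omega> \<in> space M \<Longrightarrow> X \<epsilon> \<omega> 0 = 0"
    and dc: "\<And>L. \<exists>N. \<exists>\<delta>>0. \<forall>\<epsilon>. 0 < \<epsilon> \<and> \<epsilon> < \<delta> \<longrightarrow>
       outer_prob M {\<omega> \<in> space M. \<not> dyadic_control (X \<epsilon> \<omega>) N \<beta>} \<le> exp (- L / \<epsilon> powr s)"
    and dense: "\<D> \<subseteq> {0..1}" "{0..1} \<subseteq> closure \<D>" "1 \<in> \<D>"
    and tight: "\<And>q. q \<in> \<D> \<Longrightarrow> exp_tight M s (\<lambda>\<epsilon> \<omega>. X \<epsilon> \<omega> q) euclidean"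
  shows "exp_tight M s X Dtop"
  unfolding exp_tight_def
proof
  fix L :: real
  obtain N \<delta>1 where \<delta>1: "\<delta>1 > 0" "\<And>\<epsilon>. 0 < \<epsilon> \<Longrightarrow> \<epsilon> < \<delta>1 \<Longrightarrow>
       outer_prob M {\<omega> \<in> space M. \<not> dyadic_control (X \<epsilon> \<omega>) N \<beta>} \<le> exp (- (L+1) / \<epsilon> powr s)"
    using dc[of "L+1"] by blast
  define d :: real where "d = 1/2^(Suc N)"
  define a where "a = chain_bound \<beta> (Suc N)"
  have d: "0 < d" and a: "0 \<le> a" unfolding d_def a_def using chain_bound_pos[OF \<beta>, of "Suc N"] by auto
  have d8: "0 < d/8" using d by simp
  obtain Q where Q: "finite Q" "Q \<subseteq> \<D>" "\<And>t. t \<in> {0..1} \<Longrightarrow> \<exists>q\<in>Q. \<bar>q - t\<bar> < d/8"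
    using finite_net_of_dense[OF dense(2) d8] by blast
  define Q1 where "Q1 = insert 1 Q"
  have Q1: "finite Q1" "Q1 \<subseteq> \<D>" unfolding Q1_def using Q dense by auto
  have "\<forall>q\<in>Q1. \<exists>B. 0 \<le> B \<and> (\<forall>\<^sub>F \<epsilon> in at_right 0. outer_prob M {\<omega> \<in> space M. B < \<bar>X \<epsilon> \<omega> q\<bar>} \<le> exp (- (L+1) / \<epsilon> powr s))"
    using Q1(2) tight by (intro ballI exp_tight_realD) blast
  from bchoice[OF this] obtain B where B: "\<And>q. q \<in> Q1 \<Longrightarrow> 0 \<le> B q"
    "\<And>q. q \<in> Q1 \<Longrightarrow> \<forall>\<^sub>F \<epsilon> in at_right 0. outer_prob M {\<omega> \<in> space M. B q < \<bar>X \<epsilon> \<omega> q\<bar>} \<le> exp (- (L+1) / \<epsilon> powr s)"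
    by blast
  define B' where "B' = (\<Sum>q\<in>Q1. B q)"
  have B': "B q \<le> B'" if "q \<in> Q1" for q unfolding B'_def using that B(1) Q1(1) by (intro member_le_sum) auto
  have B'0: "0 \<le> B'" unfolding B'_def using B(1) by (intro sum_nonneg)
  have "\<exists>n. N < n \<and> chain_bound \<beta> n \<le> \<eta>" if "0 < \<eta>" for \<eta>
  proof -
    have "\<forall>\<^sub>F n in sequentially. chain_bound \<beta> n < \<eta>"
      by (rule order_tendstoD(2)[OF chain_bound_tendsto_0[OF \<beta>] that])
    with eventually_gt_at_top[of N] have "\<forall>\<^sub>F n in sequentially. N < n \<and> chain_bound \<beta> n \<le> \<eta>"
      by eventually_elim simp
    then show ?thesis using eventually_happens'[OF sequentially_bot] by blast
  qed
  \<comment> \<open>For each \<eta> a level beyond \<open>N\<close> whose chaining bound is at most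
    \<eta>; its mesh is the scale used in the compact set.\<close>
  then obtain nn where nn: "\<And>\<eta>. 0 < \<eta> \<Longrightarrow> N < nn \<eta> \<and> chain_bound \<beta> (nn \<eta>) \<le> \<eta>" by metis
  define K where "K = {f \<in> Dspace. line_ext f \<in> equi_osc (\<lambda>\<eta>. 1/2^(nn \<eta>)) (B' + a)}"
  have Kc: "compactin Dtop K" unfolding K_def by (rule compactin_Dtop_equi_osc) simp
  have good: "X \<epsilon> \<omega> \<in> K" if \<epsilon>: "0 < \<epsilon>" and \<omega>: "\<omega> \<in> space M" and c: "dyadic_control (X \<epsilon> \<omega>) N \<beta>"
    and b: "\<And>q. q \<in> Q1 \<Longrightarrow> \<bar>X \<epsilon> \<omega> q\<bar> \<le> B q" for \<epsilon> \<omega>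
  proof -
    have bB: "\<bar>X \<epsilon> \<omega> q\<bar> \<le> B'" if "q \<in> insert 1 Q" for q
      using b[of q] B'[of q] that unfolding Q1_def by simp
    have QI: "Q \<subseteq> {0..1}" using Q(2) dense(1) by blast
    have M: "Mfun (X \<epsilon> \<omega> s) (X \<epsilon> \<omega> t) (X \<epsilon> \<omega> u) \<le> a"
      if "0 \<le> s" "s < t" "t < u" "u \<le> 1" "u - s < d" for s t u
      unfolding a_def by (rule Mfun_le_chain_bound[OF c \<beta> lessI D[OF \<epsilon> \<omega>]]) (use that d_def in auto)
    have bd: "\<bar>X \<epsilon> \<omega> t\<bar> \<le> B' + a" if "t \<in> {0..1}" for t
      by (rule bounded_by_grid_values[where f = "X \<epsilon> \<omega>", OF M a d X0[OF \<epsilon> \<omega>] QI Q(3) B'0 bB that])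
    show ?thesis unfolding K_def
      using D[OF \<epsilon> \<omega>] line_ext_equi_osc[OF c \<beta> D[OF \<epsilon> \<omega>] X0[OF \<epsilon> \<omega>] bd nn] by blast
  qed
  have evQ: "\<forall>\<^sub>F \<epsilon> in at_right 0. \<forall>q\<in>Q1. outer_prob M {\<omega> \<in> space M. B q < \<bar>X \<epsilon> \<omega> q\<bar>} \<le> exp (- (L+1) / \<epsilon> powr s)"
    by (rule eventually_ball_finite[OF Q1(1)]) (use B(2) in blast)
  have evd: "\<forall>\<^sub>F \<epsilon> in at_right 0. outer_prob M {\<omega> \<in> space M. \<not> dyadic_control (X \<epsilon> \<omega>) N \<beta>} \<le> exp (- (L+1) / \<epsilon> powr s)"
    unfolding eventually_at_right_field using \<delta>1 by blast
  \<comment> \<open>One event for the failure of dyadic control and one for each point of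
    \<open>Q1\<close>, all at rate \<open>L + 1\<close>.\<close>
  have evc: "\<forall>\<^sub>F \<epsilon> in at_right 0. (1 + real (card Q1)) * exp (- (L+1) * \<epsilon> powr (- s)) \<le> exp (- L / \<epsilon> powr s)"
    using eventually_exp_absorbs_const[OF s, of "1 + real (card Q1)" L] unfolding eventually_at_right_field by blast
  have "\<forall>\<^sub>F \<epsilon> in at_right 0. outer_prob M {\<omega> \<in> space M. X \<epsilon> \<omega> \<notin> K} \<le> exp (- L / \<epsilon> powr s)"
    using evQ evd evc eventually_at_right_less[of 0]
  proof eventually_elim
    case (elim \<epsilon>)
    let ?E = "exp (- (L+1) / \<epsilon> powr s)"
    let ?A = "{\<omega> \<in> space M. \<not> dyadic_control (X \<epsilon> \<omega>) N \<beta>}" and ?S = "\<lambda>q. {\<omega> \<in> space M. B q < \<bar>X \<epsilon> \<omega> q\<bar>}"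
    have "outer_prob M {\<omega> \<in> space M. X \<epsilon> \<omega> \<notin> K} \<le> outer_prob M (?A \<union> (\<Union>q\<in>Q1. ?S q))"
    proof (rule outer_prob_mono, safe)
      fix \<omega> assume w: "\<omega> \<in> space M" "X \<epsilon> \<omega> \<notin> K" "\<omega> \<notin> (\<Union>q\<in>Q1. ?S q)" "dyadic_control (X \<epsilon> \<omega>) N \<beta>"
      have "\<bar>X \<epsilon> \<omega> q\<bar> \<le> B q" if "q \<in> Q1" for q using w(1,3) that by (auto simp: not_less)
      then show False using good[OF elim(4) w(1) w(4)] w(2) by blast
    qed
    also have "\<dots> \<le> outer_prob M ?A + outer_prob M (\<Union>q\<in>Q1. ?S q)" by (rule outer_prob_Un_le[OF P])
    also have "\<dots> \<le> ?E + (\<Sum>q\<in>Q1. ?E)"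
      using elim(1,2) by (intro add_mono order_trans[OF outer_prob_UN_le[OF P Q1(1)]] sum_mono) auto
    also have "\<dots> = (1 + real (card Q1)) * exp (- (L+1) * \<epsilon> powr (- s))"
      by (simp add: powr_minus divide_inverse algebra_simps)
    finally show ?case using elim(3) by linarith
  qed
  then obtain \<delta> where "\<delta> > 0" "\<And>\<epsilon>. 0 < \<epsilon> \<Longrightarrow> \<epsilon> < \<delta> \<Longrightarrow> outer_prob M {\<omega> \<in> space M. X \<epsilon> \<omega> \<notin> K} \<le> exp (- L / \<epsilon> powr s)"
    unfolding eventually_at_right_field by blast
  then show "\<exists>K. compactin Dtop K \<and> (\<exists>\<delta>>0. \<forall>\<epsilon>. 0 < \<epsilon> \<and> \<epsilon> < \<delta> \<longrightarrow>
      outer_prob M {\<omega> \<in> space M. X \<epsilon> \<omega> \<notin> K} \<le> exp (- L / \<epsilon> powr s))"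
    using Kc by blast
qed

text \<open>The limits are unfolded: for each rate L, all large N, then all small \<epsilon>. Stated
  with exp instead of log, the bound also covers probability 0. Outer probability spares a proof
  that the supremum in \<open>wM\<close> over uncountably many times is measurable.\<close>

theorem theorem2p2:
  fixes M :: "'a measure" and X :: "real \<Rightarrow> 'a \<Rightarrow> real \<Rightarrow> real"
    and \<alpha> \<alpha>' :: real
  assumes "prob_space M"
    and "\<alpha> > 1" and "\<alpha>' = \<alpha> / (\<alpha> - 1)"
    and "\<And>\<epsilon> t. \<epsilon> > 0 \<Longrightarrow> t \<in> {0..1} \<Longrightarrow> (\<lambda>\<omega>. X \<epsilon> \<omega> t) \<in> borel_measurable M"
    and "\<And>\<epsilon> \<omega>. \<epsilon> > 0 \<Longrightarrow> \<omega> \<in> space M \<Longrightarrow> X \<epsilon> \<omega> \<in> Dspace"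
    and "\<And>\<epsilon> \<omega>. \<epsilon> > 0 \<Longrightarrow> \<omega> \<in> space M \<Longrightarrow> X \<epsilon> \<omega> 0 = 0"
    and "\<exists>c C. 0 < c \<and> 0 < C \<and>
           (\<forall>lam \<epsilon> t1 t t2. lam > 0 \<longrightarrow> \<epsilon> > 0 \<longrightarrow> 0 \<le> t1 \<longrightarrow> t1 \<le> t \<longrightarrow> t \<le> t2 \<longrightarrow> t2 \<le> 1 \<longrightarrow>
              (\<integral>\<^sup>+ \<omega>. ennreal (exp (lam * Mfun (X \<epsilon> \<omega> t1) (X \<epsilon> \<omega> t) (X \<epsilon> \<omega> t2))) \<partial>M)
                \<le> ennreal (c * exp (C * (lam * \<epsilon>) powr \<alpha> * \<bar>t2 - t1\<bar>)))"
  shows "(\<forall>\<beta>. 0 < \<beta> \<and> \<beta> < 1 / \<alpha> \<longrightarrow>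
            (\<forall>L::real. \<exists>N0::nat. \<forall>N\<ge>N0. \<exists>\<delta>>0. \<forall>\<epsilon>. 0 < \<epsilon> \<and> \<epsilon> < \<delta> \<longrightarrow>
               outer_prob M {\<omega> \<in> space M. \<exists>n::nat. n > N \<and>
                  wM (X \<epsilon> \<omega>) (2 powr (- real n))
                    > ereal (2 * (2 powr (- real n * \<beta>) / (1 - 2 powr (- \<beta>))))}
               \<le> exp (- L / \<epsilon> powr \<alpha>')))
       \<and> ((\<exists>\<D>::real set. countable \<D> \<and> \<D> \<subseteq> {0..1} \<and> {0..1} \<subseteq> closure \<D> \<and> 1 \<in> \<D> \<and>
             (\<forall>q\<in>\<D>. exp_tight M \<alpha>' (\<lambda>\<epsilon> \<omega>. X \<epsilon> \<omega> q) euclidean))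
          \<longrightarrow> exp_tight M \<alpha>' X Dtop)"
proof -
  note P = assms(1) and \<alpha> = assms(2) and \<alpha>' = assms(3) and meas = assms(4) and D = assms(5) and X0 = assms(6)
  obtain c C where c: "0 < c" "0 < C"
    and bd0: "\<forall>lam \<epsilon> t1 t t2. lam > 0 \<longrightarrow> \<epsilon> > 0 \<longrightarrow> 0 \<le> t1 \<longrightarrow> t1 \<le> t \<longrightarrow> t \<le> t2 \<longrightarrow> t2 \<le> 1 \<longrightarrow>
              (\<integral>\<^sup>+ \<omega>. ennreal (exp (lam * Mfun (X \<epsilon> \<omega> t1) (X \<epsilon> \<omega> t) (X \<epsilon> \<omega> t2))) \<partial>M)
                \<le> ennreal (c * exp (C * (lam * \<epsilon>) powr \<alpha> * \<bar>t2 - t1\<bar>))"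
    using assms(7) by (elim exE conjE) (rule that)
  have dc: "\<exists>N0. \<forall>N\<ge>N0. \<exists>\<delta>>0. \<forall>\<epsilon>. 0 < \<epsilon> \<and> \<epsilon> < \<delta> \<longrightarrow>
     outer_prob M {\<omega> \<in> space M. \<not> dyadic_control (X \<epsilon> \<omega>) N \<beta>} \<le> exp (- L / \<epsilon> powr \<alpha>')"
    if "0 < \<beta>" "\<beta> < 1 / \<alpha>" for \<beta> L
    by (rule prob_not_dyadic_control[OF P \<alpha> \<alpha>' meas c bd0[rule_format] that])
  show ?thesis
  proof (intro conjI allI impI)
    fix \<beta> L :: real assume \<beta>: "0 < \<beta> \<and> \<beta> < 1 / \<alpha>"
    \<comment> \<open>Dyadic control beyond \<open>N\<close> bounds \<open>wM\<close> at all scales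
      2^(-n) with n > N simultaneously, so the whole union over n lies in one event.\<close>
    have sub: "outer_prob M {\<omega> \<in> space M. \<exists>n::nat. n > N \<and> wM (X \<epsilon> \<omega>) (2 powr (- real n))
                    > ereal (2 * (2 powr (- real n * \<beta>) / (1 - 2 powr (- \<beta>))))}
       \<le> outer_prob M {\<omega> \<in> space M. \<not> dyadic_control (X \<epsilon> \<omega>) N \<beta>}" if "0 < \<epsilon>" for \<epsilon> N
    proof (rule outer_prob_mono, safe)
      fix \<omega> n assume w: "\<omega> \<in> space M" "N < n"
        "ereal (2 * (2 powr (- real n * \<beta>) / (1 - 2 powr (- \<beta>)))) < wM (X \<epsilon> \<omega>) (2 powr (- real n))"
        "dyadic_control (X \<epsilon> \<omega>) N \<beta>"
      have "wM (X \<epsilon> \<omega>) (2 powr (- real n)) \<le> ereal (chain_bound \<beta> n)"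
        by (rule wM_le_chain_bound[OF w(4) _ w(2) D[OF that w(1)] X0[OF that w(1)]]) (use \<beta> in simp)
      then show False using w(3) unfolding chain_bound_def by simp
    qed
    obtain N0 where N0: "\<forall>N\<ge>N0. \<exists>\<delta>>0. \<forall>\<epsilon>. 0 < \<epsilon> \<and> \<epsilon> < \<delta> \<longrightarrow>
       outer_prob M {\<omega> \<in> space M. \<not> dyadic_control (X \<epsilon> \<omega>) N \<beta>} \<le> exp (- L / \<epsilon> powr \<alpha>')"
      using dc \<beta> by blast
    show "\<exists>N0::nat. \<forall>N\<ge>N0. \<exists>\<delta>>0. \<forall>\<epsilon>. 0 < \<epsilon> \<and> \<epsilon> < \<delta> \<longrightarrow>
               outer_prob M {\<omega> \<in> space M. \<exists>n::nat. n > N \<and>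
                  wM (X \<epsilon> \<omega>) (2 powr (- real n))
                    > ereal (2 * (2 powr (- real n * \<beta>) / (1 - 2 powr (- \<beta>))))}
               \<le> exp (- L / \<epsilon> powr \<alpha>')"
    proof (intro exI[of _ N0] allI impI)
      fix N assume "N0 \<le> N"
      then obtain \<delta> where "\<delta> > 0" "\<And>\<epsilon>. 0 < \<epsilon> \<Longrightarrow> \<epsilon> < \<delta> \<Longrightarrow>
         outer_prob M {\<omega> \<in> space M. \<not> dyadic_control (X \<epsilon> \<omega>) N \<beta>} \<le> exp (- L / \<epsilon> powr \<alpha>')"
        using N0 by blast
      then show "\<exists>\<delta>>0. \<forall>\<epsilon>. 0 < \<epsilon> \<and> \<epsilon> < \<delta> \<longrightarrow>
               outer_prob M {\<omega> \<in> space M. \<exists>n::nat. n > N \<and>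
                  wM (X \<epsilon> \<omega>) (2 powr (- real n))
                    > ereal (2 * (2 powr (- real n * \<beta>) / (1 - 2 powr (- \<beta>))))}
               \<le> exp (- L / \<epsilon> powr \<alpha>')"
        using order_trans[OF sub] by (intro exI[of _ \<delta>]) simp
    qed
  next
    assume "\<exists>\<D>::real set. countable \<D> \<and> \<D> \<subseteq> {0..1} \<and> {0..1} \<subseteq> closure \<D> \<and> 1 \<in> \<D> \<and>
             (\<forall>q\<in>\<D>. exp_tight M \<alpha>' (\<lambda>\<epsilon> \<omega>. X \<epsilon> \<omega> q) euclidean)"
    then obtain \<D> :: "real set" where \<D>: "\<D> \<subseteq> {0..1}" "{0..1} \<subseteq> closure \<D>" "1 \<in> \<D>"
      "\<And>q. q \<in> \<D> \<Longrightarrow> exp_tight M \<alpha>' (\<lambda>\<epsilon> \<omega>. X \<epsilon> \<omega> q) euclidean" by blast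
    have \<alpha>'0: "0 < \<alpha>'" using \<alpha> unfolding \<alpha>' by simp
    \<comment> \<open>The second claim does not mention \<beta>; half of the critical exponent
      1/\<alpha> is a convenient choice.\<close>
    have \<beta>: "0 < 1 / (2 * \<alpha>)" "1 / (2 * \<alpha>) < 1 / \<alpha>" using \<alpha> by (auto simp: field_simps)
    show "exp_tight M \<alpha>' X Dtop"
      by (rule exp_tight_Dtop[OF P \<alpha>'0 \<beta>(1) D X0 _ \<D>]) (use dc[OF \<beta>] in blast)+
  qed
qed

end
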